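(* Assume the Riemann hypothesis. Then for every arbitrarily large fixed $A\geqslant 1$ there exist constants $T_{0},c_{0}$ and $h$, depending only on $A$, such that for every $T\geqslant T_{0}$, with $H=\frac{1}{\pi}\ln\ln\ln T+c_{0}$, \[ \min_{|t-T|\leqslant H}\bigl(S(t+h)-S(t-h)\bigr)<-A. \]
   Context: $S(t)=\frac{1}{\pi}\arg\zeta(0.5+it)$: for $t$ not the ordinate of a zero of $\zeta$, the argument is obtained by continuous variation along the horizontal half-line $\{\sigma+it:\sigma\geqslant 0.5\}$ starting from the value $0$ at $\sigma=+\infty$; at ordinates of zeros, $S(t)=\frac12(S(t+0)+S(t-0))$. *)

theory Defs
  imports "HOL-Complex_Analysis.Complex_Analysis"
begin

text \<open>
  The Riemann zeta function is the analytic continuation of the Dirichlet series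
  \<open>1 + 1/2\<^sup>s + 1/3\<^sup>s + \<dots>\<close> from \<open>Re s > 1\<close> to the punctured plane. The value at the pole is
  fixed to \<open>0\<close> only to make the description unique; existence and uniqueness are proved in
  \<open>is_zeta_ex1\<close> below.
\<close>

definition is_zeta :: "(complex \<Rightarrow> complex) \<Rightarrow> bool" where
  "is_zeta f \<longleftrightarrow> f holomorphic_on (- {1}) \<and>
     (\<forall>s. Re s > 1 \<longrightarrow> f s = (\<Sum>n. 1 / of_nat (Suc n) powr s)) \<and> f 1 = 0"

definition zeta :: "complex \<Rightarrow> complex" where
  "zeta = (THE f. is_zeta f)"

definition riemann_hypothesis :: bool where
  "riemann_hypothesis \<longleftrightarrow>
     (\<forall>s. 0 < Re s \<and> Re s < 1 \<and> zeta s = 0 \<longrightarrow> Re s = 1 / 2)"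

text \<open>
  The ordinate \<open>0\<close> of the pole is also the ordinate of the zeros \<open>-2, -4, \<dots>\<close>, so the horizontal
  half-lines used to define the argument never meet the pole.
\<close>

definition zeta_zero_ordinate :: "real \<Rightarrow> bool" where
  "zeta_zero_ordinate t \<longleftrightarrow> (\<exists>s. zeta s = 0 \<and> Im s = t)"

text \<open>
  \<open>is_arg_zeta t \<theta>\<close>: \<open>\<theta> \<sigma>\<close> is the argument of \<open>\<zeta>(\<sigma> + it)\<close>, \<open>\<sigma> \<ge> 1/2\<close>, obtained by
  continuous variation from the value \<open>0\<close> at \<open>\<sigma> = +\<infinity>\<close>.
\<close>

definition is_arg_zeta :: "real \<Rightarrow> (real \<Rightarrow> real) \<Rightarrow> bool" where
  "is_arg_zeta t \<theta> \<longleftrightarrow>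
     continuous_on {1 / 2..} \<theta> \<and>
     (\<forall>\<sigma>\<ge>1 / 2. zeta (Complex \<sigma> t) = of_real (cmod (zeta (Complex \<sigma> t))) * cis (\<theta> \<sigma>)) \<and>
     (\<theta> \<longlongrightarrow> 0) at_top"

definition S_regular :: "real \<Rightarrow> real" where
  "S_regular t = (THE x. \<exists>\<theta>. is_arg_zeta t \<theta> \<and> x = \<theta> (1 / 2) / pi)"

text \<open>
  Ordinates of zeros are isolated, so the one-sided limits \<open>S(t \<plusminus> 0)\<close> only involve
  values of \<open>S\<close> at points that are not ordinates of zeros.
\<close>

definition S :: "real \<Rightarrow> real" where
  "S t = (if zeta_zero_ordinate t
          then (Lim (at_right t) S_regular + Lim (at_left t) S_regular) / 2
          else S_regular t)"

subsection \<open>Existence and uniqueness of the analytic continuation\<close>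

definition ffact :: "nat \<Rightarrow> complex \<Rightarrow> complex" where
  "ffact j a = (\<Prod>k<j. a - of_nat k)"

lemma ffact_holomorphic: "f holomorphic_on A \<Longrightarrow> (\<lambda>s. ffact j (f s)) holomorphic_on A"
  unfolding ffact_def by (intro holomorphic_intros)

lemma norm_ffact_le: "cmod a \<le> R \<Longrightarrow> cmod (ffact j a) \<le> (R + real j) ^ j"
proof -
  assume a: "cmod a \<le> R"
  have "cmod (ffact j a) = (\<Prod>k<j. cmod (a - of_nat k))"
    by (simp add: ffact_def prod_norm)
  also have "\<dots> \<le> (\<Prod>k<j. R + real j)"
  proof (intro prod_mono conjI)
    fix k assume "k \<in> {..<j}"
    then have "cmod (a - of_nat k) \<le> cmod a + real k" "real k \<le> real j"
      using norm_triangle_ineq4[of a "of_nat k"] by auto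
    with a show "cmod (a - of_nat k) \<le> R + real j" by linarith
  qed auto
  finally show ?thesis by simp
qed

lemma binomial_remainder:
  assumes a: "cmod a \<le> R" and x: "0 \<le> x" "x \<le> 1"
  shows "cmod ((1 + of_real x) powr a - (\<Sum>j\<le>N. ffact j a / fact j * of_real x ^ j))
           \<le> (R + real (Suc N)) ^ Suc N * 2 powr R * x ^ Suc N"
proof -
  define f where "f = (\<lambda>i z. ffact i a * (1 + z) powr (a - of_nat i))"
  define B where "B = (R + real (Suc N)) ^ Suc N * 2 powr R"
  have R: "R \<ge> 0" using a norm_ge_zero order_trans by blast
  then have B0: "B \<ge> 0" by (simp add: B_def)
  let ?S = "complex_of_real ` {0..1}"
  have "cmod (f 0 (of_real x) - (\<Sum>i\<le>N. f i 0 * (of_real x - 0) ^ i / fact i))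
          \<le> B * cmod (of_real x - 0) ^ Suc N / fact N"
  proof (rule complex_Taylor[where S = ?S])
    show "convex ?S"
      by (intro convex_linear_image) (auto intro: linearI simp: scaleR_conv_of_real)
    show "(f i has_field_derivative f (Suc i) z) (at z within ?S)" if z: "z \<in> ?S" for i z
    proof -
      from z obtain y where y: "z = of_real y" "y \<ge> 0" by auto
      have "1 + z \<notin> \<real>\<^sub>\<le>\<^sub>0"
        using y by (auto simp: complex_nonpos_Reals_iff)
      then have "(f i has_field_derivative
          ffact i a * ((a - of_nat i) * (1 + z) powr (a - of_nat i - 1))) (at z within ?S)"
        unfolding f_def by (auto intro!: derivative_eq_intros)
      then show ?thesis
        by (simp add: f_def ffact_def algebra_simps)
    qed
    show "cmod (f (Suc N) z) \<le> B" if z: "z \<in> ?S" for z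
    proof -
      from z obtain y where y: "z = of_real y" "y \<ge> 0" "y \<le> 1" by auto
      have eq: "1 + z = of_real (1 + y)" using y by simp
      have "cmod ((1 + z) powr (a - of_nat (Suc N))) = (1 + y) powr (Re a - real (Suc N))"
        unfolding eq by (subst norm_powr_real_powr) (use y in auto)
      also have "\<dots> \<le> (1 + y) powr R"
        using y a complex_Re_le_cmod[of a] by (intro powr_mono) auto
      also have "\<dots> \<le> 2 powr R"
        using y R by (intro powr_mono2) auto
      finally have 1: "cmod ((1 + z) powr (a - of_nat (Suc N))) \<le> 2 powr R" .
      show ?thesis
        unfolding f_def B_def norm_mult
        using R by (intro mult_mono 1 norm_ffact_le a) auto
    qed
    show "0 \<in> ?S" by (auto intro!: image_eqI[of _ _ 0])
    show "of_real x \<in> ?S" using x by auto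
  qed
  moreover have "B * cmod (of_real x - 0) ^ Suc N / fact N \<le> B * x ^ Suc N"
  proof -
    have "B * x ^ Suc N / fact N \<le> B * x ^ Suc N / 1"
      using B0 x by (intro divide_left_mono) (auto simp: fact_ge_1)
    then show ?thesis using x by simp
  qed
  ultimately show ?thesis
    by (simp add: f_def B_def ffact_def mult.commute mult.left_commute)
qed

lemma suminf_holomorphic:
  fixes f :: "nat \<Rightarrow> complex \<Rightarrow> complex"
  assumes S: "open A" and hol: "\<And>n. f n holomorphic_on A"
    and bd: "\<And>x. x \<in> A \<Longrightarrow>
      \<exists>d h. 0 < d \<and> summable h \<and> (\<forall>n. \<forall>y\<in>ball x d \<inter> A. norm (f n y) \<le> h n)"
  shows "(\<lambda>s. \<Sum>n. f n s) holomorphic_on A" "\<And>s. s \<in> A \<Longrightarrow> summable (\<lambda>n. f n s)"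
proof -
  have "\<exists>g g'. \<forall>x\<in>A. ((\<lambda>n. f n x) sums g x) \<and> ((\<lambda>n. deriv (f n) x) sums g' x) \<and>
      (g has_field_derivative g' x) (at x)"
  proof (rule series_and_derivative_comparison_local[OF S])
    show "(f n has_field_derivative deriv (f n) x) (at x)" if "x \<in> A" for n x
      using holomorphic_derivI[OF hol S that] .
    show "\<exists>d h. 0 < d \<and> summable h \<and>
        (\<forall>\<^sub>F n in sequentially. \<forall>y\<in>ball x d \<inter> A. norm (f n y) \<le> h n)" if x: "x \<in> A" for x
    proof -
      obtain d h where "0 < d" "summable h" "\<forall>n. \<forall>y\<in>ball x d \<inter> A. norm (f n y) \<le> h n"
        using bd[OF x] by blast
      then show ?thesis by (intro exI[of _ d] exI[of _ h]) auto
    qed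
  qed
  then obtain g g' where g: "\<And>x. x \<in> A \<Longrightarrow> (\<lambda>n. f n x) sums g x"
    "\<And>x. x \<in> A \<Longrightarrow> (g has_field_derivative g' x) (at x)" by blast
  then have "g holomorphic_on A"
    by (auto simp: holomorphic_on_open[OF S])
  then show "(\<lambda>s. \<Sum>n. f n s) holomorphic_on A"
    by (rule holomorphic_transform) (use g(1) sums_unique in blast)
  show "summable (\<lambda>n. f n s)" if "s \<in> A" for s
    using g(1)[OF that] by (rule sums_summable)
qed

lemma summable_Suc_powr: "s < -1 \<Longrightarrow> summable (\<lambda>n. real (Suc n) powr s)"
  using summable_real_powr_iff[of s] summable_Suc_iff[of "\<lambda>n. real n powr s"] by simp

definition dseries :: "complex \<Rightarrow> complex" where
  "dseries s = (\<Sum>n. 1 / of_nat (Suc n) powr s)"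

definition zrem :: "nat \<Rightarrow> nat \<Rightarrow> complex \<Rightarrow> complex" where
  "zrem N n s = of_nat (Suc n) powr (1 - s) *
     ((1 + of_real (1 / real (Suc n))) powr (1 - s)
        - (\<Sum>j\<le>N. ffact j (1 - s) / fact j * of_real (1 / real (Suc n)) ^ j))"

lemma norm_of_nat_Suc_powr: "cmod (of_nat (Suc n) powr s) = real (Suc n) powr Re s"
proof -
  have "of_nat (Suc n) = complex_of_real (real (Suc n))" by simp
  then show ?thesis by (simp only: norm_powr_real_powr of_nat_0_le_iff) (simp add: norm_powr_real_powr)
qed

lemma open_half: "open {s::complex. Re s > c}"
  by (rule open_halfspace_Re_gt)

lemma zrem_sum:
  shows "(\<lambda>s. \<Sum>n. zrem N n s) holomorphic_on {s. Re s > 1 - real N}"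
    and "Re s > 1 - real N \<Longrightarrow> summable (\<lambda>n. zrem N n s)"
proof -
  let ?A = "{s. Re s > 1 - real N}"
  have hol: "zrem N n holomorphic_on ?A" for n
  proof -
    have "1 + complex_of_real (1 / real (Suc n)) \<noteq> 0"
      by (metis add_pos_pos less_irrefl of_nat_0_less_iff of_real_1 of_real_add of_real_eq_0_iff
          zero_less_Suc zero_less_divide_1_iff zero_less_one)
    then show ?thesis
      unfolding zrem_def by (intro holomorphic_intros ffact_holomorphic) auto
  qed
  have bd: "\<exists>d h. 0 < d \<and> summable h \<and> (\<forall>n. \<forall>y\<in>ball s d \<inter> ?A. norm (zrem N n y) \<le> h n)"
    if s: "s \<in> ?A" for s
  proof -
    define d where "d = (Re s - (1 - real N)) / 2"
    have d: "d > 0" using s by (simp add: d_def)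
    define R where "R = cmod (1 - s) + d"
    define C where "C = (R + real (Suc N)) ^ Suc N * 2 powr R"
    have C: "C \<ge> 0" using d by (simp add: C_def R_def)
    define e where "e = d - Re s - real N"
    have "e < -1" using s by (simp add: e_def d_def field_simps)
    then have sm: "summable (\<lambda>n. C * real (Suc n) powr e)"
      by (intro summable_mult summable_Suc_powr)
    have "cmod (zrem N n y) \<le> C * real (Suc n) powr e" if y: "y \<in> ball s d" for n y
    proof -
      have "cmod (1 - y) \<le> cmod (1 - s) + cmod (s - y)"
        using norm_triangle_ineq[of "1 - s" "s - y"] by simp
      then have R: "cmod (1 - y) \<le> R" using y by (simp add: R_def dist_norm)
      have "\<bar>Re (s - y)\<bar> \<le> cmod (s - y)" by (rule abs_Re_le_cmod)
      then have re: "Re s - d \<le> Re y" using y by (simp add: dist_norm)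
      have "cmod (zrem N n y) \<le> real (Suc n) powr (1 - Re y) * (C * (1 / real (Suc n)) ^ Suc N)"
        unfolding zrem_def norm_mult norm_of_nat_Suc_powr C_def
        using binomial_remainder[OF R, of "1 / real (Suc n)" N]
        by (intro mult_mono) auto
      also have "(1 / real (Suc n)) ^ Suc N = real (Suc n) powr (- real (Suc N))"
        by (simp only: powr_minus powr_realpow of_nat_0_less_iff zero_less_Suc)
           (simp add: power_one_over inverse_eq_divide)
      also have "real (Suc n) powr (1 - Re y) * (C * real (Suc n) powr (- real (Suc N)))
          = C * real (Suc n) powr (- Re y - real N)"
        by (simp add: powr_add[symmetric] algebra_simps)
      also have "\<dots> \<le> C * real (Suc n) powr e"
        using re C by (intro mult_left_mono powr_mono) (auto simp: e_def)
      finally show ?thesis .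
    qed
    then show ?thesis using d sm by blast
  qed
  show "(\<lambda>s. \<Sum>n. zrem N n s) holomorphic_on ?A"
    by (rule suminf_holomorphic(1)[OF open_half hol bd])
  show "Re s > 1 - real N \<Longrightarrow> summable (\<lambda>n. zrem N n s)"
    using suminf_holomorphic(2)[OF open_half hol bd] by blast
qed

lemma dseries_term: "1 / of_nat (Suc n) powr s = of_nat (Suc n) powr (- s :: complex)"
  by (simp add: powr_minus divide_inverse)

lemma dseries:
  shows "dseries holomorphic_on {s. Re s > 1}"
    and "Re s > 1 \<Longrightarrow> (\<lambda>n. of_nat (Suc n) powr (- s)) sums dseries s"
proof -
  let ?f = "\<lambda>n s. of_nat (Suc n) powr (- s) :: complex"
  let ?A = "{s. Re s > 1}"
  have hol: "?f n holomorphic_on ?A" for n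
    by (intro holomorphic_intros)
  have bd: "\<exists>d h. 0 < d \<and> summable h \<and> (\<forall>n. \<forall>y\<in>ball s d \<inter> ?A. norm (?f n y) \<le> h n)"
    if s: "s \<in> ?A" for s
  proof -
    define d where "d = (Re s - 1) / 2"
    have d: "d > 0" using s by (simp add: d_def)
    have sm: "summable (\<lambda>n. real (Suc n) powr (d - Re s))"
      by (intro summable_Suc_powr) (use s in \<open>simp add: d_def field_simps\<close>)
    have "cmod (?f n y) \<le> real (Suc n) powr (d - Re s)" if y: "y \<in> ball s d" for n y
    proof -
      have "\<bar>Re (s - y)\<bar> \<le> cmod (s - y)" by (rule abs_Re_le_cmod)
      then have "Re s - d \<le> Re y" using y by (simp add: dist_norm)
      then show ?thesis
        unfolding norm_of_nat_Suc_powr by (intro powr_mono) auto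
    qed
    then show ?thesis using d sm by blast
  qed
  have eq: "dseries = (\<lambda>s. \<Sum>n. ?f n s)"
    by (simp only: dseries_def[abs_def] dseries_term)
  show "dseries holomorphic_on ?A"
    unfolding eq by (rule suminf_holomorphic(1)[OF open_half hol bd])
  show "Re s > 1 \<Longrightarrow> (\<lambda>n. of_nat (Suc n) powr (- s)) sums dseries s"
    unfolding eq using suminf_holomorphic(2)[OF open_half hol bd] by blast
qed

lemma zrem_eq:
  "zrem N n s = of_nat (Suc (Suc n)) powr (1 - s) - of_nat (Suc n) powr (1 - s)
     - (\<Sum>j=1..N. ffact j (1 - s) / fact j * of_nat (Suc n) powr (- (s + of_nat j - 1)))"
proof -
  have p1: "of_nat (Suc n) powr (1 - s) * (1 + of_real (1 / real (Suc n))) powr (1 - s)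
      = of_nat (Suc (Suc n)) powr (1 - s)"
  proof -
    have "complex_of_real (real (Suc n)) powr (1 - s) * of_real (1 + 1 / real (Suc n)) powr (1 - s)
        = (of_real (real (Suc n)) * of_real (1 + 1 / real (Suc n))) powr (1 - s)"
      by (rule powr_times_real[symmetric]) auto
    also have "complex_of_real (real (Suc n)) * of_real (1 + 1 / real (Suc n))
        = of_real (real (Suc (Suc n)))"
      unfolding of_real_mult[symmetric] by (intro arg_cong[of _ _ of_real]) (simp add: field_simps)
    finally show ?thesis by simp
  qed
  have p2: "of_nat (Suc n) powr (1 - s) * (c * of_real (1 / real (Suc n)) ^ j)
      = c * of_nat (Suc n) powr (- (s + of_nat j - 1))" for c j
  proof -
    have nz: "of_nat (Suc n) \<noteq> (0::complex)" by (simp del: of_nat_Suc)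
    have "- (s + of_nat j - 1) = (1 - s) + (- of_nat j)" by simp
    then have "of_nat (Suc n) powr (- (s + of_nat j - 1))
        = of_nat (Suc n) powr (1 - s) * of_nat (Suc n) powr (- of_nat j :: complex)"
      by (simp only: powr_add)
    also have "of_nat (Suc n) powr (- of_nat j :: complex) = of_real (1 / real (Suc n)) ^ j"
      using nz by (simp add: powr_minus powr_nat' power_one_over inverse_eq_divide del: of_nat_Suc)
    finally show ?thesis by simp
  qed
  have "zrem N n s = of_nat (Suc (Suc n)) powr (1 - s)
      - (\<Sum>j\<le>N. ffact j (1 - s) / fact j * of_nat (Suc n) powr (- (s + of_nat j - 1)))"
    unfolding zrem_def right_diff_distrib p1 sum_distrib_left p2 ..
  also have "{..N} = insert 0 {1..N}" by auto
  finally show ?thesis by (simp add: ffact_def algebra_simps)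
qed

lemma zrem_dseries:
  assumes s: "Re s > 1"
  shows "(\<Sum>n. zrem N n s) = - 1 - (\<Sum>j=1..N. ffact j (1 - s) / fact j * dseries (s + of_nat j - 1))"
proof -
  have "(\<lambda>n. of_nat (Suc n) powr (1 - s) :: complex) \<longlonglongrightarrow> 0"
  proof (rule tendsto_norm_zero_cancel)
    have "(\<lambda>n. real (Suc n) powr (1 - Re s)) \<longlonglongrightarrow> 0"
      by (rule tendsto_neg_powr[OF _ filterlim_compose[OF filterlim_real_sequentially filterlim_Suc]])
         (use s in auto)
    then show "(\<lambda>n. cmod (of_nat (Suc n) powr (1 - s))) \<longlonglongrightarrow> 0"
      by (simp only: norm_of_nat_Suc_powr minus_complex.sel one_complex.sel)
  qed
  from telescope_sums[OF this]
  have 1: "(\<lambda>n. of_nat (Suc (Suc n)) powr (1 - s) - of_nat (Suc n) powr (1 - s)) sums (- 1 :: complex)"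
    by simp
  have 2: "(\<lambda>n. \<Sum>j=1..N. ffact j (1 - s) / fact j * of_nat (Suc n) powr (- (s + of_nat j - 1)))
      sums (\<Sum>j=1..N. ffact j (1 - s) / fact j * dseries (s + of_nat j - 1))"
    by (intro sums_sum sums_mult dseries(2)) (use s in auto)
  from sums_diff[OF 1 2] show ?thesis
    unfolding zrem_eq[symmetric] by (rule sums_unique[symmetric])
qed

lemma continuation_step:
  "\<exists>f. f holomorphic_on {s. Re s > 1 - real k} \<and> (\<forall>s. Re s > 1 \<longrightarrow> f s = (s - 1) * dseries s)"
proof (induction k)
  case 0
  show ?case
    by (rule exI[of _ "\<lambda>s. (s - 1) * dseries s"]) (auto intro!: holomorphic_intros dseries(1))
next
  case (Suc k)
  then obtain f where f: "f holomorphic_on {s. Re s > 1 - real k}"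
    "\<And>s. Re s > 1 \<Longrightarrow> f s = (s - 1) * dseries s" by blast
  let ?A = "{s. Re s > 1 - real (Suc k)}"
  define g where "g = (\<lambda>s. 1 + (\<Sum>n. zrem (Suc k) n s)
      - (\<Sum>j=2..Suc k. ffact (j - 1) (1 - s) / fact j * f (s + of_nat j - 1)))"
  have "g holomorphic_on ?A"
    unfolding g_def
  proof (intro holomorphic_intros zrem_sum(1) ffact_holomorphic)
    fix j assume j: "j \<in> {2..Suc k}"
    have "(f \<circ> (\<lambda>s. s + of_nat j - 1)) holomorphic_on ?A"
      by (rule holomorphic_on_compose_gen[OF _ f(1)]) (use j in \<open>auto intro!: holomorphic_intros\<close>)
    then show "(\<lambda>s. f (s + of_nat j - 1)) holomorphic_on ?A" by (simp add: o_def)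
  qed auto
  moreover have "g s = (s - 1) * dseries s" if s: "Re s > 1" for s
  proof -
    have "ffact j (1 - s) / fact j * dseries (s + of_nat j - 1)
        = - (ffact (j - 1) (1 - s) / fact j * f (s + of_nat j - 1))"
      if j: "j \<in> {2..Suc k}" for j
    proof -
      have f': "f (s + of_nat j - 1) = (s + of_nat j - 2) * dseries (s + of_nat j - 1)"
        by (subst f(2)) (use s j in auto)
      obtain i where i: "j = Suc i" using j by (cases j) auto
      have "ffact j (1 - s) = - (ffact (j - 1) (1 - s) * (s + of_nat j - 2))"
        by (simp add: i ffact_def algebra_simps)
      then show ?thesis unfolding f' by simp
    qed
    then have "(\<Sum>j=2..Suc k. ffact j (1 - s) / fact j * dseries (s + of_nat j - 1))
        = - (\<Sum>j=2..Suc k. ffact (j - 1) (1 - s) / fact j * f (s + of_nat j - 1))"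
      by (simp add: sum_negf[symmetric])
    moreover have "{1..Suc k} = insert 1 {2..Suc k}" by auto
    ultimately have "(\<Sum>n. zrem (Suc k) n s) = - 1 - ((1 - s) * dseries s
        - (\<Sum>j=2..Suc k. ffact (j - 1) (1 - s) / fact j * f (s + of_nat j - 1)))"
      using zrem_dseries[OF s, of "Suc k"] by (simp add: ffact_def)
    then show ?thesis unfolding g_def by (simp add: algebra_simps)
  qed
  ultimately show ?case by blast
qed

lemma continuation_exists:
  "\<exists>F. F holomorphic_on UNIV \<and> (\<forall>s. Re s > 1 \<longrightarrow> F s = (s - 1) * dseries s)"
proof -
  define H where "H = (\<lambda>k::nat. {s::complex. Re s > 1 - real k})"
  obtain f where f: "\<And>k. f k holomorphic_on H k"
    "\<And>k s. Re s > 1 \<Longrightarrow> f k s = (s - 1) * dseries s"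
    using continuation_step unfolding H_def by metis
  have oH: "open (H k)" for k unfolding H_def by (rule open_half)
  have cH: "connected (H k)" for k
    unfolding H_def by (intro convex_connected convex_halfspace_Re_gt)
  have mono: "H k \<subseteq> H l" if "k \<le> l" for k l using that by (auto simp: H_def)
  have eq: "f k s = f l s" if kl: "k \<le> l" and s: "s \<in> H k" for k l s
  proof -
    have "f k s - f l s = 0"
    proof (rule analytic_continuation_open[of "H 0" "H k" "\<lambda>s. f k s - f l s" "\<lambda>_. 0"])
      have "(2::complex) \<in> H 0" by (simp add: H_def)
      then show "H 0 \<noteq> {}" by blast
      show "(\<lambda>s. f k s - f l s) holomorphic_on H k"
        using f(1)[of k] f(1)[of l] mono[OF kl] by (intro holomorphic_intros) (auto intro: holomorphic_on_subset)
      show "f k z - f l z = 0" if "z \<in> H 0" for z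
        using that f(2)[of z] by (simp add: H_def)
    qed (use oH cH mono s in auto)
    then show ?thesis by simp
  qed
  define m where "m = (\<lambda>s::complex. LEAST k. s \<in> H k)"
  have mH: "s \<in> H (m s)" for s
  proof -
    obtain k :: nat where "1 - Re s < real k" using reals_Archimedean2 by blast
    then have "s \<in> H k" by (simp add: H_def)
    then show ?thesis unfolding m_def by (rule LeastI)
  qed
  define F where "F = (\<lambda>s. f (m s) s)"
  have Ff: "F s = f k s" if "s \<in> H k" for k s
  proof -
    have "m s \<le> k" using that unfolding m_def by (rule Least_le)
    then show ?thesis unfolding F_def by (rule eq[OF _ mH])
  qed
  have "F holomorphic_on (\<Union>k\<in>UNIV. H k)"
    by (rule holomorphic_on_UN_open)
       (use oH Ff in \<open>auto intro: holomorphic_transform[OF f(1)]\<close>)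
  moreover have "(\<Union>k\<in>UNIV. H k) = UNIV" using mH by blast
  moreover have "F s = (s - 1) * dseries s" if "Re s > 1" for s
    using Ff[of s 0] f(2)[OF that] that by (simp add: H_def)
  ultimately show ?thesis by auto
qed

lemma is_zeta_ex1: "\<exists>!f. is_zeta f"
proof (rule ex_ex1I)
  obtain F where F: "F holomorphic_on UNIV" "\<And>s. Re s > 1 \<Longrightarrow> F s = (s - 1) * dseries s"
    using continuation_exists by blast
  define f where "f = (\<lambda>s. F s / (s - 1))"
  have "is_zeta f"
    unfolding is_zeta_def
  proof (intro conjI allI impI)
    show "f holomorphic_on - {1}"
      unfolding f_def by (intro holomorphic_intros holomorphic_on_subset[OF F(1)]) auto
    fix s :: complex assume s: "Re s > 1"
    then have "s \<noteq> 1" by auto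
    then show "f s = (\<Sum>n. 1 / of_nat (Suc n) powr s)"
      unfolding dseries_def[symmetric] f_def F(2)[OF s] by simp
  qed (simp add: f_def)
  then show "\<exists>f. is_zeta f" by blast
next
  fix f g assume f: "is_zeta f" and g: "is_zeta g"
  show "f = g"
  proof
    fix s :: complex
    show "f s = g s"
    proof (cases "s = 1")
      case True
      then show ?thesis using f g by (simp add: is_zeta_def)
    next
      case False
      show ?thesis
      proof (rule analytic_continuation_open[of "{s. Re s > 1}" "- {1}" f g])
        have "(2::complex) \<in> {s. Re s > 1}" by simp
        then show "{s::complex. Re s > 1} \<noteq> {}" by blast
        show "connected (- {1::complex})"
          by (rule connected_punctured_universe) simp
        show "f z = g z" if "z \<in> {s. Re s > 1}" for z
          using that f g by (simp add: is_zeta_def)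
      qed (use f g False in \<open>auto simp: is_zeta_def open_half\<close>)
    qed
  qed
qed

lemma is_zeta_zeta: "is_zeta zeta"
  unfolding zeta_def by (rule theI'[OF is_zeta_ex1])

end

theory Submission
  imports Defs "HOL-Number_Theory.Prime_Powers" "HOL-Probability.Sinc_Integral"
    "HOL-Real_Asymp.Real_Asymp"
begin

text \<open>
  Let \<open>K = \<phi> * \<phi>\<close> with \<open>\<phi>(v) = exp (- c (cosh 2\<pi>v + cosh \<pi>v))\<close>. Then \<open>K \<ge> 0\<close>, its Fourier
  transform \<open>K\<^sup>^ = (\<phi>\<^sup>^)\<^sup>2\<close> is nonnegative and \<open>O(exp (- x/2) / (1 + x\<^sup>2))\<close>, and \<open>K(u)\<close> is at most
  \<open>B exp (- c exp (\<pi> |u|))\<close>. This decay of \<open>K\<^sup>^\<close> is just enough to continue, under the Riemann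
  hypothesis, the identity obtained by integrating the Dirichlet series of \<open>log \<zeta>\<close> against \<open>K\<close>
  down to the critical line: up to \<open>O(1)\<close> and a term from the pole that vanishes as \<open>t \<rightarrow> \<infinity>\<close>, the
  average of \<open>\<pi> (S(t + u + h) - S(t + u - h))\<close> over \<open>u\<close> with weight \<open>K(u)\<close> is
  \<open>- 2 \<Sum> \<Lambda>(n) / (log n \<surd>n) sin (h log n) K\<^sup>^(log n) cos (t log n)\<close>.

  At an almost period \<open>t\<close> of the first \<open>n\<^sup>i\<^sup>t\<close> all the cosines are close to \<open>1\<close>; such \<open>t\<close> exist
  within a bounded distance of every \<open>T\<close>. Averaging the resulting sum over \<open>h\<close> with weight
  \<open>exp (- h)\<close> replaces \<open>sin (h log n)\<close> by the positive number \<open>log n / (1 + log\<^sup>2 n)\<close>. As \<open>c \<rightarrow> \<infinity>\<close>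
  the transform \<open>K\<^sup>^\<close>, divided by \<open>K\<^sup>^(0)\<close>, tends to \<open>1\<close> and the sum diverges because
  \<open>\<Sum> \<Lambda>(n) / (n log n)\<close> does. So some \<open>h\<close> makes the average smaller than \<open>- A\<close>.

  For \<open>|u|\<close> beyond \<open>\<pi>\<^sup>-\<^sup>1 log log log T + O(1)\<close> the weight \<open>K(u)\<close> is smaller than \<open>(log T)\<^sup>-\<^sup>2\<close>,
  so there it suffices that the increments of \<open>S\<close> are at least \<open>- O(log T)\<close>. This one-sided bound
  holds because the zeros lie on or to the left of the critical line and hence contribute
  positively to \<open>Re (\<zeta>'/\<zeta>)\<close> on its right.
\<close>

section \<open>Logarithmic derivatives and zeros\<close>

lemma Borel_Caratheodory_unit_disc:
  assumes holo: "f holomorphic_on ball 0 1" and zero: "f 0 = 0" and A: "A > 0"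
    and Re_less: "\<And>z. cmod z < 1 \<Longrightarrow> Re (f z) < A" and z: "cmod z < 1"
  shows "cmod (f z) \<le> 2 * A * cmod z / (1 - cmod z)"
proof -
  define g where "g = (\<lambda>z. f z / (2 * of_real A - f z))"
  have denom: "2 * of_real A - f w \<noteq> 0" if "cmod w < 1" for w
  proof
    assume "2 * of_real A - f w = 0"
    then have "Re (2 * of_real A - f w) = 0" by simp
    then show False using Re_less[OF that] A by simp
  qed
  have "cmod (g z) \<le> cmod z"
  proof (rule Schwarz_Lemma(1))
    show "g holomorphic_on ball 0 1"
      unfolding g_def using denom by (intro holomorphic_intros holo) auto
    show "g 0 = 0" by (simp add: g_def zero)
    fix w :: complex assume w: "cmod w < 1"
    have "A * Re (f w) < A * A" using Re_less[OF w] A by simp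
    then have "(cmod (f w))\<^sup>2 < (cmod (2 * of_real A - f w))\<^sup>2"
      unfolding cmod_power2 by (simp add: power2_eq_square algebra_simps)
    then have "cmod (f w) < cmod (2 * of_real A - f w)"
      by (rule power_less_imp_less_base) simp
    then show "cmod (g w) < 1"
      unfolding g_def norm_divide using denom[OF w] by simp
  qed (use z in auto)
  moreover have "cmod (2 * of_real A - f z) \<le> 2 * A + cmod (f z)"
    using norm_triangle_ineq4[of "2 * of_real A" "f z"] A by simp
  moreover have "f z = g z * (2 * of_real A - f z)"
    using denom[OF z] by (simp add: g_def)
  then have "cmod (f z) = cmod (g z) * cmod (2 * of_real A - f z)"
    by (metis norm_mult)
  ultimately have "cmod (f z) \<le> cmod z * (2 * A + cmod (f z))"
    by (simp add: mult_mono)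
  then show ?thesis
    using z by (simp add: pos_le_divide_eq algebra_simps)
qed

lemma Borel_Caratheodory:
  assumes holo: "f holomorphic_on ball z\<^sub>0 R" and zero: "f z\<^sub>0 = 0" and "A > 0"
    and Re_less: "\<And>z. z \<in> ball z\<^sub>0 R \<Longrightarrow> Re (f z) < A" and z: "z \<in> ball z\<^sub>0 R"
  shows "cmod (f z) \<le> 2 * A * dist z\<^sub>0 z / (R - dist z\<^sub>0 z)"
proof -
  have R: "R > 0" using z by (metis ball_eq_empty empty_iff not_le)
  define p where "p = (\<lambda>w. f (z\<^sub>0 + of_real R * w))"
  define w where "w = (z - z\<^sub>0) / of_real R"
  have in_ball: "z\<^sub>0 + of_real R * u \<in> ball z\<^sub>0 R" if "cmod u < 1" for u
    using that R by (simp add: dist_norm norm_mult)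
  have cmod_w: "cmod w = dist z\<^sub>0 z / R"
    using R by (simp add: w_def norm_divide dist_norm norm_minus_commute)
  have "cmod (p w) \<le> 2 * A * cmod w / (1 - cmod w)"
  proof (rule Borel_Caratheodory_unit_disc)
    have "(f \<circ> (\<lambda>w. z\<^sub>0 + of_real R * w)) holomorphic_on ball 0 1"
      by (rule holomorphic_on_compose_gen[OF _ holo]) (auto intro!: holomorphic_intros in_ball)
    then show "p holomorphic_on ball 0 1" by (simp add: p_def o_def)
    show "Re (p u) < A" if "cmod u < 1" for u
      unfolding p_def by (intro Re_less in_ball that)
  qed (use \<open>A > 0\<close> zero z R in \<open>auto simp: p_def cmod_w\<close>)
  also have "\<dots> = 2 * A * dist z\<^sub>0 z / (R - dist z\<^sub>0 z)"
    using R by (simp add: cmod_w field_simps)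
  finally show ?thesis using R by (simp add: p_def w_def)
qed

lemma Borel_Caratheodory_deriv:
  assumes holo: "f holomorphic_on ball z\<^sub>0 R" and zero: "f z\<^sub>0 = 0" and A: "A > 0"
    and Re_less: "\<And>z. z \<in> ball z\<^sub>0 R \<Longrightarrow> Re (f z) < A" and s: "s \<in> ball z\<^sub>0 R"
  shows "cmod (deriv f s) \<le> 8 * A * R / (R - dist z\<^sub>0 s)\<^sup>2"
proof -
  define e where "e = (R - dist z\<^sub>0 s) / 2"
  have e: "e > 0" "e \<le> R / 2" using s by (auto simp: e_def)
  have near: "dist z\<^sub>0 z \<le> R - e" if "z \<in> cball s e" for z
    using that dist_triangle[of z\<^sub>0 z s] by (simp add: e_def field_simps)
  then have "cball s e \<subseteq> ball z\<^sub>0 R" using e by fastforce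
  then have holo_cball: "f holomorphic_on cball s e" by (rule holomorphic_on_subset[OF holo])
  have f_le: "cmod (f z) \<le> 2 * A * R / e" if z: "z \<in> cball s e" for z
  proof -
    have "cmod (f z) \<le> 2 * A * dist z\<^sub>0 z / (R - dist z\<^sub>0 z)"
      using near[OF z] e by (intro Borel_Caratheodory holo zero A Re_less) auto
    also have "\<dots> \<le> 2 * A * R / e"
      using A near[OF z] e by (intro frac_le mult_left_mono) auto
    finally show ?thesis .
  qed
  have "cmod ((deriv ^^ 1) f s) \<le> fact 1 * (2 * A * R / e) / e ^ 1"
  proof (rule Cauchy_inequality)
    show "f holomorphic_on ball s e"
      by (rule holomorphic_on_subset[OF holo_cball ball_subset_cball])
    show "continuous_on (cball s e) f" by (rule holomorphic_on_imp_continuous_on[OF holo_cball])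
  qed (use e f_le in \<open>auto simp: dist_norm\<close>)
  also have "\<dots> = 8 * A * R / (R - dist z\<^sub>0 s)\<^sup>2" by (simp add: e_def power2_eq_square)
  finally show ?thesis by simp
qed

lemma norm_logderiv_le:
  assumes holo: "g holomorphic_on ball z\<^sub>0 r" and nonzero: "\<And>z. z \<in> ball z\<^sub>0 r \<Longrightarrow> g z \<noteq> 0"
    and A: "A > 0" and bound: "\<And>z. z \<in> ball z\<^sub>0 r \<Longrightarrow> cmod (g z) \<le> exp A * cmod (g z\<^sub>0)"
    and s: "s \<in> ball z\<^sub>0 r"
  shows "cmod (deriv g s / g s) \<le> 16 * A * r / (r - dist z\<^sub>0 s)\<^sup>2"
proof -
  have z\<^sub>0: "z\<^sub>0 \<in> ball z\<^sub>0 r" using s by (simp add: order_le_less_trans[OF zero_le_dist])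
  obtain l where l: "l holomorphic_on ball z\<^sub>0 r" "\<And>z. z \<in> ball z\<^sub>0 r \<Longrightarrow> exp (l z) = g z"
    using holomorphic_logarithm_exists[OF convex_ball open_ball holo nonzero z\<^sub>0] by metis
  define q where "q = (\<lambda>z. l z - l z\<^sub>0)"
  have q: "q holomorphic_on ball z\<^sub>0 r" unfolding q_def by (intro holomorphic_intros l)
  have "cmod (deriv q s) \<le> 8 * (2 * A) * r / (r - dist z\<^sub>0 s)\<^sup>2"
  proof (rule Borel_Caratheodory_deriv[OF q _ _ _ s])
    fix z assume z: "z \<in> ball z\<^sub>0 r"
    have "exp (Re (l z)) = cmod (g z)" using l(2)[OF z] by (metis norm_exp_eq_Re)
    also have "\<dots> \<le> exp A * cmod (g z\<^sub>0)" by (rule bound[OF z])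
    also have "cmod (g z\<^sub>0) = exp (Re (l z\<^sub>0))" using l(2)[OF z\<^sub>0] by (metis norm_exp_eq_Re)
    finally show "Re (q z) < 2 * A" using A by (simp add: q_def flip: exp_add)
  qed (use A in \<open>auto simp: q_def\<close>)
  moreover have "deriv g s = g s * deriv q s"
  proof -
    have "((\<lambda>z. exp (q z + l z\<^sub>0)) has_field_derivative exp (q s + l z\<^sub>0) * deriv q s) (at s)"
      using holomorphic_derivI[OF q open_ball s] by (auto intro!: derivative_eq_intros)
    then have "(g has_field_derivative g s * deriv q s) (at s)"
      using has_field_derivative_transform_within_open[OF _ open_ball s, of _ _ g] l(2) s
      by (simp add: q_def)
    then show ?thesis by (rule DERIV_imp_deriv)
  qed
  ultimately show ?thesis using nonzero[OF s] by simp
qed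

lemma holomorphic_factor_zero:
  assumes f: "f holomorphic_on U" and U: "open U" "connected U" and "\<rho> \<in> U"
    and z\<^sub>0: "z\<^sub>0 \<in> U" "f z\<^sub>0 \<noteq> 0"
  obtains g n where "g holomorphic_on U" "g \<rho> \<noteq> 0" "\<And>s. s \<in> U \<Longrightarrow> f s = (s - \<rho>) ^ n * g s"
proof (cases "f \<rho> = 0")
  case False
  then show ?thesis using that[of f 0] f by simp
next
  case True
  have "\<not> f constant_on U"
    using True z\<^sub>0 \<open>\<rho> \<in> U\<close> unfolding constant_on_def by metis
  then obtain k r n where n: "0 < n" and r: "0 < r" "ball \<rho> r \<subseteq> U"
    and k: "k holomorphic_on ball \<rho> r"
      "\<And>w. w \<in> ball \<rho> r \<Longrightarrow> f w = (w - \<rho>) ^ n * k w" "\<And>w. w \<in> ball \<rho> r \<Longrightarrow> k w \<noteq> 0"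
    using holomorphic_factor_zero_nonconstant[OF f U \<open>\<rho> \<in> U\<close> True] by metis
  define g where "g = (\<lambda>s. if s = \<rho> then k \<rho> else f s / (s - \<rho>) ^ n)"
  have g_eq_k: "g s = k s" if "s \<in> ball \<rho> r" for s
    using that k(2)[OF that] by (simp add: g_def)
  have "g holomorphic_on ball \<rho> r"
    by (rule holomorphic_transform[OF k(1)]) (simp add: g_eq_k)
  moreover have "g holomorphic_on U - {\<rho>}"
  proof (rule holomorphic_transform)
    show "(\<lambda>s. f s / (s - \<rho>) ^ n) holomorphic_on U - {\<rho>}"
      by (intro holomorphic_intros holomorphic_on_subset[OF f]) auto
  qed (simp add: g_def)
  ultimately have "g holomorphic_on (ball \<rho> r \<union> (U - {\<rho>}))"
    using U by (intro holomorphic_on_Un) auto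
  moreover have "ball \<rho> r \<union> (U - {\<rho>}) = U" using r \<open>\<rho> \<in> U\<close> by auto
  ultimately have "g holomorphic_on U" by simp
  moreover have "g \<rho> \<noteq> 0" using k(3) r g_eq_k by simp
  moreover have "f s = (s - \<rho>) ^ n * g s" for s
    using True n by (cases "s = \<rho>") (auto simp: g_def)
  ultimately show ?thesis by (rule that)
qed

lemma holomorphic_factor_finite_zeros:
  assumes "finite F" "F \<subseteq> U" and U: "open U" "connected U"
    and f: "f holomorphic_on U" and z\<^sub>0: "z\<^sub>0 \<in> U" "f z\<^sub>0 \<noteq> 0"
  obtains g m where "g holomorphic_on U" "\<And>\<rho>. \<rho> \<in> F \<Longrightarrow> g \<rho> \<noteq> 0"
    "\<And>s. s \<in> U \<Longrightarrow> f s = (\<Prod>\<rho>\<in>F. (s - \<rho>) ^ m \<rho>) * g s"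
  using assms(1,2)
proof (induction F arbitrary: thesis)
  case empty
  then show ?case using f by simp
next
  case (insert \<rho> F)
  then obtain g m where g: "g holomorphic_on U" "\<And>\<rho>. \<rho> \<in> F \<Longrightarrow> g \<rho> \<noteq> 0"
      "\<And>s. s \<in> U \<Longrightarrow> f s = (\<Prod>\<rho>\<in>F. (s - \<rho>) ^ m \<rho>) * g s" by auto
  have "g z\<^sub>0 \<noteq> 0" using z\<^sub>0 g(3)[of z\<^sub>0] by auto
  then obtain g' n where g': "g' holomorphic_on U" "g' \<rho> \<noteq> 0" "\<And>s. s \<in> U \<Longrightarrow> g s = (s - \<rho>) ^ n * g' s"
    using holomorphic_factor_zero[OF g(1) U, of \<rho> z\<^sub>0] z\<^sub>0 insert.prems by auto
  show ?case
  proof (rule insert.prems(1)[OF g'(1)])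
    show "g' \<sigma> \<noteq> 0" if "\<sigma> \<in> insert \<rho> F" for \<sigma>
      using that g' g(2)[of \<sigma>] insert.prems by auto
    fix s assume s: "s \<in> U"
    have "(\<Prod>\<sigma>\<in>insert \<rho> F. (s - \<sigma>) ^ (m(\<rho> := n)) \<sigma>) = (s - \<rho>) ^ n * (\<Prod>\<sigma>\<in>F. (s - \<sigma>) ^ (m(\<rho> := n)) \<sigma>)"
      using insert.hyps by simp
    also have "(\<Prod>\<sigma>\<in>F. (s - \<sigma>) ^ (m(\<rho> := n)) \<sigma>) = (\<Prod>\<sigma>\<in>F. (s - \<sigma>) ^ m \<sigma>)"
      using insert.hyps by (intro prod.cong) auto
    finally show "f s = (\<Prod>\<sigma>\<in>insert \<rho> F. (s - \<sigma>) ^ (m(\<rho> := n)) \<sigma>) * g' s"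
      using g(3)[OF s] g'(3)[OF s] by simp
  qed
qed

lemma holomorphic_factor_compact_zeros:
  assumes f: "f holomorphic_on U" and U: "open U" "connected U" and A: "compact A" "A \<subseteq> U"
    and z\<^sub>0: "z\<^sub>0 \<in> U" "f z\<^sub>0 \<noteq> 0"
  obtains g m where "g holomorphic_on U" "\<And>s. s \<in> A \<Longrightarrow> g s \<noteq> 0"
    "\<And>s. s \<in> U \<Longrightarrow> f s = (\<Prod>\<rho> | \<rho> \<in> A \<and> f \<rho> = 0. (s - \<rho>) ^ m \<rho>) * g s"
proof -
  define F where "F = {\<rho> \<in> A. f \<rho> = 0}"
  have fin: "finite F"
  proof (cases "f constant_on U")
    case True
    then have "F = {}" using z\<^sub>0 A(2) unfolding constant_on_def F_def by auto
    then show ?thesis by simp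
  next
    case False
    then show ?thesis unfolding F_def by (intro holomorphic_compact_finite_zeros[OF f U A])
  qed
  have F_sub: "F \<subseteq> U" using A(2) by (auto simp: F_def)
  obtain g m where g: "g holomorphic_on U" "\<And>\<rho>. \<rho> \<in> F \<Longrightarrow> g \<rho> \<noteq> 0"
    and fg: "\<And>s. s \<in> U \<Longrightarrow> f s = (\<Prod>\<rho>\<in>F. (s - \<rho>) ^ m \<rho>) * g s"
    using holomorphic_factor_finite_zeros[OF fin F_sub U f z\<^sub>0] by metis
  have "g s \<noteq> 0" if "s \<in> A" for s
    using that g(2)[of s] fg[of s] A(2) by (cases "f s = 0") (auto simp: F_def)
  with g(1) show ?thesis using fg unfolding F_def by (rule that)
qed

lemma logderiv_prod_power_mult:
  assumes "open U" "s \<in> U" and g: "g holomorphic_on U" "g s \<noteq> 0" and "s \<notin> F"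
    and f: "\<And>s. s \<in> U \<Longrightarrow> f s = (\<Prod>\<rho>\<in>F. (s - \<rho>) ^ m \<rho>) * g s"
  shows "deriv f s / f s = (\<Sum>\<rho>\<in>F. of_nat (m \<rho>) / (s - \<rho>)) + deriv g s / g s"
proof (cases "finite F")
  case True
  define P where "P = (\<lambda>s. \<Prod>\<rho>\<in>F. (s - \<rho>) ^ m \<rho>)"
  have "P s \<noteq> 0" using True \<open>s \<notin> F\<close> by (auto simp: P_def)
  have "(P has_field_derivative
      P s * (\<Sum>\<rho>\<in>F. of_nat (m \<rho>) * (s - \<rho>) ^ (m \<rho> - 1) / (s - \<rho>) ^ m \<rho>)) (at s)"
    unfolding P_def
    by (rule has_field_derivative_prod') (use \<open>s \<notin> F\<close> in \<open>auto intro!: derivative_eq_intros\<close>)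
  moreover have "of_nat (m \<rho>) * (s - \<rho>) ^ (m \<rho> - 1) / (s - \<rho>) ^ m \<rho> = of_nat (m \<rho>) / (s - \<rho>)"
    if "\<rho> \<in> F" for \<rho>
    using that \<open>s \<notin> F\<close> by (cases "m \<rho>") (auto simp del: of_nat_Suc)
  ultimately have "(P has_field_derivative P s * (\<Sum>\<rho>\<in>F. of_nat (m \<rho>) / (s - \<rho>))) (at s)"
    by simp
  from DERIV_mult[OF this holomorphic_derivI[OF g(1) \<open>open U\<close> \<open>s \<in> U\<close>]]
  have "(f has_field_derivative
      P s * (\<Sum>\<rho>\<in>F. of_nat (m \<rho>) / (s - \<rho>)) * g s + deriv g s * P s) (at s)"
    by (rule has_field_derivative_transform_within_open[OF _ \<open>open U\<close> \<open>s \<in> U\<close>])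
       (simp add: f P_def)
  then have "deriv f s = P s * (\<Sum>\<rho>\<in>F. of_nat (m \<rho>) / (s - \<rho>)) * g s + deriv g s * P s"
    by (rule DERIV_imp_deriv)
  moreover have "f s = P s * g s" using f[OF \<open>s \<in> U\<close>] by (simp add: P_def)
  ultimately show ?thesis using \<open>P s \<noteq> 0\<close> g(2) by (simp add: field_simps)
next
  case False
  have "deriv f s = deriv g s"
    by (rule deriv_cong_ev)
       (use False assms in \<open>auto simp: eventually_nhds\<close>)
  then show ?thesis using False f[OF \<open>s \<in> U\<close>] by simp
qed

lemma norm_cofactor_le:
  assumes F: "F \<subseteq> cball z\<^sub>0 r" and holo: "g holomorphic_on U" and U: "cball z\<^sub>0 (2 * r) \<subseteq> U"
    and f: "\<And>s. s \<in> U \<Longrightarrow> f s = (\<Prod>\<rho>\<in>F. (s - \<rho>) ^ m \<rho>) * g s" and "r > 0" "f z\<^sub>0 \<noteq> 0"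
    and bound: "\<And>s. s \<in> cball z\<^sub>0 (2 * r) \<Longrightarrow> cmod (f s) \<le> M * cmod (f z\<^sub>0)"
    and w: "w \<in> cball z\<^sub>0 (2 * r)"
  shows "cmod (g w) \<le> M * cmod (g z\<^sub>0)"
proof (rule maximum_modulus_frontier[of g "cball z\<^sub>0 (2 * r)"])
  show "g holomorphic_on interior (cball z\<^sub>0 (2 * r))"
    by (rule holomorphic_on_subset[OF holo]) (use U interior_subset in blast)
  show "continuous_on (closure (cball z\<^sub>0 (2 * r))) g"
    using U by (intro holomorphic_on_imp_continuous_on holomorphic_on_subset[OF holo]) simp
  let ?P = "\<lambda>s. \<Prod>\<rho>\<in>F. (s - \<rho>) ^ m \<rho>"
  have z\<^sub>0: "z\<^sub>0 \<in> U" using U \<open>r > 0\<close> by auto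
  fix z assume "z \<in> frontier (cball z\<^sub>0 (2 * r))"
  then have z: "dist z\<^sub>0 z = 2 * r" using \<open>r > 0\<close> by simp
  then have "z \<in> U" using U by auto
  have "cmod (?P z\<^sub>0) \<le> cmod (?P z)"
    unfolding prod_norm[symmetric] norm_power
  proof (intro prod_mono conjI power_mono)
    fix \<rho> assume "\<rho> \<in> F"
    then have "dist z\<^sub>0 \<rho> \<le> r" using F by auto
    then have "dist z\<^sub>0 \<rho> \<le> dist z \<rho>"
      using z dist_triangle[of z\<^sub>0 z \<rho>] by (simp add: dist_commute)
    then show "cmod (z\<^sub>0 - \<rho>) \<le> cmod (z - \<rho>)" by (simp add: dist_norm)
  qed auto
  then have "cmod (g z) * cmod (?P z\<^sub>0) \<le> cmod (f z)"
    using f[OF \<open>z \<in> U\<close>] by (simp add: norm_mult mult_left_mono mult.commute)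
  also have "\<dots> \<le> M * cmod (g z\<^sub>0) * cmod (?P z\<^sub>0)"
    using bound[of z] z f[OF z\<^sub>0] by (simp add: norm_mult mult_ac)
  finally show "cmod (g z) \<le> M * cmod (g z\<^sub>0)"
    using f[OF z\<^sub>0] \<open>f z\<^sub>0 \<noteq> 0\<close> by simp
qed (use w in auto)

text \<open>Zeros with smaller real part than \<open>s\<close> contribute positively to \<open>Re (f'/f)\<close> at \<open>s\<close>; the
  rest of \<open>f\<close> has a logarithm, to which the Borel--Caratheodory inequality applies.\<close>

lemma Re_logderiv_ge:
  assumes f: "f holomorphic_on U" and U: "open U" "connected U" "cball z\<^sub>0 (2 * r) \<subseteq> U"
    and nonzero: "f z\<^sub>0 \<noteq> 0" and A: "A > 0"
    and bound: "\<And>s. s \<in> cball z\<^sub>0 (2 * r) \<Longrightarrow> cmod (f s) \<le> exp A * cmod (f z\<^sub>0)"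
    and zeros: "\<And>\<rho>. \<rho> \<in> cball z\<^sub>0 r \<Longrightarrow> f \<rho> = 0 \<Longrightarrow> Re \<rho> < Re s" and s: "s \<in> ball z\<^sub>0 r"
  shows "Re (deriv f s / f s) \<ge> - (16 * A * r / (r - dist z\<^sub>0 s)\<^sup>2)"
proof -
  have r: "r > 0" using s by (metis ball_eq_empty empty_iff not_le)
  have z\<^sub>0: "z\<^sub>0 \<in> U" using U r by auto
  have sub: "cball z\<^sub>0 r \<subseteq> U" using U r by (auto simp: subset_iff)
  define F where "F = {\<rho> \<in> cball z\<^sub>0 r. f \<rho> = 0}"
  obtain g m where g: "g holomorphic_on U" and g_nonzero: "\<And>s. s \<in> cball z\<^sub>0 r \<Longrightarrow> g s \<noteq> 0"
    and fg: "\<And>s. s \<in> U \<Longrightarrow> f s = (\<Prod>\<rho>\<in>F. (s - \<rho>) ^ m \<rho>) * g s"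
    using holomorphic_factor_compact_zeros[OF f U(1,2) compact_cball sub z\<^sub>0 nonzero]
    unfolding F_def by metis
  have "cmod (deriv g s / g s) \<le> 16 * A * r / (r - dist z\<^sub>0 s)\<^sup>2"
  proof (rule norm_logderiv_le[OF _ _ A _ s])
    show "g holomorphic_on ball z\<^sub>0 r" by (rule holomorphic_on_subset[OF g]) (use sub in auto)
    show "g z \<noteq> 0" if "z \<in> ball z\<^sub>0 r" for z using that by (intro g_nonzero) simp
    show "cmod (g z) \<le> exp A * cmod (g z\<^sub>0)" if "z \<in> ball z\<^sub>0 r" for z
      by (rule norm_cofactor_le[OF _ g U(3) fg r nonzero bound]) (use that r in \<open>auto simp: F_def\<close>)
  qed
  then have "Re (deriv g s / g s) \<ge> - (16 * A * r / (r - dist z\<^sub>0 s)\<^sup>2)"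
    using abs_Re_le_cmod[of "deriv g s / g s"] by linarith
  moreover have "Re (deriv f s / f s) = (\<Sum>\<rho>\<in>F. Re (of_nat (m \<rho>) / (s - \<rho>))) + Re (deriv g s / g s)"
  proof -
    have "f s \<noteq> 0" using zeros[of s] s by auto
    then have "s \<notin> F" by (simp add: F_def)
    moreover have "s \<in> U" "g s \<noteq> 0" using s sub g_nonzero by auto
    ultimately show ?thesis
      using logderiv_prod_power_mult[OF U(1) _ g _ _ fg] by simp
  qed
  moreover have "(\<Sum>\<rho>\<in>F. Re (of_nat (m \<rho>) / (s - \<rho>))) \<ge> 0"
  proof (rule sum_nonneg)
    fix \<rho> assume "\<rho> \<in> F"
    then have "Re \<rho> < Re s" using zeros[of \<rho>] by (simp add: F_def)
    then show "Re (of_nat (m \<rho>) / (s - \<rho>)) \<ge> 0" by (simp add: Re_divide')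
  qed
  ultimately show ?thesis by linarith
qed

section \<open>Integrals depending on a parameter\<close>

lemma integral_dominated_convergence_at_within:
  fixes f :: "'b::first_countable_topology \<Rightarrow> 'a \<Rightarrow> 'c::{banach, second_countable_topology}"
  assumes meas: "g \<in> borel_measurable M" "\<And>t. t \<in> A \<Longrightarrow> f t \<in> borel_measurable M"
    and w: "integrable M w" and lim: "AE x in M. ((\<lambda>t. f t x) \<longlongrightarrow> g x) (at a within A)"
    and bound: "\<And>t. t \<in> A \<Longrightarrow> AE x in M. norm (f t x) \<le> w x"
  shows "((\<lambda>t. \<integral>x. f t x \<partial>M) \<longlongrightarrow> (\<integral>x. g x \<partial>M)) (at a within A)"
  unfolding tendsto_at_iff_sequentially o_def
proof (intro allI impI)
  fix X assume X: "\<forall>i. X i \<in> A - {a}" "X \<longlonglongrightarrow> a"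
  show "(\<lambda>i. \<integral>x. f (X i) x \<partial>M) \<longlonglongrightarrow> (\<integral>x. g x \<partial>M)"
  proof (rule integral_dominated_convergence[OF meas(1) _ w])
    show "AE x in M. (\<lambda>i. f (X i) x) \<longlonglongrightarrow> g x"
      using lim by eventually_elim (use X in \<open>auto simp: tendsto_at_iff_sequentially o_def\<close>)
  qed (use X meas(2) bound in auto)
qed

lemma norm_diff_le_of_bounded_holomorphic:
  assumes holo: "f holomorphic_on U" and sub: "cball s r \<subseteq> U" and r: "r > 0"
    and bound: "\<And>z. z \<in> cball s r \<Longrightarrow> cmod (f z) \<le> M" and w: "w \<in> cball s (r / 2)"
  shows "cmod (f w - f s) \<le> 2 / r * M * cmod (w - s)"
proof (rule field_differentiable_bound[of "ball s r \<inter> cball s (r / 2)"])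
  fix z assume z: "z \<in> ball s r \<inter> cball s (r / 2)"
  have holo': "f holomorphic_on cball s r" by (rule holomorphic_on_subset[OF holo sub])
  have sub_z: "cball z (r / 2) \<subseteq> cball s r"
  proof
    fix v assume "v \<in> cball z (r / 2)"
    then show "v \<in> cball s r" using z dist_triangle[of s v z] by simp
  qed
  have "f holomorphic_on ball s r" by (rule holomorphic_on_subset[OF holo' ball_subset_cball])
  then have "(f has_field_derivative deriv f z) (at z)"
    by (rule holomorphic_derivI) (use z in auto)
  then show "(f has_field_derivative deriv f z) (at z within ball s r \<inter> cball s (r / 2))"
    by (rule has_field_derivative_at_within)
  have "cmod ((deriv ^^ 1) f z) \<le> fact 1 * M / (r / 2) ^ 1"
  proof (rule Cauchy_inequality)
    show "f holomorphic_on ball z (r / 2)"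
      by (rule holomorphic_on_subset[OF holo']) (use sub_z ball_subset_cball in blast)
    show "continuous_on (cball z (r / 2)) f"
      by (rule holomorphic_on_imp_continuous_on[OF holomorphic_on_subset[OF holo' sub_z]])
    show "cmod (f v) \<le> M" if "cmod (z - v) = r / 2" for v
      by (rule bound) (use that sub_z in \<open>auto simp: dist_norm\<close>)
  qed (use r in auto)
  then show "cmod (deriv f z) \<le> 2 / r * M" by (simp add: mult.commute)
qed (use w r in \<open>auto intro: convex_Int\<close>)

lemma borel_measurable_limit_within:
  fixes q :: "'b::first_countable_topology \<Rightarrow> 'a \<Rightarrow> 'c::metric_space"
  assumes s: "s islimpt A" and meas: "\<And>z. z \<in> A \<Longrightarrow> q z \<in> borel_measurable M"
    and lim: "\<And>x. x \<in> space M \<Longrightarrow> ((\<lambda>z. q z x) \<longlongrightarrow> D x) (at s within A)"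
  shows "D \<in> borel_measurable M"
proof -
  obtain X where X: "\<And>n. X n \<in> A - {s}" "X \<longlonglongrightarrow> s"
    using s unfolding islimpt_sequential by blast
  then have "filterlim X (at s within A) sequentially" by (simp add: filterlim_at)
  then have "(\<lambda>n. q (X n) x) \<longlonglongrightarrow> D x" if "x \<in> space M" for x
    by (rule filterlim_compose[OF lim[OF that]])
  moreover have "q (X n) \<in> borel_measurable M" for n using X(1) by (intro meas) blast
  ultimately show ?thesis by (rule borel_measurable_LIMSEQ_metric[rotated])
qed

lemma has_field_derivative_integral:
  fixes f :: "complex \<Rightarrow> 'a \<Rightarrow> complex"
  assumes U: "open U" "cball s r \<subseteq> U" and r: "r > 0"
    and holo: "\<And>x. x \<in> space M \<Longrightarrow> (\<lambda>z. f z x) holomorphic_on U"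
    and meas: "\<And>z. z \<in> cball s r \<Longrightarrow> f z \<in> borel_measurable M" and w: "integrable M w"
    and bound: "\<And>z x. z \<in> cball s r \<Longrightarrow> x \<in> space M \<Longrightarrow> cmod (f z x) \<le> w x"
  shows "((\<lambda>z. \<integral>x. f z x \<partial>M) has_field_derivative (\<integral>x. deriv (\<lambda>z. f z x) s \<partial>M)) (at s)"
proof -
  have s: "s \<in> U" using U r by auto
  define q where "q = (\<lambda>z x. (f z x - f s x) / (z - s))"
  define D where "D = (\<lambda>x. deriv (\<lambda>z. f z x) s)"
  define A where "A = ball s (r / 2) - {s}"
  have A: "at s within A = at s"
    unfolding A_def by (rule at_within_nhd[of _ "ball s (r / 2)"]) (use r in auto)
  have q_meas: "q z \<in> borel_measurable M" if "z \<in> A" for z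
    unfolding q_def using meas that r
    by (intro borel_measurable_divide borel_measurable_diff) (auto simp: A_def)
  have q_lim: "((\<lambda>z. q z x) \<longlongrightarrow> D x) (at s within A)" if "x \<in> space M" for x
    using holomorphic_derivI[OF holo[OF that] U(1) s]
    unfolding A by (simp add: D_def q_def has_field_derivative_iff)
  have q_bound: "cmod (q z x) \<le> 2 / r * w x" if z: "z \<in> A" and x: "x \<in> space M" for z x
  proof -
    have "cmod (f z x - f s x) \<le> 2 / r * w x * cmod (z - s)"
      using z by (intro norm_diff_le_of_bounded_holomorphic[OF holo[OF x] U(2) r] bound x)
        (auto simp: A_def)
    then show ?thesis using z by (simp add: A_def q_def norm_divide pos_divide_le_eq)
  qed
  have "s islimpt A" using A trivial_limit_within[of s A] by simp
  then have D_meas: "D \<in> borel_measurable M"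
    by (rule borel_measurable_limit_within[OF _ q_meas q_lim])
  have "((\<lambda>z. \<integral>x. q z x \<partial>M) \<longlongrightarrow> (\<integral>x. D x \<partial>M)) (at s within A)"
  proof (rule integral_dominated_convergence_at_within[OF D_meas q_meas])
    show "integrable M (\<lambda>x. 2 / r * w x)" using w by simp
  qed (use q_lim q_bound in auto)
  moreover have int: "integrable M (f z)" if "z \<in> cball s r" for z
    using that r bound[OF that] by (intro Bochner_Integration.integrable_bound[OF w] meas)
      (auto intro!: AE_I2 order_trans[OF _ abs_ge_self])
  then have "(\<integral>x. q z x \<partial>M) = ((\<integral>x. f z x \<partial>M) - (\<integral>x. f s x \<partial>M)) / (z - s)" if "z \<in> A" for z
    unfolding q_def using that int[of z] int[of s] r by (simp add: A_def)
  then have "\<forall>\<^sub>F z in at s within A. (\<integral>x. q z x \<partial>M) = ((\<integral>x. f z x \<partial>M) - (\<integral>x. f s x \<partial>M)) / (z - s)"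
    unfolding eventually_at_filter by (intro always_eventually) auto
  ultimately have "((\<lambda>z. ((\<integral>x. f z x \<partial>M) - (\<integral>x. f s x \<partial>M)) / (z - s))
      \<longlongrightarrow> (\<integral>x. D x \<partial>M)) (at s within A)"
    by (rule Lim_transform_eventually)
  then show ?thesis unfolding A by (simp add: D_def has_field_derivative_iff)
qed

lemma holomorphic_integral:
  fixes f :: "complex \<Rightarrow> 'a \<Rightarrow> complex"
  assumes U: "open U" and holo: "\<And>x. x \<in> space M \<Longrightarrow> (\<lambda>s. f s x) holomorphic_on U"
    and meas: "\<And>s. s \<in> U \<Longrightarrow> f s \<in> borel_measurable M"
    and dominated: "\<And>s. s \<in> U \<Longrightarrow> \<exists>r>0. \<exists>w. cball s r \<subseteq> U \<and> integrable M w \<and>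
                      (\<forall>z\<in>cball s r. \<forall>x\<in>space M. cmod (f z x) \<le> w x)"
  shows "(\<lambda>s. \<integral>x. f s x \<partial>M) holomorphic_on U"
  unfolding holomorphic_on_open[OF U]
proof (intro ballI)
  fix s assume "s \<in> U"
  then obtain r w where r: "r > 0" "cball s r \<subseteq> U" and w: "integrable M w"
    and bound: "\<forall>z\<in>cball s r. \<forall>x\<in>space M. cmod (f z x) \<le> w x"
    using dominated by blast
  have "((\<lambda>s. \<integral>x. f s x \<partial>M) has_field_derivative (\<integral>x. deriv (\<lambda>s. f s x) s \<partial>M)) (at s)"
    by (rule has_field_derivative_integral[OF U r(2,1) holo _ w]) (use r meas bound in auto)
  then show "\<exists>D. ((\<lambda>s. \<integral>x. f s x \<partial>M) has_field_derivative D) (at s)" by blast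
qed

lemma lborel_integral_translate:
  fixes f :: "real \<Rightarrow> 'a :: {banach, second_countable_topology}"
  shows "(\<integral>x. f (x + t) \<partial>lborel) = (\<integral>x. f x \<partial>lborel)"
  using lborel_integral_real_affine[of 1 f t, symmetric] by (simp add: add.commute)

lemma lborel_integrable_translate:
  fixes f :: "real \<Rightarrow> 'a :: {banach, second_countable_topology}"
  shows "integrable lborel f \<Longrightarrow> integrable lborel (\<lambda>x. f (x + t))"
  using lborel_integrable_real_affine[of f 1 t] by (simp add: add.commute)

section \<open>Functions of quadratic decay\<close>

lemma one_plus_square_pos: "0 < 1 + (x::real)\<^sup>2"
  by (simp add: add_pos_nonneg)

lemma integral_quadratic_decay:
  shows "integrable lborel (\<lambda>x::real. C / (1 + x\<^sup>2))"
    and "(\<integral>x. C / (1 + x\<^sup>2) \<partial>lborel) = C * pi"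
proof -
  show "integrable lborel (\<lambda>x::real. C / (1 + x\<^sup>2))"
    using integrable_inverse_1_plus_square
    by (simp add: set_integrable_def einterval_def divide_inverse)
  have "(\<integral>x. inverse (1 + x\<^sup>2) \<partial>lborel) = pi"
    using LBINT_inverse_1_plus_square
    by (simp add: interval_lebesgue_integral_def set_lebesgue_integral_def einterval_def)
  then show "(\<integral>x. C / (1 + x\<^sup>2) \<partial>lborel) = C * pi"
    by (simp add: divide_inverse)
qed

lemma integrable_quadratic_decay:
  fixes f :: "real \<Rightarrow> 'a :: {banach, second_countable_topology}"
  assumes f: "f \<in> borel_measurable borel" and bound: "\<And>x. norm (f x) \<le> C / (1 + x\<^sup>2)"
  shows "integrable lborel f"
proof (rule Bochner_Integration.integrable_bound[OF integral_quadratic_decay(1)[of C]])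
  show "AE x in lborel. norm (f x) \<le> norm (C / (1 + x\<^sup>2))"
    using order_trans[OF bound abs_ge_self] by simp
qed (use f in simp)

lemma quadratic_decay_translate:
  fixes x r :: real
  shows "1 / (1 + (x + r)\<^sup>2) \<le> (2 + 2 * r\<^sup>2) / (1 + x\<^sup>2)"
proof -
  have "x\<^sup>2 \<le> 2 * (x + r)\<^sup>2 + 2 * r\<^sup>2"
    using sum_squares_ge_zero[of "x + 2 * r" 0] by (simp add: power2_eq_square algebra_simps)
  moreover have "0 \<le> (x + r)\<^sup>2 * r\<^sup>2" by simp
  moreover have expand: "(2 + 2 * b) * (1 + a) = 2 + 2 * a + 2 * b + 2 * (a * b)" for a b :: real
    by (simp add: algebra_simps)
  ultimately have "1 + x\<^sup>2 \<le> (2 + 2 * r\<^sup>2) * (1 + (x + r)\<^sup>2)"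
    unfolding expand by linarith
  then show ?thesis
    using one_plus_square_pos[of "x + r"] one_plus_square_pos[of x]
    by (simp add: divide_le_eq pos_le_divide_eq mult.commute)
qed

lemma quadratic_decay_translate_le:
  fixes C x r R :: real
  assumes "C \<ge> 0" "\<bar>r\<bar> \<le> R"
  shows "C / (1 + (x + r)\<^sup>2) \<le> C * (2 + 2 * R\<^sup>2) / (1 + x\<^sup>2)"
proof -
  have "C * (1 / (1 + (x + r)\<^sup>2)) \<le> C * ((2 + 2 * r\<^sup>2) / (1 + x\<^sup>2))"
    by (intro mult_left_mono quadratic_decay_translate assms)
  also have "r\<^sup>2 \<le> R\<^sup>2" using assms(2) by (metis power2_abs power_mono abs_ge_zero)
  then have "C * ((2 + 2 * r\<^sup>2) / (1 + x\<^sup>2)) \<le> C * ((2 + 2 * R\<^sup>2) / (1 + x\<^sup>2))"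
    using assms(1) by (intro mult_left_mono divide_right_mono) auto
  finally show ?thesis by simp
qed

definition fourier :: "(real \<Rightarrow> complex) \<Rightarrow> real \<Rightarrow> complex" where
  "fourier f x = (\<integral>v. f v * cis (- (x * v)) \<partial>lborel)"

locale strip_decay =
  fixes \<Psi> :: "complex \<Rightarrow> complex" and a C :: real
  assumes holomorphic: "\<Psi> holomorphic_on {z. \<bar>Im z\<bar> < a}"
    and decay: "\<bar>Im z\<bar> < a \<Longrightarrow> cmod (\<Psi> z) \<le> C / (1 + (Re z)\<^sup>2)"
begin

lemma strip_eq: "{z. \<bar>Im z\<bar> < a} = {z. Im z < a} \<inter> {z. Im z > - a}"
  by auto

lemma open_strip: "open {z. \<bar>Im z\<bar> < a}"
  unfolding strip_eq by (intro open_Int open_halfspace_Im_lt open_halfspace_Im_gt)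

lemma connected_strip: "connected {z. \<bar>Im z\<bar> < a}"
  unfolding strip_eq
  by (intro convex_connected convex_Int convex_halfspace_Im_lt convex_halfspace_Im_gt)

lemma measurable_horizontal_line:
  assumes "\<bar>Im w\<bar> < a"
  shows "(\<lambda>v. \<Psi> (of_real v + w)) \<in> borel_measurable borel"
  by (intro borel_measurable_continuous_onI
        continuous_on_compose2[OF holomorphic_on_imp_continuous_on[OF holomorphic]])
     (use assms in \<open>auto intro!: continuous_intros\<close>)

lemma integral_translate_holomorphic:
  "(\<lambda>w. \<integral>v. \<Psi> (of_real v + w) \<partial>lborel) holomorphic_on {z. \<bar>Im z\<bar> < a}"
proof (rule holomorphic_integral[OF open_strip])
  fix x :: real
  have "(\<Psi> \<circ> (\<lambda>s. of_real x + s)) holomorphic_on {z. \<bar>Im z\<bar> < a}"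
    by (rule holomorphic_on_compose_gen[OF _ holomorphic]) (auto intro!: holomorphic_intros)
  then show "(\<lambda>s. \<Psi> (of_real x + s)) holomorphic_on {z. \<bar>Im z\<bar> < a}" by (simp add: o_def)
next
  fix s assume s: "s \<in> {z. \<bar>Im z\<bar> < a}"
  show "(\<lambda>x. \<Psi> (of_real x + s)) \<in> borel_measurable lborel"
    using measurable_horizontal_line s by simp
  obtain r where r: "r > 0" "cball s r \<subseteq> {z. \<bar>Im z\<bar> < a}"
    using open_strip s open_contains_cball by blast
  have "0 \<le> C / (1 + (Re s)\<^sup>2)"
    by (rule order_trans[OF norm_ge_zero decay]) (use s in simp)
  then have C: "C \<ge> 0"
    using one_plus_square_pos[of "Re s"] by (auto simp: zero_le_divide_iff)
  have "cmod (\<Psi> (of_real x + w)) \<le> C * (2 + 2 * (\<bar>Re s\<bar> + r)\<^sup>2) / (1 + x\<^sup>2)"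
    if w: "w \<in> cball s r" for w x
  proof -
    have "cmod (\<Psi> (of_real x + w)) \<le> C / (1 + (x + Re w)\<^sup>2)"
      using decay[of "of_real x + w"] w r by auto
    also have "\<bar>Re w\<bar> \<le> \<bar>Re s\<bar> + r"
      using w abs_Re_le_cmod[of "s - w"] by (simp add: dist_norm)
    then have "C / (1 + (x + Re w)\<^sup>2) \<le> C * (2 + 2 * (\<bar>Re s\<bar> + r)\<^sup>2) / (1 + x\<^sup>2)"
      by (rule quadratic_decay_translate_le[OF C])
    finally show ?thesis .
  qed
  then show "\<exists>r>0. \<exists>h. cball s r \<subseteq> {z. \<bar>Im z\<bar> < a} \<and> integrable lborel h \<and>
      (\<forall>w\<in>cball s r. \<forall>x\<in>space lborel. cmod (\<Psi> (of_real x + w)) \<le> h x)"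
    using r integral_quadratic_decay(1) by blast
qed

lemma integral_horizontal_shift:
  assumes w: "\<bar>Im w\<bar> < a"
  shows "(\<integral>v. \<Psi> (of_real v + w) \<partial>lborel) = (\<integral>v. \<Psi> (of_real v) \<partial>lborel)"
proof -
  define F where "F = (\<lambda>w. \<integral>v. \<Psi> (of_real v + w) \<partial>lborel)"
  have a: "a > 0" using w by linarith
  have "F w - F 0 = 0"
  proof (rule analytic_continuation[OF _ open_strip connected_strip, where f = "\<lambda>w. F w - F 0"])
    show "(\<lambda>w. F w - F 0) holomorphic_on {z. \<bar>Im z\<bar> < a}"
      unfolding F_def by (intro holomorphic_intros integral_translate_holomorphic)
    show "0 islimpt complex_of_real ` {0<..<a}"
      unfolding islimpt_approachable
    proof (intro allI impI)
      fix e :: real assume "e > 0"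
      define d where "d = min e a / 2"
      have "0 < d" "d < a" "d < e" using a \<open>e > 0\<close> by (auto simp: d_def)
      then show "\<exists>x'\<in>complex_of_real ` {0<..<a}. x' \<noteq> 0 \<and> dist x' 0 < e"
        by (intro bexI[of _ "of_real d"]) auto
    qed
    fix z assume "z \<in> complex_of_real ` {0<..<a}"
    then obtain b where "z = of_real b" by blast
    then show "F z - F 0 = 0"
      using lborel_integral_translate[of "\<lambda>v. \<Psi> (of_real v)" b] by (simp add: F_def)
  qed (use w a in auto)
  then show ?thesis by (simp add: F_def)
qed

lemma strip_decay_mult_exp:
  assumes "x \<ge> 0"
  shows "strip_decay (\<lambda>z. \<Psi> z * exp (- \<i> * of_real x * z)) a (C * exp (x * a))"
proof
  fix z assume z: "\<bar>Im z\<bar> < a"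
  have "cmod (\<Psi> z) * exp (x * Im z) \<le> C / (1 + (Re z)\<^sup>2) * exp (x * a)"
    using decay[OF z] z assms
    by (intro mult_mono) (auto intro: mult_left_mono order_trans[OF norm_ge_zero])
  then show "cmod (\<Psi> z * exp (- \<i> * of_real x * z)) \<le> C * exp (x * a) / (1 + (Re z)\<^sup>2)"
    by (simp add: norm_mult)
qed (intro holomorphic_intros holomorphic)

text \<open>The line of integration is moved to the edge of the strip in the half-plane where the
  oscillating factor decays.\<close>

lemma norm_fourier_le:
  assumes x: "x \<ge> 0" and a: "a > 0"
  shows "cmod (fourier (\<lambda>v. \<Psi> (of_real v)) x) \<le> C * pi * exp (- x * a)"
proof -
  interpret e: strip_decay "\<lambda>z. \<Psi> z * exp (- \<i> * of_real x * z)" a "C * exp (x * a)"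
    by (rule strip_decay_mult_exp[OF x])
  define I where "I = fourier (\<lambda>v. \<Psi> (of_real v)) x"
  have bound: "cmod I \<le> C * pi * exp (- x * y)" if y: "0 \<le> y" "y < a" for y
  proof -
    let ?w = "- \<i> * of_real y"
    have w: "\<bar>Im ?w\<bar> < a" using y by simp
    have "I = (\<integral>v. \<Psi> (of_real v + ?w) * exp (- \<i> * of_real x * (of_real v + ?w)) \<partial>lborel)"
      unfolding I_def fourier_def e.integral_horizontal_shift[OF w]
      by (simp add: cis_conv_exp mult.assoc)
    also have "cmod \<dots> \<le> (\<integral>v. C * exp (- x * y) / (1 + v\<^sup>2) \<partial>lborel)"
    proof (rule Bochner_Integration.integral_norm_bound_integral)
      show "integrable lborel (\<lambda>v. \<Psi> (of_real v + ?w) * exp (- \<i> * of_real x * (of_real v + ?w)))"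
        by (rule integrable_quadratic_decay[OF e.measurable_horizontal_line[OF w]])
           (use e.decay[of "of_real v + ?w" for v] y in simp)
      show "cmod (\<Psi> (of_real v + ?w) * exp (- \<i> * of_real x * (of_real v + ?w)))
          \<le> C * exp (- x * y) / (1 + v\<^sup>2)" for v
        using mult_right_mono[OF decay[of "of_real v + ?w"], of "exp (- x * y)"] y
        by (simp add: norm_mult)
    qed (rule integral_quadratic_decay(1))
    also have "\<dots> = C * pi * exp (- x * y)" by (simp add: integral_quadratic_decay(2))
    finally show ?thesis .
  qed
  have "((\<lambda>y. C * pi * exp (- x * y)) \<longlongrightarrow> C * pi * exp (- x * a)) (at_left a)"
    by (intro tendsto_intros)
  moreover have "\<forall>\<^sub>F y in at_left a. cmod I \<le> C * pi * exp (- x * y)"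
    using eventually_at_left_real[OF a] by eventually_elim (use bound in auto)
  ultimately show ?thesis
    unfolding I_def[symmetric] by (rule tendsto_lowerbound) simp
qed

end

lemma integral_derivative_quadratic_decay:
  fixes F f :: "real \<Rightarrow> complex"
  assumes deriv: "\<And>v. (F has_vector_derivative f v) (at v)" and f: "continuous_on UNIV f"
    and F_decay: "\<And>v. cmod (F v) \<le> C / (1 + v\<^sup>2)" and f_decay: "\<And>v. cmod (f v) \<le> D / (1 + v\<^sup>2)"
  shows "(\<integral>v. f v \<partial>lborel) = 0"
proof -
  have "((\<lambda>v::real. C / (1 + v\<^sup>2)) \<longlongrightarrow> 0) at_top" "((\<lambda>v::real. C / (1 + v\<^sup>2)) \<longlongrightarrow> 0) at_bot"
    by real_asymp+
  then have lim: "(F \<longlongrightarrow> 0) at_top" "(F \<longlongrightarrow> 0) at_bot"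
    using F_decay by (auto intro: Lim_null_comparison[rotated])
  have "integrable lborel f"
    using f by (intro integrable_quadratic_decay[OF _ f_decay] borel_measurable_continuous_onI)
  then have "(LBINT v=-\<infinity>..\<infinity>. f v) = 0 - 0"
    using lim f
    by (intro interval_integral_FTC_integrable)
       (auto simp: set_integrable_def einterval_def ereal_tendsto_simps deriv
          continuous_on_eq_continuous_at)
  then show ?thesis
    by (simp add: interval_lebesgue_integral_def einterval_def set_lebesgue_integral_def)
qed

lemma fourier_derivative:
  fixes F f :: "real \<Rightarrow> complex"
  assumes deriv: "\<And>v. (F has_vector_derivative f v) (at v)" and f: "continuous_on UNIV f"
    and F_decay: "\<And>v. cmod (F v) \<le> C / (1 + v\<^sup>2)" and f_decay: "\<And>v. cmod (f v) \<le> D / (1 + v\<^sup>2)"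
  shows "fourier f x = \<i> * of_real x * fourier F x"
proof -
  let ?e = "\<lambda>v. cis (- (x * v))"
  have e_deriv: "(?e has_vector_derivative - \<i> * of_real x * ?e v) (at v)" for v
  proof -
    have "((\<lambda>z. exp (- \<i> * of_real x * z)) has_field_derivative
        - \<i> * of_real x * exp (- \<i> * of_real x * of_real v)) (at (of_real v))"
      by (auto intro!: derivative_eq_intros)
    from has_vector_derivative_real_field[OF this] show ?thesis
      by (simp add: o_def cis_conv_exp mult.assoc)
  qed
  have F: "continuous_on UNIV F"
    using deriv by (intro continuous_at_imp_continuous_on ballI has_vector_derivative_continuous)
  have e: "continuous_on UNIV ?e" unfolding cis_conv_exp by (intro continuous_intros)
  have int: "integrable lborel (\<lambda>v. f v * ?e v)" "integrable lborel (\<lambda>v. F v * ?e v)"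
    using f F e F_decay f_decay
    by (auto intro!: integrable_quadratic_decay borel_measurable_continuous_onI
          continuous_intros simp: norm_mult)
  have "(\<integral>v. f v * ?e v - \<i> * of_real x * (F v * ?e v) \<partial>lborel) = 0"
  proof (rule integral_derivative_quadratic_decay)
    show "((\<lambda>v. F v * ?e v)
        has_vector_derivative f v * ?e v - \<i> * of_real x * (F v * ?e v)) (at v)" for v
      using has_vector_derivative_mult[OF deriv e_deriv, of v] by (simp add: algebra_simps)
    show "cmod (F v * ?e v) \<le> C / (1 + v\<^sup>2)" for v using F_decay[of v] by (simp add: norm_mult)
    fix v
    have "cmod (f v * ?e v - \<i> * of_real x * (F v * ?e v)) \<le> cmod (f v) + \<bar>x\<bar> * cmod (F v)"
      using norm_triangle_ineq4[of "f v * ?e v" "\<i> * of_real x * (F v * ?e v)"]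
      by (simp add: norm_mult)
    also have "\<dots> \<le> D / (1 + v\<^sup>2) + \<bar>x\<bar> * (C / (1 + v\<^sup>2))"
      by (intro add_mono mult_left_mono F_decay f_decay) auto
    finally show "cmod (f v * ?e v - \<i> * of_real x * (F v * ?e v)) \<le> (D + \<bar>x\<bar> * C) / (1 + v\<^sup>2)"
      by (simp add: add_divide_distrib)
  qed (intro continuous_intros f F e)
  moreover have "(\<integral>v. f v * ?e v - \<i> * of_real x * (F v * ?e v) \<partial>lborel) =
      (\<integral>v. f v * ?e v \<partial>lborel) - \<i> * of_real x * (\<integral>v. F v * ?e v \<partial>lborel)"
    unfolding integral_mult_right_zero[symmetric]
    by (intro Bochner_Integration.integral_diff int integrable_mult_right)
  ultimately show ?thesis by (simp add: fourier_def)
qed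

lemma translation_tendsto_0:
  fixes w :: "real \<Rightarrow> real"
  assumes meas [measurable]: "w \<in> borel_measurable borel"
    and decay: "\<And>x. \<bar>w x\<bar> \<le> D / (1 + x\<^sup>2)" and cont: "AE x in lborel. isCont w x"
  shows "((\<lambda>y. \<integral>x. \<bar>w x - w (x + y)\<bar> \<partial>lborel) \<longlongrightarrow> 0) (at 0)"
proof -
  have D: "D \<ge> 0" using decay[of 0] by simp
  have "((\<lambda>y. \<integral>x. \<bar>w x - w (x + y)\<bar> \<partial>lborel)
      \<longlongrightarrow> (\<integral>x. 0 \<partial>(lborel :: real measure))) (at 0 within {-1<..<1})"
  proof (rule integral_dominated_convergence_at_within)
    show "integrable lborel (\<lambda>x::real. D * 5 / (1 + x\<^sup>2))" by (rule integral_quadratic_decay(1))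
    show "AE x in lborel. ((\<lambda>y. \<bar>w x - w (x + y)\<bar>) \<longlongrightarrow> 0) (at 0 within {-1<..<1})"
      using cont
    proof eventually_elim
      case (elim x)
      have "((\<lambda>y. x + y) \<longlongrightarrow> x + 0) (at 0 within {-1<..<1})" by (intro tendsto_intros)
      then have "((\<lambda>y. w (x + y)) \<longlongrightarrow> w x) (at 0 within {-1<..<1})"
        using isCont_tendsto_compose[OF elim] by simp
      then have "((\<lambda>y. \<bar>w x - w (x + y)\<bar>) \<longlongrightarrow> \<bar>w x - w x\<bar>) (at 0 within {-1<..<1})"
        by (intro tendsto_intros)
      then show ?case by simp
    qed
    fix y :: real assume "y \<in> {-1<..<1}"
    then have "\<bar>y\<bar> \<le> 1" by auto
    then have shift: "D / (1 + (x + y)\<^sup>2) \<le> D * 4 / (1 + x\<^sup>2)" for x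
      using quadratic_decay_translate_le[OF D, of y 1 x] by simp
    have "\<bar>w x - w (x + y)\<bar> \<le> D / (1 + x\<^sup>2) + D * 4 / (1 + x\<^sup>2)" for x
      using decay[of x] decay[of "x + y"] shift[of x] by linarith
    then have "\<bar>w x - w (x + y)\<bar> \<le> D * 5 / (1 + x\<^sup>2)" for x
      by (simp add: add_divide_distrib[symmetric] mult.commute)
    then show "AE x in lborel. norm \<bar>w x - w (x + y)\<bar> \<le> D * 5 / (1 + x\<^sup>2)" by simp
  qed auto
  then show ?thesis by (simp add: at_within_open[of 0 "{-1<..<1::real}"])
qed

text \<open>Shifting by half a period changes the sign of the cosine.\<close>

lemma abs_integral_cos_le_translation:
  fixes w :: "real \<Rightarrow> real"
  assumes w: "integrable lborel w" and t: "t \<noteq> 0"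
  shows "2 * \<bar>\<integral>x. w x * cos (t * x) \<partial>lborel\<bar> \<le> (\<integral>x. \<bar>w x - w (x + pi / t)\<bar> \<partial>lborel)"
proof -
  let ?f = "\<lambda>x. w x * cos (t * x)"
  have [measurable]: "w \<in> borel_measurable borel" using w by auto
  have f: "integrable lborel ?f"
    by (rule Bochner_Integration.integrable_bound[OF w]) (auto simp: abs_mult mult_left_le)
  have shift: "?f (x + pi / t) = - (w (x + pi / t) * cos (t * x))" for x
    using t by (simp add: distrib_left cos_add)
  have "2 * (\<integral>x. ?f x \<partial>lborel) = (\<integral>x. ?f x \<partial>lborel) + (\<integral>x. ?f (x + pi / t) \<partial>lborel)"
    by (simp add: lborel_integral_translate[of ?f])
  also have "\<dots> = (\<integral>x. ?f x + ?f (x + pi / t) \<partial>lborel)"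
    by (intro Bochner_Integration.integral_add[symmetric] f lborel_integrable_translate)
  finally have "2 * \<bar>\<integral>x. ?f x \<partial>lborel\<bar> = \<bar>\<integral>x. (w x - w (x + pi / t)) * cos (t * x) \<partial>lborel\<bar>"
    unfolding shift by (simp add: left_diff_distrib)
  also have "\<dots> \<le> (\<integral>x. \<bar>w x - w (x + pi / t)\<bar> \<partial>lborel)"
  proof (rule Bochner_Integration.integral_abs_bound_integral)
    have d: "integrable lborel (\<lambda>x. w x - w (x + pi / t))"
      by (intro Bochner_Integration.integrable_diff w lborel_integrable_translate)
    then show "integrable lborel (\<lambda>x. (w x - w (x + pi / t)) * cos (t * x))"
      by (rule Bochner_Integration.integrable_bound) (auto simp: abs_mult mult_left_le)
    show "integrable lborel (\<lambda>x. \<bar>w x - w (x + pi / t)\<bar>)" using d by simp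
  qed (simp add: abs_mult mult_left_le)
  finally show ?thesis .
qed

lemma Riemann_Lebesgue_cos:
  fixes w :: "real \<Rightarrow> real"
  assumes meas: "w \<in> borel_measurable borel"
    and decay: "\<And>x. \<bar>w x\<bar> \<le> D / (1 + x\<^sup>2)" and cont: "AE x in lborel. isCont w x"
  shows "((\<lambda>t. \<integral>x. w x * cos (t * x) \<partial>lborel) \<longlongrightarrow> 0) at_top"
proof (rule Lim_null_comparison)
  have w: "integrable lborel w"
    using meas decay by (intro integrable_quadratic_decay) auto
  show "\<forall>\<^sub>F t in at_top. norm (\<integral>x. w x * cos (t * x) \<partial>lborel)
      \<le> (\<integral>x. \<bar>w x - w (x + pi / t)\<bar> \<partial>lborel)"
    using eventually_gt_at_top[of 0]
  proof eventually_elim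
    case (elim t)
    then show ?case using abs_integral_cos_le_translation[OF w, of t] by simp
  qed
  have "filterlim (\<lambda>t. pi / t) (at 0) at_top" by real_asymp
  then show "((\<lambda>t. \<integral>x. \<bar>w x - w (x + pi / t)\<bar> \<partial>lborel) \<longlongrightarrow> 0) at_top"
    by (rule filterlim_compose[OF translation_tendsto_0[OF assms]])
qed

section \<open>Laplace transforms\<close>

lemma laplace_exp:
  assumes a: "Re a > 0"
  shows "integrable lborel (\<lambda>x. of_real (indicator {0<..} x) * exp (- a * of_real x))"
    and "(\<integral>x. of_real (indicator {0<..} x) * exp (- a * of_real x) \<partial>lborel) = 1 / a"
proof -
  have a0: "a \<noteq> 0" using a by auto
  have int: "set_integrable lborel {0<..} (\<lambda>x. exp (- a * of_real x))"
    by (rule set_integrable_bound[OF integrable_I0i_exp_mscale[OF a]])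
       (auto simp: mult.commute set_borel_measurable_def)
  then show "integrable lborel (\<lambda>x. of_real (indicator {0<..} x) * exp (- a * of_real x))"
    by (simp add: set_integrable_def scaleR_conv_of_real)
  define F where "F = (\<lambda>x::real. - exp (- a * of_real x) / a)"
  have "(LBINT x=0..\<infinity>. exp (- a * of_real x)) = 0 - (- 1 / a)"
  proof (rule interval_integral_FTC_integrable)
    show "(F has_vector_derivative exp (- a * of_real x)) (at x)" for x
    proof -
      have "((\<lambda>z. - exp (- a * z) / a) has_field_derivative exp (- a * of_real x)) (at (of_real x))"
        using a0 by (auto intro!: derivative_eq_intros)
      from has_vector_derivative_real_field[OF this] show ?thesis by (simp add: F_def o_def)
    qed
    show "set_integrable lborel (einterval 0 \<infinity>) (\<lambda>x. exp (- a * of_real x))"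
      using int by (simp add: einterval_def greaterThan_def)
    have "(F \<longlongrightarrow> - exp (- a * of_real 0) / a) (at_right 0)"
      unfolding F_def using a0 by (intro tendsto_intros) auto
    then show "((F \<circ> real_of_ereal) \<longlongrightarrow> - 1 / a) (at_right 0)"
      by (simp add: ereal_tendsto_simps zero_ereal_def)
    have "((\<lambda>x. exp (- Re a * x) / cmod a) \<longlongrightarrow> 0) at_top" using a a0 by real_asymp
    then have "(F \<longlongrightarrow> 0) at_top"
      by (rule Lim_null_comparison[rotated]) (simp add: F_def norm_divide)
    then show "((F \<circ> real_of_ereal) \<longlongrightarrow> 0) (at_left \<infinity>)" by (simp add: ereal_tendsto_simps)
  qed (auto intro!: continuous_intros)
  then show "(\<integral>x. of_real (indicator {0<..} x) * exp (- a * of_real x) \<partial>lborel) = 1 / a"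
    by (simp add: interval_lebesgue_integral_0_infty set_lebesgue_integral_def scaleR_conv_of_real)
qed

lemma laplace_sin:
  fixes a :: real
  shows "integrable lborel (\<lambda>y. indicator {0<..} y * exp (- y) * sin (a * y))"
    and "(\<integral>y. indicator {0<..} y * exp (- y) * sin (a * y) \<partial>lborel) = a / (1 + a\<^sup>2)"
proof -
  define z where "z = Complex 1 (- a)"
  have z: "Re z > 0" by (simp add: z_def)
  have Im_eq: "Im (of_real (indicator {0<..} y) * exp (- z * of_real y))
      = indicator {0<..} y * exp (- y) * sin (a * y)" for y
    by (simp add: z_def Im_exp)
  show "integrable lborel (\<lambda>y. indicator {0<..} y * exp (- y) * sin (a * y))"
    using integrable_Im[OF laplace_exp(1)[OF z]] unfolding Im_eq .
  have "(\<integral>y. indicator {0<..} y * exp (- y) * sin (a * y) \<partial>lborel) = Im (1 / z)"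
    using integral_Im[OF laplace_exp(1)[OF z]] unfolding Im_eq laplace_exp(2)[OF z] .
  also have "\<dots> = a / (1 + a\<^sup>2)" by (simp add: z_def Im_divide)
  finally show "(\<integral>y. indicator {0<..} y * exp (- y) * sin (a * y) \<partial>lborel) = a / (1 + a\<^sup>2)" .
qed

lemma integral_exp_neg:
  shows "integrable lborel (\<lambda>y. indicator {0<..} y * exp (- y) :: real)"
    and "(\<integral>y. indicator {0<..} y * exp (- y) \<partial>lborel) = (1::real)"
  using has_bochner_integral_I0i_power_exp_m[of 0]
  by (auto simp: has_bochner_integral_iff mult.commute)

definition wsinc :: "real \<Rightarrow> real \<Rightarrow> real" where
  "wsinc h x = h * sinc (h * x)"

lemma wsinc_continuous: "continuous_on A (wsinc h)"
  unfolding wsinc_def[abs_def] by (intro continuous_intros)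

lemma wsinc_measurable [measurable]: "wsinc h \<in> borel_measurable borel"
  by (intro borel_measurable_continuous_onI wsinc_continuous)

lemma abs_wsinc_le: "h > 0 \<Longrightarrow> \<bar>wsinc h x\<bar> \<le> h"
  using abs_sin_x_le_abs_x[of "h * x"] by (simp add: wsinc_def abs_mult abs_divide divide_le_eq)

lemma integral_cis_symmetric:
  assumes "h > 0"
  shows "(\<integral>y. indicator {-h..h} y *\<^sub>R cis (- (x * y)) \<partial>lborel) = 2 * of_real (wsinc h x)"
proof (cases "x = 0")
  case True
  then show ?thesis using assms by (simp add: wsinc_def scaleR_conv_of_real)
next
  case False
  define F where "F = (\<lambda>y. cis (- (x * y)) / (- \<i> * of_real x))"
  have "(\<integral>y. indicator {-h..h} y *\<^sub>R cis (- (x * y)) \<partial>lborel) = F h - F (- h)"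
  proof (rule integral_FTC_atLeastAtMost)
    fix y :: real
    have "((\<lambda>w. exp (- \<i> * of_real x * w) / (- \<i> * of_real x)) has_field_derivative
        exp (- \<i> * of_real x * of_real y)) (at (of_real y))"
      using False by (auto intro!: derivative_eq_intros)
    from has_vector_derivative_real_field[OF this]
    show "(F has_vector_derivative cis (- (x * y))) (at y within {-h..h})"
      by (auto simp: F_def o_def cis_conv_exp mult.assoc intro: has_vector_derivative_at_within)
  qed (use assms in \<open>auto simp: cis_conv_exp intro!: continuous_intros\<close>)
  also have "F h - F (- h) = (cis (- (x * h)) - cis (x * h)) / (- \<i> * of_real x)"
    by (simp add: F_def diff_divide_distrib)
  also have "cis (- (x * h)) - cis (x * h) = - 2 * \<i> * of_real (sin (h * x))"
    by (simp add: complex_eq_iff mult.commute)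
  also have "- 2 * \<i> * of_real (sin (h * x)) / (- \<i> * of_real x) = 2 * of_real (sin (h * x) / x)"
    using False by (simp add: field_simps)
  also have "sin (h * x) / x = wsinc h x" using False assms by (simp add: wsinc_def)
  finally show ?thesis .
qed

lemma Ln_difference_integral:
  assumes z: "Re z > 0" and h: "h > 0"
  shows "(\<integral>y. indicator {-h..h} y *\<^sub>R (1 / (z + \<i> * of_real y)) \<partial>lborel)
    = - \<i> * (Ln (z + \<i> * of_real h) - Ln (z - \<i> * of_real h))"
proof -
  have "(\<integral>y. indicator {-h..h} y *\<^sub>R (1 / (z + \<i> * of_real y)) \<partial>lborel)
      = - \<i> * Ln (z + \<i> * of_real h) - (- \<i> * Ln (z + \<i> * of_real (- h)))"
  proof (rule integral_FTC_atLeastAtMost[of "- h" h "\<lambda>y. - \<i> * Ln (z + \<i> * of_real y)"])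
    fix y :: real
    have "z + \<i> * of_real y \<notin> \<real>\<^sub>\<le>\<^sub>0" using z by (auto simp: complex_nonpos_Reals_iff)
    then have "((\<lambda>w. - \<i> * Ln (z + \<i> * w))
        has_field_derivative 1 / (z + \<i> * of_real y)) (at (of_real y))"
      by (auto intro!: derivative_eq_intros simp: field_simps)
    from has_vector_derivative_real_field[OF this]
    show "((\<lambda>y. - \<i> * Ln (z + \<i> * of_real y)) has_vector_derivative 1 / (z + \<i> * of_real y))
        (at y within {-h..h})"
      by (auto simp: o_def intro: has_vector_derivative_at_within)
  next
    have "z + \<i> * of_real y \<noteq> 0" for y using z by (auto simp: complex_eq_iff)
    then show "continuous_on {-h..h} (\<lambda>y. 1 / (z + \<i> * of_real y))"
      by (intro continuous_intros) auto
  qed (use h in auto)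
  then show ?thesis by (simp add: algebra_simps)
qed

lemma Ln_difference_laplace:
  assumes z: "Re z > 0" and h: "h > 0"
  shows "Ln (z + \<i> * of_real h) - Ln (z - \<i> * of_real h)
    = 2 * \<i> * (\<integral>x. of_real (indicator {0<..} x * wsinc h x) * exp (- z * of_real x) \<partial>lborel)"
proof -
  let ?E = "\<lambda>y x. of_real (indicator {0<..} x) * exp (- (z + \<i> * of_real y) * of_real x)"
  let ?f = "\<lambda>y x. of_real (indicator {-h..h} y) * ?E y x"
  have norm_f: "norm (?f y x) = indicator {-h..h} y * (indicator {0<..} x * exp (- Re z * x))"
    for y x
    by (simp add: norm_mult indicator_def)
  have E: "Re (z + \<i> * of_real y) > 0" for y using z by simp
  have int: "integrable (lborel \<Otimes>\<^sub>M lborel) (\<lambda>(y, x). ?f y x)"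
  proof (rule lborel_pair.Fubini_integrable)
    show "(\<lambda>(y, x). ?f y x) \<in> borel_measurable (lborel \<Otimes>\<^sub>M lborel)"
      unfolding case_prod_beta by measurable
    show "integrable lborel (\<lambda>y. \<integral>x. norm (case (y, x) of (y, x) \<Rightarrow> ?f y x) \<partial>lborel)"
      unfolding case_prod_conv norm_f integral_mult_right_zero
      by (simp add: emeasure_lborel_Icc_eq integrable_mult_left)
    show "AE y in lborel. integrable lborel (\<lambda>x. case (y, x) of (y, x) \<Rightarrow> ?f y x)"
      unfolding case_prod_conv by (intro AE_I2 integrable_mult_right laplace_exp(1)[OF E])
  qed
  have inner_x: "(\<integral>x. ?f y x \<partial>lborel) = indicator {-h..h} y *\<^sub>R (1 / (z + \<i> * of_real y))" for y
    unfolding integral_mult_right_zero laplace_exp(2)[OF E] by (simp add: scaleR_conv_of_real)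
  have inner_y: "(\<integral>y. ?f y x \<partial>lborel)
      = 2 * (of_real (indicator {0<..} x * wsinc h x) * exp (- z * of_real x))" for x
  proof -
    have "?f y x = (indicator {-h..h} y *\<^sub>R cis (- (x * y))) *
        (of_real (indicator {0<..} x) * exp (- z * of_real x))" for y
      by (simp add: scaleR_conv_of_real cis_conv_exp exp_add[symmetric] algebra_simps)
    then show ?thesis
      by (simp only: integral_mult_left_zero integral_cis_symmetric[OF h]) simp
  qed
  have "(\<integral>x. (\<integral>y. ?f y x \<partial>lborel) \<partial>lborel) = (\<integral>y. (\<integral>x. ?f y x \<partial>lborel) \<partial>lborel)"
    by (rule lborel_pair.Fubini_integral[OF int])
  then have "2 * (\<integral>x. of_real (indicator {0<..} x * wsinc h x) * exp (- z * of_real x) \<partial>lborel)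
      = - \<i> * (Ln (z + \<i> * of_real h) - Ln (z - \<i> * of_real h))"
    unfolding inner_y inner_x Ln_difference_integral[OF z h]
    by (simp only: integral_mult_right_zero)
  from arg_cong[OF this, of "\<lambda>v. \<i> * v"] show ?thesis by (simp add: mult_ac)
qed

section \<open>Dirichlet series\<close>

definition dirichlet_series :: "(nat \<Rightarrow> complex) \<Rightarrow> complex \<Rightarrow> complex" where
  "dirichlet_series c s = (\<Sum>n. c n * of_nat n powr (- s))"

lemma norm_of_nat_powr: "cmod (of_nat n powr s) = real n powr Re s"
  by (simp add: norm_powr_real_powr)

lemma of_nat_powr_eq_exp: "n > 0 \<Longrightarrow> of_nat n powr (s :: complex) = exp (s * of_real (ln (real n)))"
  using Ln_of_real[of "real n"] by (simp add: powr_def)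

lemma has_sum_pairs_divisors:
  "((\<lambda>(d, m). f d m) has_sum X) ({n. 0 < n} \<times> {n. 0 < n}) \<longleftrightarrow>
    ((\<lambda>(n, d). f d (n div d)) has_sum X) (Sigma {n::nat. 0 < n} (\<lambda>n. {d. d dvd n}))"
  by (rule has_sum_reindex_bij_witness[of _ "\<lambda>(n, d). (d, n div d)" "\<lambda>(d, m). (d * m, d)"])
     (auto intro: dvd_pos_nat simp: div_greater_zero_iff dvd_imp_le)

definition dirichlet_conv :: "(nat \<Rightarrow> complex) \<Rightarrow> (nat \<Rightarrow> complex) \<Rightarrow> nat \<Rightarrow> complex" where
  "dirichlet_conv a b n = (\<Sum>d | d dvd n. a d * b (n div d))"

lemma has_sum_product_abs:
  fixes f :: "'a \<Rightarrow> complex" and g :: "'b \<Rightarrow> complex"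
  assumes f: "(f has_sum x) A" "(\<lambda>i. norm (f i)) summable_on A"
    and g: "(g has_sum y) B" "(\<lambda>j. norm (g j)) summable_on B"
  shows "((\<lambda>(i, j). f i * g j) has_sum (x * y)) (A \<times> B)"
proof -
  have "(\<lambda>p. norm (case p of (i, j) \<Rightarrow> f i * g j)) summable_on (A \<times> B)"
  proof (rule summable_on_SigmaI[where g = "\<lambda>i. norm (f i) * infsum (\<lambda>j. norm (g j)) B"])
    show "((\<lambda>j. norm (case (i, j) of (i, j) \<Rightarrow> f i * g j)) has_sum
        norm (f i) * infsum (\<lambda>j. norm (g j)) B) B" for i
      using has_sum_cmult_right[OF has_sum_infsum[OF g(2)], of "norm (f i)"]
      by (simp add: norm_mult)
    show "(\<lambda>i. norm (f i) * infsum (\<lambda>j. norm (g j)) B) summable_on A"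
      by (intro summable_on_cmult_left f)
  qed auto
  then have "(\<lambda>(i, j). f i * g j) summable_on (A \<times> B)" by (rule abs_summable_summable)
  then show ?thesis
    by (rule has_sum_SigmaI[rotated 2])
       (auto intro: has_sum_cmult_right[OF g(1)] has_sum_cmult_left[OF f(1)])
qed

lemma dirichlet_series_mult_sums:
  assumes a: "summable (\<lambda>n. cmod (a n * of_nat n powr (- s)))"
    and b: "summable (\<lambda>n. cmod (b n * of_nat n powr (- s)))"
  shows "(\<lambda>n. dirichlet_conv a b n * of_nat n powr (- s))
    sums (dirichlet_series a s * dirichlet_series b s)"
proof -
  let ?f = "\<lambda>n. a n * of_nat n powr (- s)" and ?g = "\<lambda>n. b n * of_nat n powr (- s)"
  let ?h = "\<lambda>(d, m). ?f d * ?g m" and ?P = "{n::nat. n > 0}"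
  have f: "(?f has_sum dirichlet_series a s) UNIV" and g: "(?g has_sum dirichlet_series b s) UNIV"
    unfolding dirichlet_series_def using a b
    by (auto intro!: norm_summable_imp_has_sum summable_sums summable_norm_cancel)
  have af: "(\<lambda>n. cmod (?f n)) summable_on UNIV" and ag: "(\<lambda>n. cmod (?g n)) summable_on UNIV"
    using a b by (auto intro!: norm_summable_imp_summable_on)
  from f af g ag have "(?h has_sum (dirichlet_series a s * dirichlet_series b s)) (UNIV \<times> UNIV)"
    by (rule has_sum_product_abs)
  then have "(?h has_sum (dirichlet_series a s * dirichlet_series b s)) (?P \<times> ?P)"
    by (rule has_sum_cong_neutral[THEN iffD1, rotated -1]) auto
  then have "((\<lambda>(n, d). ?f d * ?g (n div d)) has_sum (dirichlet_series a s * dirichlet_series b s))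
      (Sigma ?P (\<lambda>n. {d. d dvd n}))"
    by (rule has_sum_pairs_divisors[THEN iffD1])
  then have "((\<lambda>n. dirichlet_conv a b n * of_nat n powr (- s)) has_sum
      (dirichlet_series a s * dirichlet_series b s)) ?P"
  proof (rule has_sum_SigmaD)
    fix n assume n: "n \<in> ?P"
    have "?f d * ?g (n div d) = a d * b (n div d) * of_nat n powr (- s)" if "d \<in> {d. d dvd n}" for d
      using that powr_times_real[of "of_nat d" "of_nat (n div d)" "- s"]
      by (simp add: mult_ac flip: of_nat_mult)
    then have "dirichlet_conv a b n * of_nat n powr (- s) = (\<Sum>d | d dvd n. ?f d * ?g (n div d))"
      unfolding dirichlet_conv_def sum_distrib_right by (intro sum.cong refl) (simp only:)
    then show "((\<lambda>d. case (n, d) of (n, d) \<Rightarrow> ?f d * ?g (n div d)) has_sum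
        dirichlet_conv a b n * of_nat n powr (- s)) {d. d dvd n}"
      using n by (simp add: has_sum_finite)
  qed
  then have "((\<lambda>n. dirichlet_conv a b n * of_nat n powr (- s)) has_sum
      (dirichlet_series a s * dirichlet_series b s)) UNIV"
    by (rule has_sum_cong_neutral[THEN iffD1, rotated -1]) auto
  then show ?thesis by (rule has_sum_imp_sums)
qed

locale dirichlet_coeffs =
  fixes c :: "nat \<Rightarrow> complex" and a M :: real
  assumes bound: "n > 0 \<Longrightarrow> cmod (c n) \<le> M * real n powr a"
begin

lemma M_nonneg: "M \<ge> 0"
  using order_trans[OF norm_ge_zero bound[of 1]] by simp

lemma norm_term_le:
  assumes "Re s \<ge> \<sigma>"
  shows "cmod (c n * of_nat n powr (- s)) \<le> M * real n powr (a - \<sigma>)"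
proof (cases "n > 0")
  case True
  have "cmod (c n * of_nat n powr (- s)) \<le> M * real n powr a * real n powr (- \<sigma>)"
    unfolding norm_mult norm_of_nat_powr using True assms M_nonneg
    by (intro mult_mono bound powr_mono) auto
  then show ?thesis by (simp add: powr_diff powr_minus divide_inverse mult.assoc)
qed simp

lemma summable_bound: "\<sigma> > a + 1 \<Longrightarrow> summable (\<lambda>n. M * real n powr (a - \<sigma>))"
  by (intro summable_mult) (simp add: summable_real_powr_iff)

lemma summable_norm_terms:
  assumes "Re s > a + 1"
  shows "summable (\<lambda>n. cmod (c n * of_nat n powr (- s)))"
  by (rule summable_comparison_test'[OF summable_bound[OF assms], of 0])
     (use norm_term_le in auto)

lemma sums: "Re s > a + 1 \<Longrightarrow> (\<lambda>n. c n * of_nat n powr (- s)) sums dirichlet_series c s"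
  unfolding dirichlet_series_def
  by (rule summable_sums[OF summable_norm_cancel[OF summable_norm_terms]])

lemma coeffs_mult_ln:
  assumes \<delta>: "\<delta> > 0"
  shows "dirichlet_coeffs (\<lambda>n. of_real (ln (real n)) * c n) (a + \<delta>) (M / \<delta>)"
proof
  fix n :: nat assume n: "n > 0"
  have "cmod (of_real (ln (real n)) * c n) \<le> (real n powr \<delta> / \<delta>) * (M * real n powr a)"
    unfolding norm_mult using n \<delta> ln_powr_bound[of "real n" \<delta>] bound[OF n]
    by (intro mult_mono) auto
  then show "cmod (of_real (ln (real n)) * c n) \<le> M / \<delta> * real n powr (a + \<delta>)"
    by (simp add: powr_add mult_ac)
qed

lemma series_and_derivative:
  obtains D D' where "\<And>s. Re s > a + 1 \<Longrightarrow> (\<lambda>n. c n * of_nat n powr (- s)) sums D s"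
    "\<And>s. Re s > a + 1 \<Longrightarrow> (\<lambda>n. - (of_real (ln (real n)) * c n * of_nat n powr (- s))) sums D' s"
    "\<And>s. Re s > a + 1 \<Longrightarrow> (D has_field_derivative D' s) (at s)"
proof -
  let ?f = "\<lambda>n s. c n * of_nat n powr (- s)"
  let ?f' = "\<lambda>n s. - (of_real (ln (real n)) * c n * of_nat n powr (- s))"
  have "\<exists>D D'. \<forall>s\<in>{s. Re s > a + 1}.
      (\<lambda>n. ?f n s) sums D s \<and> (\<lambda>n. ?f' n s) sums D' s \<and> (D has_field_derivative D' s) (at s)"
  proof (rule series_and_derivative_comparison_local[OF open_half])
    show "(?f n has_field_derivative ?f' n s) (at s)" for n s
    proof (cases "n > 0")
      case True
      have "((\<lambda>s. c n * exp (- s * of_real (ln (real n)))) has_field_derivative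
          - (of_real (ln (real n)) * c n * exp (- s * of_real (ln (real n))))) (at s)"
        by (auto intro!: derivative_eq_intros)
      then show ?thesis by (simp add: of_nat_powr_eq_exp[OF True])
    qed simp
  next
    fix s :: complex assume s: "s \<in> {s. Re s > a + 1}"
    define d where "d = (Re s - (a + 1)) / 2"
    have d: "d > 0" "Re s - d > a + 1" using s by (auto simp: d_def field_simps)
    have "cmod (?f n z) \<le> M * real n powr (a - (Re s - d))" if "z \<in> ball s d" for n z
      using that abs_Re_le_cmod[of "s - z"] by (intro norm_term_le) (simp add: dist_norm)
    then show "\<exists>d h. 0 < d \<and> summable h \<and>
        (\<forall>\<^sub>F n in sequentially. \<forall>z\<in>ball s d \<inter> {s. Re s > a + 1}. cmod (?f n z) \<le> h n)"
      using d summable_bound[OF d(2)]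
      by (intro exI[of _ d] exI[of _ "\<lambda>n. M * real n powr (a - (Re s - d))"]) auto
  qed
  then show ?thesis using that by auto
qed

lemma has_field_derivative:
  assumes s: "Re s > a + 1"
  shows "(dirichlet_series c has_field_derivative
    - dirichlet_series (\<lambda>n. of_real (ln (real n)) * c n) s) (at s)"
proof -
  obtain D D' where D: "\<And>s. Re s > a + 1 \<Longrightarrow> (\<lambda>n. c n * of_nat n powr (- s)) sums D s"
    "\<And>s. Re s > a + 1 \<Longrightarrow> (\<lambda>n. - (of_real (ln (real n)) * c n * of_nat n powr (- s))) sums D' s"
    "\<And>s. Re s > a + 1 \<Longrightarrow> (D has_field_derivative D' s) (at s)"
    using series_and_derivative by blast
  define \<delta> where "\<delta> = (Re s - (a + 1)) / 2"
  have \<delta>: "\<delta> > 0" "Re s > a + \<delta> + 1" using s by (auto simp: \<delta>_def field_simps)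
  interpret d: dirichlet_coeffs "\<lambda>n. of_real (ln (real n)) * c n" "a + \<delta>" "M / \<delta>"
    by (rule coeffs_mult_ln[OF \<delta>(1)])
  have "D' s = - dirichlet_series (\<lambda>n. of_real (ln (real n)) * c n) s"
    using D(2)[OF s] sums_minus[OF d.sums[OF \<delta>(2)]] by (rule sums_unique2)
  moreover have "(dirichlet_series c has_field_derivative D' s) (at s)"
    by (rule has_field_derivative_transform_within_open[OF D(3)[OF s] open_half[of "a + 1"]])
       (use s sums_unique2[OF D(1) sums] in auto)
  ultimately show ?thesis by simp
qed

lemma holomorphic: "dirichlet_series c holomorphic_on {s. Re s > a + 1}"
  using has_field_derivative by (auto simp: holomorphic_on_open[OF open_half])

lemma norm_le:
  assumes "\<sigma> > a + 1" "Re s \<ge> \<sigma>"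
  shows "cmod (dirichlet_series c s) \<le> (\<Sum>n. M * real n powr (a - \<sigma>))"
  unfolding dirichlet_series_def
  by (rule norm_suminf_le[OF norm_term_le[OF assms(2)] summable_bound[OF assms(1)]])

lemma norm_diff_first_le:
  assumes s: "Re s \<ge> a + 2"
  shows "cmod (dirichlet_series c s - c 1) \<le> 2 powr (a + 2 - Re s) * (\<Sum>n. M * real n powr (- 2))"
proof -
  let ?d = "\<lambda>n. (if n = 1 then 0 else c n) * of_nat n powr (- s)"
  have sm: "summable (\<lambda>n. M * real n powr (- 2))" using summable_bound[of "a + 2"] by simp
  have "(\<lambda>n. c n * of_nat n powr (- s) - (if n = 1 then c n else 0))
      sums (dirichlet_series c s - c 1)"
    by (intro sums_diff sums sums_single) (use s in simp)
  also have "(\<lambda>n. c n * of_nat n powr (- s) - (if n = 1 then c n else 0)) = ?d"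
    by auto
  finally have d: "?d sums (dirichlet_series c s - c 1)" .
  have "cmod (?d n) \<le> 2 powr (a + 2 - Re s) * (M * real n powr (- 2))" for n
  proof (cases "n \<le> 1")
    case True
    then have "n = 0 \<or> n = 1" by auto
    then show ?thesis using M_nonneg by auto
  next
    case False
    have "cmod (?d n) \<le> M * real n powr (a - Re s)"
      using norm_term_le[of "Re s" s n] False by simp
    also have "a - Re s = (a + 2 - Re s) + (- 2)" by simp
    also have "M * real n powr ((a + 2 - Re s) + (- 2))
        = real n powr (a + 2 - Re s) * (M * real n powr (- 2))"
      unfolding powr_add by simp
    also have "\<dots> \<le> 2 powr (a + 2 - Re s) * (M * real n powr (- 2))"
      using False s M_nonneg by (intro mult_right_mono powr_mono2') auto
    finally show ?thesis .
  qed
  then have "cmod (\<Sum>n. ?d n) \<le> (\<Sum>n. 2 powr (a + 2 - Re s) * (M * real n powr (- 2)))"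
    by (intro norm_suminf_le summable_mult sm)
  then show ?thesis using sums_unique[OF d] suminf_mult[OF sm] by simp
qed

lemma tendsto_first:
  assumes "filterlim (\<lambda>x. Re (f x)) at_top F"
  shows "((\<lambda>x. dirichlet_series c (f x)) \<longlongrightarrow> c 1) F"
proof -
  define K where "K = (\<Sum>n. M * real n powr (- 2))"
  have "\<forall>\<^sub>F x in F. Re (f x) \<ge> a + 2" using assms by (simp add: filterlim_at_top)
  then have "\<forall>\<^sub>F x in F. cmod (dirichlet_series c (f x) - c 1) \<le> 2 powr (a + 2 - Re (f x)) * K"
    by eventually_elim (simp add: norm_diff_first_le K_def del: One_nat_def)
  moreover have "((\<lambda>y. 2 powr (a + 2 - y) * K) \<longlongrightarrow> 0) at_top" by real_asymp
  then have "((\<lambda>x. 2 powr (a + 2 - Re (f x)) * K) \<longlongrightarrow> 0) F" by (rule filterlim_compose[OF _ assms])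
  ultimately have "((\<lambda>x. dirichlet_series c (f x) - c 1) \<longlongrightarrow> 0) F" by (rule Lim_null_comparison)
  then show ?thesis by (simp add: LIM_zero_iff)
qed

end

section \<open>The logarithm of zeta to the right of the line of absolute convergence\<close>

lemma zeta_holomorphic: "zeta holomorphic_on - {1}"
  and zeta_series: "Re s > 1 \<Longrightarrow> zeta s = (\<Sum>n. 1 / of_nat (Suc n) powr s)"
  and zeta_1: "zeta 1 = 0"
  using is_zeta_zeta by (auto simp: is_zeta_def)

lemma zeta_eq_dseries: "Re s > 1 \<Longrightarrow> zeta s = dseries s"
  by (simp only: zeta_series dseries_def)

interpretation one: dirichlet_coeffs "\<lambda>_. 1" 0 1
  by unfold_locales simp

lemma zeta_eq_dirichlet_series:
  assumes "Re s > 1"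
  shows "zeta s = dirichlet_series (\<lambda>_. 1) s"
proof -
  have "(\<lambda>n. of_nat (Suc n) powr (- s)) sums zeta s"
    unfolding zeta_eq_dseries[OF assms] by (rule dseries(2)[OF assms])
  then have "(\<lambda>n. 1 * of_nat n powr (- s)) sums zeta s"
    by (subst (asm) sums_Suc_iff) simp
  then show ?thesis using one.sums[of s] assms by (simp add: sums_unique2)
qed

definition log_coeff :: "nat \<Rightarrow> real" where
  "log_coeff n = mangoldt n / ln (real n)"

lemma log_coeff_0 [simp]: "log_coeff 0 = 0" and log_coeff_1 [simp]: "log_coeff (Suc 0) = 0"
  by (simp_all add: log_coeff_def)

lemma log_coeff_nonneg: "log_coeff n \<ge> 0"
  unfolding log_coeff_def
  by (cases "n = 0") (auto intro!: divide_nonneg_nonneg mangoldt_nonneg ln_ge_zero)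

lemma log_coeff_le_1: "log_coeff n \<le> 1"
proof (cases "n \<le> 1")
  case True
  then have "n = 0 \<or> n = 1" by auto
  then show ?thesis by auto
next
  case False
  then show ?thesis using mangoldt_le[of n] by (simp add: log_coeff_def)
qed

lemma ln_mult_log_coeff: "ln (real n) * log_coeff n = mangoldt n"
proof (cases "n \<le> 1")
  case True
  then have "n = 0 \<or> n = 1" by auto
  then show ?thesis by auto
next
  case False
  then show ?thesis by (simp add: log_coeff_def)
qed

lemma of_real_ln_mult_log_coeff:
  "complex_of_real (ln (real n)) * of_real (log_coeff n) = mangoldt n"
  by (simp only: of_real_mult[symmetric] ln_mult_log_coeff of_real_mangoldt)

definition log_zeta_series :: "complex \<Rightarrow> complex" where
  "log_zeta_series = dirichlet_series (\<lambda>n. of_real (log_coeff n))"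

interpretation log_zeta: dirichlet_coeffs "\<lambda>n. of_real (log_coeff n)" 0 1
  by unfold_locales (simp add: log_coeff_nonneg log_coeff_le_1)

lemma log_coeff_powr:
  "of_real (log_coeff n) * of_nat n powr (s :: complex)
      = of_real (log_coeff n) * exp (s * of_real (ln (real n)))"
  by (cases "n = 0") (simp_all add: of_nat_powr_eq_exp)

lemma log_zeta_series_sums:
  assumes "Re s > 1"
  shows "(\<lambda>n. of_real (log_coeff n) * exp (- s * of_real (ln (real n)))) sums log_zeta_series s"
  using log_zeta.sums[of s] assms unfolding log_zeta_series_def log_coeff_powr by simp

lemma summable_norm_log_zeta_series:
  assumes "Re s > 1"
  shows "summable (\<lambda>n. cmod (of_real (log_coeff n) * exp (- s * of_real (ln (real n)))))"
  using log_zeta.summable_norm_terms[of s] assms unfolding log_coeff_powr by simp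

lemma Re_log_zeta_series_sums:
  assumes "\<sigma> > 1"
  shows "(\<lambda>n. log_coeff n * exp (- \<sigma> * ln (real n)) * cos (t * ln (real n)))
    sums Re (log_zeta_series (Complex \<sigma> t))"
  using sums_Re[OF log_zeta_series_sums[of "Complex \<sigma> t"]] assms by (simp add: Re_exp mult.assoc)

lemma log_zeta_series_holomorphic: "log_zeta_series holomorphic_on {s. Re s > 1}"
  using log_zeta.holomorphic by (simp add: log_zeta_series_def)

lemma log_zeta_series_has_field_derivative:
  assumes "Re s > 1"
  shows "(log_zeta_series has_field_derivative - dirichlet_series mangoldt s) (at s)"
  using log_zeta.has_field_derivative[of s] assms
  by (simp add: log_zeta_series_def of_real_ln_mult_log_coeff)

lemma ln_coeffs: "\<delta> > 0 \<Longrightarrow> dirichlet_coeffs (\<lambda>n. of_real (ln (real n)) * 1) \<delta> (1 / \<delta>)"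
  using one.coeffs_mult_ln[of \<delta>] by simp

lemma mangoldt_coeffs: "\<delta> > 0 \<Longrightarrow> dirichlet_coeffs mangoldt \<delta> (1 / \<delta>)"
  using log_zeta.coeffs_mult_ln[of \<delta>] by (simp add: of_real_ln_mult_log_coeff)

lemma zeta_has_field_derivative:
  assumes s: "Re s > 1"
  shows "(zeta has_field_derivative - dirichlet_series mangoldt s * zeta s) (at s)"
proof -
  let ?ln = "\<lambda>n. complex_of_real (ln (real n))"
  define \<delta> where "\<delta> = (Re s - 1) / 2"
  have \<delta>: "\<delta> > 0" "Re s > \<delta> + 1" using s by (auto simp: \<delta>_def field_simps)
  have conv: "dirichlet_conv mangoldt (\<lambda>_. 1) n * of_nat n powr (- s)
      = ?ln n * 1 * of_nat n powr (- s)"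
    for n
    using mangoldt_sum[of n, where ?'a = complex] by (cases "n = 0") (auto simp: dirichlet_conv_def)
  have "(\<lambda>n. dirichlet_conv mangoldt (\<lambda>_. 1) n * of_nat n powr (- s))
      sums (dirichlet_series mangoldt s * dirichlet_series (\<lambda>_. 1) s)"
    by (intro dirichlet_series_mult_sums one.summable_norm_terms
          dirichlet_coeffs.summable_norm_terms[OF mangoldt_coeffs[OF \<delta>(1)] \<delta>(2)])
       (use s in simp)
  with dirichlet_coeffs.sums[OF ln_coeffs[OF \<delta>(1)] \<delta>(2)]
  have "dirichlet_series (\<lambda>n. ?ln n * 1) s = dirichlet_series mangoldt s * zeta s"
    unfolding conv zeta_eq_dirichlet_series[OF s] by (rule sums_unique2)
  with one.has_field_derivative[of s] s
  have "(dirichlet_series (\<lambda>_. 1)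
      has_field_derivative - dirichlet_series mangoldt s * zeta s) (at s)"
    by simp
  then show ?thesis
    by (rule has_field_derivative_transform_within_open[OF _ open_half[of 1]])
       (use s in \<open>auto simp: zeta_eq_dirichlet_series\<close>)
qed

lemma exp_log_zeta_series:
  assumes s: "Re s > 1"
  shows "exp (log_zeta_series s) = zeta s"
proof -
  define W where "W = (\<lambda>s. zeta s * exp (- log_zeta_series s))"
  have "(W has_field_derivative 0) (at s)" if "Re s > 1" for s
    unfolding W_def
    by (rule DERIV_cong, (rule derivative_intros zeta_has_field_derivative[OF that]
          log_zeta_series_has_field_derivative[OF that])+) (simp add: algebra_simps)
  then have "\<exists>k. \<forall>s\<in>{s. Re s > 1}. W s = k"
    by (intro has_field_derivative_zero_constant)
       (auto intro: convex_halfspace_Re_gt has_field_derivative_at_within)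
  then obtain k where k: "\<And>s. Re s > 1 \<Longrightarrow> W s = k" by auto
  have top: "filterlim (\<lambda>x::real. Re (of_real x :: complex)) at_top at_top"
    by (simp add: filterlim_ident)
  have "((\<lambda>x. dirichlet_series (\<lambda>_. 1) (of_real x) * exp (- log_zeta_series (of_real x)))
      \<longlongrightarrow> 1 * exp (- of_real (log_coeff 1))) at_top"
    unfolding log_zeta_series_def
    by (intro tendsto_intros one.tendsto_first log_zeta.tendsto_first top)
  moreover have "\<forall>\<^sub>F x in at_top.
      dirichlet_series (\<lambda>_. 1) (of_real x) * exp (- log_zeta_series (of_real x)) = k"
    using eventually_gt_at_top[of 1]
    by eventually_elim (use k in \<open>auto simp: W_def zeta_eq_dirichlet_series\<close>)
  then have "((\<lambda>x::real. dirichlet_series (\<lambda>_. 1) (of_real x) * exp (- log_zeta_series (of_real x)))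
      \<longlongrightarrow> k) at_top"
    by (rule tendsto_eventually)
  ultimately have "k = 1" using tendsto_unique[OF trivial_limit_at_top_linorder] by force
  then show ?thesis using k[OF s] by (simp add: W_def exp_minus field_simps)
qed

lemma norm_zeta_eq: "Re s > 1 \<Longrightarrow> cmod (zeta s) = exp (Re (log_zeta_series s))"
  using exp_log_zeta_series[of s] norm_exp_eq_Re[of "log_zeta_series s"] by simp

lemma zeta_three_four_one:
  assumes x: "x > 1"
  shows "1 \<le> cmod (zeta (Complex x 0)) ^ 3 * cmod (zeta (Complex x t)) ^ 4 *
      cmod (zeta (Complex x (2 * t)))"
proof -
  let ?L = "\<lambda>u. Re (log_zeta_series (Complex x u))"
  let ?v = "\<lambda>n u. log_coeff n * exp (- x * ln (real n)) * cos (u * ln (real n))"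
  have "3 + 4 * cos y + cos (2 * y) = 2 * (1 + cos y)\<^sup>2" for y :: real
    unfolding cos_double_cos by (simp add: power2_eq_square algebra_simps)
  then have cos: "3 + 4 * cos y + cos (2 * y) \<ge> 0" for y :: real by simp
  have nonneg: "0 \<le> 3 * ?v n 0 + 4 * ?v n t + ?v n (2 * t)" for n
  proof -
    have "3 * ?v n 0 + 4 * ?v n t + ?v n (2 * t) = log_coeff n * exp (- x * ln (real n)) *
        (3 + 4 * cos (t * ln (real n)) + cos (2 * (t * ln (real n))))"
      by (simp add: algebra_simps)
    then show ?thesis using cos log_coeff_nonneg[of n] by simp
  qed
  have sm: "(\<lambda>n. 3 * ?v n 0 + 4 * ?v n t + ?v n (2 * t)) sums (3 * ?L 0 + 4 * ?L t + ?L (2 * t))"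
    by (intro sums_add sums_mult Re_log_zeta_series_sums x)
  have "3 * ?L 0 + 4 * ?L t + ?L (2 * t) \<ge> 0"
    by (rule sums_le[OF nonneg sums_zero sm])
  then have "1 \<le> exp (3 * ?L 0 + 4 * ?L t + ?L (2 * t))" by simp
  also have "\<dots> = cmod (zeta (Complex x 0)) ^ 3 * cmod (zeta (Complex x t)) ^ 4 *
      cmod (zeta (Complex x (2 * t)))"
    using x by (simp add: norm_zeta_eq exp_add flip: exp_of_nat_mult)
  finally show ?thesis .
qed

section \<open>The entire function \<open>(s - 1) \<zeta>(s)\<close>\<close>

definition zeta_reg :: "complex \<Rightarrow> complex" where
  "zeta_reg s = (if s = 1 then 1 else (s - 1) * zeta s)"

lemma zeta_reg_1 [simp]: "zeta_reg 1 = 1"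
  by (simp add: zeta_reg_def)

lemma zeta_eq_zeta_reg: "zeta s = zeta_reg s / (s - 1)"
  by (simp add: zeta_reg_def zeta_1)

lemma norm_binomial_remainder_le:
  assumes a: "Re a \<le> real (Suc N)" and x: "0 \<le> x" "x \<le> 1"
  shows "cmod ((1 + of_real x) powr a - (\<Sum>j\<le>N. ffact j a / fact j * of_real x ^ j))
           \<le> cmod (ffact (Suc N) a) * x ^ Suc N"
proof -
  define f where "f = (\<lambda>i z. ffact i a * (1 + z) powr (a - of_nat i))"
  define B where "B = cmod (ffact (Suc N) a)"
  let ?I = "complex_of_real ` {0..1}"
  have "cmod (f 0 (of_real x) - (\<Sum>i\<le>N. f i 0 * (of_real x - 0) ^ i / fact i))
          \<le> B * cmod (of_real x - 0) ^ Suc N / fact N"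
  proof (rule complex_Taylor[where S = ?I])
    show "convex ?I"
      by (intro convex_linear_image) (auto intro: linearI simp: scaleR_conv_of_real)
    show "0 \<in> ?I" "of_real x \<in> ?I" using x by (auto intro!: image_eqI[of _ _ 0])
    fix z assume "z \<in> ?I"
    then obtain y where y: "z = of_real y" "0 \<le> y" "y \<le> 1" by auto
    show "(f i has_field_derivative f (Suc i) z) (at z within ?I)" for i
    proof -
      have "1 + z \<notin> \<real>\<^sub>\<le>\<^sub>0" using y by (auto simp: complex_nonpos_Reals_iff)
      then have "(f i has_field_derivative
          ffact i a * ((a - of_nat i) * (1 + z) powr (a - of_nat i - 1))) (at z within ?I)"
        unfolding f_def by (auto intro!: derivative_eq_intros)
      then show ?thesis by (simp add: f_def ffact_def algebra_simps)
    qed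
    have "cmod ((1 + z) powr (a - of_nat (Suc N))) = (1 + y) powr (Re a - real (Suc N))"
      using norm_powr_real_powr[of "of_real (1 + y)" "a - of_nat (Suc N)"] y by simp
    also have "\<dots> \<le> (1 + y) powr 0" using y a by (intro powr_mono) auto
    finally have "cmod ((1 + z) powr (a - of_nat (Suc N))) \<le> 1" using y by simp
    then show "cmod (f (Suc N) z) \<le> B"
      unfolding f_def B_def norm_mult by (simp add: mult_left_le)
  qed
  also have "B * cmod (of_real x - 0) ^ Suc N / fact N \<le> B * x ^ Suc N / 1"
    using x by (intro frac_le) (auto simp: B_def fact_ge_1)
  finally show ?thesis
    by (simp add: f_def B_def ffact_def mult.commute mult.left_commute)
qed

lemma norm_suminf_zrem_le:
  assumes \<tau>: "\<tau> > 1" and s: "Re s \<ge> \<tau> - real N"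
  shows "cmod (\<Sum>n. zrem N n s)
    \<le> (cmod (1 - s) + real (Suc N)) ^ Suc N * (\<Sum>n. real (Suc n) powr (- \<tau>))"
proof -
  define C where "C = (cmod (1 - s) + real (Suc N)) ^ Suc N"
  have sm: "summable (\<lambda>n. real (Suc n) powr (- \<tau>))" using \<tau> by (intro summable_Suc_powr) auto
  have "cmod (\<Sum>n. zrem N n s) \<le> (\<Sum>n. C * real (Suc n) powr (- \<tau>))"
  proof (rule norm_suminf_le[OF _ summable_mult[OF sm]])
    fix n
    define x where "x = 1 / real (Suc n)"
    have "cmod ((1 + of_real x) powr (1 - s) - (\<Sum>j\<le>N. ffact j (1 - s) / fact j * of_real x ^ j))
        \<le> cmod (ffact (Suc N) (1 - s)) * x ^ Suc N"
      by (rule norm_binomial_remainder_le) (use s \<tau> in \<open>auto simp: x_def\<close>)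
    also have "\<dots> \<le> C * x ^ Suc N"
      unfolding C_def by (intro mult_right_mono norm_ffact_le) (auto simp: x_def)
    finally have "cmod (zrem N n s) \<le> real (Suc n) powr (1 - Re s) * (C * x ^ Suc N)"
      unfolding zrem_def norm_mult norm_of_nat_Suc_powr x_def minus_complex.sel one_complex.sel
      by (rule mult_left_mono) simp
    also have "x ^ Suc N = real (Suc n) powr (- real (Suc N))"
      by (simp only: x_def powr_minus powr_realpow of_nat_0_less_iff zero_less_Suc)
         (simp add: power_one_over inverse_eq_divide)
    also have "real (Suc n) powr (1 - Re s) * (C * real (Suc n) powr (- real (Suc N)))
        = C * real (Suc n) powr (- Re s - real N)"
      by (simp add: powr_add[symmetric] algebra_simps)
    also have "\<dots> \<le> C * real (Suc n) powr (- \<tau>)"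
      using s by (intro mult_left_mono powr_mono) (auto simp: C_def)
    finally show "cmod (zrem N n s) \<le> C * real (Suc n) powr (- \<tau>)" .
  qed
  then show ?thesis unfolding C_def using suminf_mult[OF sm] by simp
qed

lemma zeta_reg_eq_zrem:
  assumes s: "Re s > 0"
  shows "zeta_reg s = 1 + (\<Sum>n. zrem 1 n s)"
proof (cases "s = 1")
  case True
  have "zrem 1 n 1 = 0" for n
    unfolding zrem_eq by (simp add: ffact_def powr_def del: of_nat_Suc)
  then show ?thesis using True by simp
next
  case False
  let ?U = "{s. Re s > 0} - {1}"
  have "(s - 1) * zeta s = 1 + (\<Sum>n. zrem 1 n s)"
  proof (rule analytic_continuation_open[of "{s. Re s > 1}" ?U "\<lambda>s. (s - 1) * zeta s"
        "\<lambda>s. 1 + (\<Sum>n. zrem 1 n s)"])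
    have "2 \<in> {s::complex. Re s > 1}" by simp
    then show "{s::complex. Re s > 1} \<noteq> {}" by blast
    show "connected ?U"
      by (intro connected_open_delete open_half convex_connected convex_halfspace_Re_gt) simp
    show "(\<lambda>s. (s - 1) * zeta s) holomorphic_on ?U"
      by (intro holomorphic_intros holomorphic_on_subset[OF zeta_holomorphic]) auto
    show "(\<lambda>s. 1 + (\<Sum>n. zrem 1 n s)) holomorphic_on ?U"
      by (intro holomorphic_intros holomorphic_on_subset[OF zrem_sum(1)[of 1]]) auto
    fix z :: complex assume "z \<in> {s. Re s > 1}"
    then show "(z - 1) * zeta z = 1 + (\<Sum>n. zrem 1 n z)"
      using zrem_dseries[of z 1] by (simp add: zeta_eq_dseries ffact_def algebra_simps)
  qed (use s False open_half in auto)
  then show ?thesis using False by (simp add: zeta_reg_def)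
qed

lemma zeta_reg_holomorphic: "zeta_reg holomorphic_on A"
proof -
  have "zeta_reg holomorphic_on {s. Re s > 0}"
    by (rule holomorphic_transform[of "\<lambda>s. 1 + (\<Sum>n. zrem 1 n s)"])
       (use zrem_sum(1)[of 1] in \<open>auto intro!: holomorphic_intros simp: zeta_reg_eq_zrem\<close>)
  moreover have "zeta_reg holomorphic_on - {1}"
    by (rule holomorphic_transform[of "\<lambda>s. (s - 1) * zeta s"])
       (auto intro!: holomorphic_intros zeta_holomorphic simp: zeta_reg_def)
  ultimately have "zeta_reg holomorphic_on ({s. Re s > 0} \<union> - {1})"
    by (rule holomorphic_on_Un) (auto intro: open_half)
  then show ?thesis by (rule holomorphic_on_subset) auto
qed

lemma isCont_zeta_reg: "isCont zeta_reg s"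
  using holomorphic_on_imp_continuous_on[OF zeta_reg_holomorphic[of UNIV]]
  by (simp add: continuous_on_eq_continuous_at)

lemma tendsto_Complex_left [tendsto_intros]:
  "(f \<longlongrightarrow> a) F \<Longrightarrow> ((\<lambda>x. Complex (f x) t) \<longlongrightarrow> Complex a t) F"
  unfolding Complex_eq by (intro tendsto_intros)

lemma continuous_on_Complex_left [continuous_intros]:
  "continuous_on A f \<Longrightarrow> continuous_on A (\<lambda>x. Complex (f x) t)"
  unfolding Complex_eq by (intro continuous_intros)

subsection \<open>Growth\<close>

definition log_height :: "real \<Rightarrow> real" where
  "log_height t = ln (\<bar>t\<bar> + 3)"

lemma log_height_ge_1: "log_height t \<ge> 1"
proof -
  have "exp 1 \<le> \<bar>t\<bar> + 3" using exp_le by linarith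
  then show ?thesis unfolding log_height_def by (subst ln_ge_iff) auto
qed

lemma log_height_add_le: "log_height (t + u) \<le> log_height t * (1 + \<bar>u\<bar>)"
proof -
  have "\<bar>t + u\<bar> + 3 \<le> (\<bar>t\<bar> + 3) * (1 + \<bar>u\<bar>)"
    using abs_triangle_ineq[of t u] mult_nonneg_nonneg[of "\<bar>t\<bar>" "\<bar>u\<bar>"] abs_ge_zero[of u]
    unfolding distrib_left distrib_right by linarith
  also have "\<dots> \<le> (\<bar>t\<bar> + 3) * exp \<bar>u\<bar>" by (intro mult_left_mono exp_ge_add_one_self) auto
  finally have "log_height (t + u) \<le> ln ((\<bar>t\<bar> + 3) * exp \<bar>u\<bar>)"
    unfolding log_height_def by (subst ln_le_cancel_iff) auto
  also have "\<dots> = log_height t + \<bar>u\<bar>" by (simp add: log_height_def ln_mult)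
  also have "\<dots> \<le> log_height t * (1 + \<bar>u\<bar>)"
    using mult_right_mono[OF log_height_ge_1[of t], of "\<bar>u\<bar>"] by (simp add: distrib_left)
  finally show ?thesis .
qed

lemma log_height_near:
  assumes "\<bar>u - t\<bar> \<le> d"
  shows "log_height u \<le> log_height t * (1 + d)"
proof -
  have "log_height u \<le> log_height t * (1 + \<bar>u - t\<bar>)"
    using log_height_add_le[of t "u - t"] by simp
  also have "\<dots> \<le> log_height t * (1 + d)"
    using assms log_height_ge_1[of t] by (intro mult_left_mono) auto
  finally show ?thesis .
qed

lemma zeta_reg_growth:
  obtains C where "C > 0"
    "\<And>s. 1/8 \<le> Re s \<Longrightarrow> Re s \<le> 4 \<Longrightarrow> cmod (zeta_reg s) \<le> exp (C * log_height (Im s))"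
proof -
  define K where "K = (\<Sum>n. real (Suc n) powr (- (9/8)))"
  have K: "K \<ge> 0" unfolding K_def by (intro suminf_nonneg summable_Suc_powr) auto
  define C where "C = ln (1 + K) + 4"
  have "cmod (zeta_reg s) \<le> exp (C * log_height (Im s))" if s: "1/8 \<le> Re s" "Re s \<le> 4" for s
  proof -
    define y where "y = \<bar>Im s\<bar> + 3"
    have y: "y \<ge> 3" by (simp add: y_def)
    have "cmod (1 - s) + 2 \<le> y + 4"
      using cmod_le[of "1 - s"] s by (simp add: y_def)
    also have "\<dots> \<le> y\<^sup>2" using mult_right_mono[of 3 y y] y unfolding power2_eq_square by linarith
    finally have "(cmod (1 - s) + 2)\<^sup>2 \<le> (y\<^sup>2)\<^sup>2" by (intro power_mono) auto
    then have "(cmod (1 - s) + 2)\<^sup>2 * K \<le> y ^ 4 * K" using K by (intro mult_right_mono) auto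
    moreover have "cmod (\<Sum>n. zrem 1 n s) \<le> (cmod (1 - s) + 2)\<^sup>2 * K"
      using norm_suminf_zrem_le[of "9/8" 1 s] s by (simp add: K_def numeral_2_eq_2)
    moreover have "1 \<le> y ^ 4" using y by (intro one_le_power) auto
    ultimately have "cmod (zeta_reg s) \<le> (1 + K) * y ^ 4"
      using s norm_triangle_ineq[of 1 "\<Sum>n. zrem 1 n s"]
      by (simp add: zeta_reg_eq_zrem algebra_simps)
    also have "\<dots> = exp (ln (1 + K) + 4 * ln y)"
      using K y exp_of_nat_mult[of 4 "ln y"] by (simp add: exp_add)
    also have "\<dots> \<le> exp (C * log_height (Im s))"
      using mult_left_mono[OF log_height_ge_1[of "Im s"], of "ln (1 + K)"] K
      by (simp add: C_def y_def log_height_def distrib_right)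
    finally show ?thesis .
  qed
  moreover have "C > 0" using K by (simp add: C_def add_nonneg_pos)
  ultimately show ?thesis by (rule that[rotated])
qed

subsection \<open>Zeros\<close>

lemma zeta_pole_limit: "((\<lambda>x. (x - 1) * cmod (zeta (Complex x 0))) \<longlongrightarrow> 1) (at_right 1)"
proof (rule Lim_transform_eventually)
  have "((\<lambda>x. cmod (zeta_reg (Complex x 0))) \<longlongrightarrow> cmod (zeta_reg (Complex 1 0))) (at_right 1)"
    by (intro tendsto_norm isCont_tendsto_compose[OF isCont_zeta_reg] tendsto_intros)
  then show "((\<lambda>x. cmod (zeta_reg (Complex x 0))) \<longlongrightarrow> 1) (at_right 1)"
    by (simp add: zeta_reg_1 flip: one_complex.code)
  have "Complex x 0 - 1 = of_real (x - 1)" for x by (simp add: complex_eq_iff)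
  then have "cmod (Complex x 0 - 1) = \<bar>x - 1\<bar>" for x by (simp only: norm_of_real)
  then show "\<forall>\<^sub>F x in at_right 1. cmod (zeta_reg (Complex x 0))
      = (x - 1) * cmod (zeta (Complex x 0))"
    by (auto simp: eventually_at_filter zeta_reg_def norm_mult complex_eq_iff)
qed

lemma zeta_nonzero_Re_eq_1:
  assumes t: "t \<noteq> 0"
  shows "zeta (Complex 1 t) \<noteq> 0"
proof
  assume zero: "zeta (Complex 1 t) = 0"
  have deriv: "(zeta has_field_derivative deriv zeta (Complex 1 u)) (at (Complex 1 u))"
    if "u \<noteq> 0" for u
    by (rule holomorphic_derivI[OF zeta_holomorphic]) (use that in \<open>auto simp: complex_eq_iff\<close>)
  have right: "\<forall>\<^sub>F x in at_right (1::real). x > 1" by (simp add: eventually_at_filter)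
  let ?a = "\<lambda>x. (x - 1) * cmod (zeta (Complex x 0))"
    and ?b = "\<lambda>x. cmod (zeta (Complex x t)) / (x - 1)"
    and ?c = "\<lambda>x. cmod (zeta (Complex x (2 * t)))"
  have a: "(?a \<longlongrightarrow> 1) (at_right 1)" by (rule zeta_pole_limit)
  have b: "(?b \<longlongrightarrow> cmod (deriv zeta (Complex 1 t))) (at_right 1)"
  proof (rule Lim_transform_eventually)
    have "filterlim (\<lambda>x. Complex x t) (at (Complex 1 t)) (at_right 1)"
      by (auto simp: filterlim_at eventually_at_filter intro!: tendsto_intros)
    with deriv[OF t] show "((\<lambda>x.
        cmod ((zeta (Complex x t) - zeta (Complex 1 t)) / (Complex x t - Complex 1 t)))
        \<longlongrightarrow> cmod (deriv zeta (Complex 1 t))) (at_right 1)"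
      unfolding has_field_derivative_iff by (intro tendsto_norm) (rule filterlim_compose)
    have "Complex x t - Complex 1 t = of_real (x - 1)" for x by (simp add: complex_eq_iff)
    then have dist: "cmod (Complex x t - Complex 1 t) = \<bar>x - 1\<bar>" for x by (simp only: norm_of_real)
    show "\<forall>\<^sub>F x in at_right 1.
        cmod ((zeta (Complex x t) - zeta (Complex 1 t)) / (Complex x t - Complex 1 t)) = ?b x"
      using right by eventually_elim (simp add: zero norm_divide dist)
  qed
  have c: "(?c \<longlongrightarrow> cmod (zeta (Complex 1 (2 * t)))) (at_right 1)"
    by (intro tendsto_norm isCont_tendsto_compose[OF DERIV_isCont[OF deriv]] tendsto_intros)
       (use t in simp)
  have "((\<lambda>x. (x - 1) * (?a x ^ 3 * ?b x ^ 4 * ?c x)) \<longlongrightarrow> (1 - 1) *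
      (1 ^ 3 * cmod (deriv zeta (Complex 1 t)) ^ 4 * cmod (zeta (Complex 1 (2 * t))))) (at_right 1)"
    by (intro tendsto_intros a b c)
  then have "((\<lambda>x. (x - 1) * (?a x ^ 3 * ?b x ^ 4 * ?c x)) \<longlongrightarrow> 0) (at_right 1)" by simp
  moreover have "\<forall>\<^sub>F x in at_right 1. 1 \<le> (x - 1) * (?a x ^ 3 * ?b x ^ 4 * ?c x)"
    using right
  proof eventually_elim
    case (elim x)
    have cancel: "e * ((e * a) ^ 3 * (b / e) ^ 4 * c) = a ^ 3 * b ^ 4 * c"
      if "e \<noteq> 0" for a b c e :: real
      using that by (simp add: field_simps power_mult_distrib power4_eq_xxxx power3_eq_cube)
    show ?case using zeta_three_four_one[OF elim, of t] elim by (subst cancel) auto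
  qed
  ultimately have "(1::real) \<le> 0" by (rule tendsto_lowerbound) simp
  then show False by simp
qed

lemma zeta_reg_zero_imp_Re_le:
  assumes RH: riemann_hypothesis and zero: "zeta_reg s = 0"
  shows "Re s \<le> 1/2"
proof (rule ccontr)
  assume "\<not> Re s \<le> 1/2"
  have "s \<noteq> 1" using zero by auto
  have zeta: "zeta s = 0" using zero by (simp add: zeta_eq_zeta_reg)
  consider "Re s < 1" | "Re s = 1" | "Re s > 1" by linarith
  then show False
  proof cases
    case 1
    then show False using RH zeta \<open>\<not> Re s \<le> 1/2\<close> unfolding riemann_hypothesis_def by force
  next
    case 2
    then have "s = Complex 1 (Im s)" "Im s \<noteq> 0" using \<open>s \<noteq> 1\<close> by (auto simp: complex_eq_iff)
    then show False using zeta zeta_nonzero_Re_eq_1 by metis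
  next
    case 3
    then show False using zeta exp_log_zeta_series[of s] by (metis exp_not_eq_zero)
  qed
qed

lemma zeta_reg_not_constant: "\<not> zeta_reg constant_on UNIV"
proof
  assume "zeta_reg constant_on UNIV"
  then have "zeta_reg s = 1" for s using zeta_reg_1 unfolding constant_on_def by (metis UNIV_I)
  then have "dirichlet_series (\<lambda>_. 1) (of_real x) = 1 / (of_real x - 1)" if "x > 1" for x
    using that zeta_eq_dirichlet_series[of "of_real x"] zeta_eq_zeta_reg[of "of_real x"] by simp
  then have "\<forall>\<^sub>F x in at_top. dirichlet_series (\<lambda>_. 1) (of_real x) = 1 / (of_real x - 1)"
    by (intro eventually_mono[OF eventually_gt_at_top[of 1]])
  moreover have "((\<lambda>x. dirichlet_series (\<lambda>_. 1) (of_real x)) \<longlongrightarrow> 1) at_top"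
    by (rule one.tendsto_first) (simp add: filterlim_ident)
  ultimately have "((\<lambda>x. 1 / (complex_of_real x - 1)) \<longlongrightarrow> 1) at_top"
    by (rule Lim_transform_eventually[rotated])
  moreover have "((\<lambda>x. complex_of_real (1 / (x - 1))) \<longlongrightarrow> of_real 0) at_top"
    by (intro tendsto_of_real) real_asymp
  ultimately show False using tendsto_unique[OF trivial_limit_at_top_linorder] by force
qed

lemma countable_zeta_zero_ordinates: "countable {t. zeta_zero_ordinate t}"
proof -
  have "countable {z \<in> UNIV. zeta_reg z = 0}"
    by (rule holomorphic_countable_zeros[OF zeta_reg_holomorphic])
       (use zeta_reg_not_constant in auto)
  then have "countable (Im ` insert 1 {z. zeta_reg z = 0})" by simp
  then show ?thesis
    by (rule countable_subset[rotated])
       (auto simp: zeta_zero_ordinate_def zeta_eq_zeta_reg image_iff)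
qed

lemma AE_not_zeta_zero_ordinate: "AE u in lborel. \<not> zeta_zero_ordinate (u + a)"
proof -
  have "countable ((\<lambda>t. t - a) ` {t. zeta_zero_ordinate t})"
    by (intro countable_image countable_zeta_zero_ordinates)
  then have "AE u in lborel. u \<notin> (\<lambda>t. t - a) ` {t. zeta_zero_ordinate t}"
    by (intro AE_not_in countable_imp_null_set_lborel)
  then show ?thesis by eventually_elim (force simp: image_iff)
qed

section \<open>Fourier transforms\<close>

lemma cis_measurable [measurable]: "(\<lambda>u::real. cis (- (x * u))) \<in> borel_measurable borel"
  unfolding cis_conv_exp by (intro borel_measurable_continuous_onI continuous_intros)

lemma fourier_even:
  fixes f :: "real \<Rightarrow> real"
  assumes f: "integrable lborel f" and even: "\<And>v. f (- v) = f v"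
  shows "fourier (\<lambda>v. of_real (f v)) x = of_real (\<integral>v. f v * cos (x * v) \<partial>lborel)"
proof -
  have [measurable]: "f \<in> borel_measurable borel" using f by auto
  have cos: "integrable lborel (\<lambda>v. f v * cos (x * v))"
    and sin: "integrable lborel (\<lambda>v. f v * sin (x * v))"
    by (auto intro!: Bochner_Integration.integrable_bound[OF f] simp: abs_mult mult_left_le)
  have odd: "(\<integral>v. f v * sin (x * v) \<partial>lborel) = 0"
    using lborel_integral_real_affine[of "-1" "\<lambda>v. f v * sin (x * v)" 0] by (simp add: even)
  have "of_real (f v) * cis (- (x * v))
      = of_real (f v * cos (x * v)) - \<i> * of_real (f v * sin (x * v))" for v
    by (simp add: complex_eq_iff)
  then have "fourier (\<lambda>v. of_real (f v)) x
      = (\<integral>v. of_real (f v * cos (x * v)) \<partial>lborel) - (\<integral>v. \<i> * of_real (f v * sin (x * v)) \<partial>lborel)"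
    unfolding fourier_def using cos sin
    by (simp only: Bochner_Integration.integral_diff integrable_mult_right integrable_of_real)
  also have "\<dots> = of_real (\<integral>v. f v * cos (x * v) \<partial>lborel)"
    using odd by (simp only: integral_mult_right_zero integral_complex_of_real) simp
  finally show ?thesis .
qed

lemma convolution_cis_integrable:
  fixes f g :: "real \<Rightarrow> real" and x :: real
  assumes f: "integrable lborel f" and g: "integrable lborel g"
  defines "h \<equiv> \<lambda>v u. complex_of_real (f v * g (u - v)) * cis (- (x * u))"
  shows "integrable (lborel \<Otimes>\<^sub>M lborel) (\<lambda>(v, u). h v u)"
proof (rule lborel_pair.Fubini_integrable)
  have [measurable]: "f \<in> borel_measurable borel" "g \<in> borel_measurable borel" using f g by auto
  show "(\<lambda>(v, u). h v u) \<in> borel_measurable (lborel \<Otimes>\<^sub>M lborel)"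
    unfolding h_def by measurable
  have "(\<integral>u. norm (h v u) \<partial>lborel) = \<bar>f v\<bar> * (\<integral>u. \<bar>g u\<bar> \<partial>lborel)" for v
    using lborel_integral_translate[of "\<lambda>u. \<bar>g u\<bar>" "- v"] by (simp add: h_def norm_mult abs_mult)
  then show "integrable lborel (\<lambda>v. \<integral>u. norm (case (v, u) of (v, u) \<Rightarrow> h v u) \<partial>lborel)"
    using f by simp
  have g_shift: "integrable lborel (\<lambda>u. g (u - v))" for v
    using lborel_integrable_translate[OF g, of "- v"] by simp
  have "integrable lborel (\<lambda>u. h v u)" for v
    unfolding h_def
    by (rule Bochner_Integration.integrable_bound[OF
          integrable_mult_right[OF g_shift[of v], of "f v"]])
       (auto simp: norm_mult)
  then show "AE v in lborel. integrable lborel (\<lambda>u. case (v, u) of (v, u) \<Rightarrow> h v u)" by simp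
qed

lemma convolution_fourier:
  fixes f g :: "real \<Rightarrow> real"
  assumes f: "integrable lborel f" and g: "integrable lborel g"
  shows "integrable lborel (\<lambda>u. \<integral>v. f v * g (u - v) \<partial>lborel)"
    and "fourier (\<lambda>u. of_real (\<integral>v. f v * g (u - v) \<partial>lborel)) x
      = fourier (\<lambda>v. of_real (f v)) x * fourier (\<lambda>v. of_real (g v)) x"
proof -
  let ?h = "\<lambda>x v u. of_real (f v * g (u - v)) * cis (- (x * u))"
  have int: "integrable (lborel \<Otimes>\<^sub>M lborel) (\<lambda>(v, u). ?h x v u)" for x
    by (rule convolution_cis_integrable[OF f g])
  have inner_v: "(\<integral>v. ?h x v u \<partial>lborel) = of_real (\<integral>v. f v * g (u - v) \<partial>lborel) * cis (- (x * u))"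
    for x u
    unfolding integral_mult_left_zero integral_complex_of_real ..
  have "integrable lborel (\<lambda>u. of_real (\<integral>v. f v * g (u - v) \<partial>lborel) * cis (- (0 * u)))"
    using lborel_pair.integrable_snd[OF int[of 0]] unfolding inner_v by simp
  from integrable_Re[OF this] show "integrable lborel (\<lambda>u. \<integral>v. f v * g (u - v) \<partial>lborel)" by simp
  have inner_u: "(\<integral>u. ?h x v u \<partial>lborel)
      = of_real (f v) * cis (- (x * v)) * fourier (\<lambda>v. of_real (g v)) x" for v
  proof -
    have "cis (- (x * (w + v))) = cis (- (x * v)) * cis (- (x * w))" for w
      by (simp add: cis_mult algebra_simps)
    then have eq: "?h x v (w + v)
        = of_real (f v) * cis (- (x * v)) * (of_real (g w) * cis (- (x * w)))" for w
      by (simp add: mult_ac)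
    have "(\<integral>u. ?h x v u \<partial>lborel) = (\<integral>w. ?h x v (w + v) \<partial>lborel)"
      by (rule lborel_integral_translate[symmetric])
    then show ?thesis by (simp only: eq fourier_def integral_mult_right_zero)
  qed
  have "fourier (\<lambda>u. of_real (\<integral>v. f v * g (u - v) \<partial>lborel)) x
      = (\<integral>u. (\<integral>v. ?h x v u \<partial>lborel) \<partial>lborel)"
    unfolding fourier_def inner_v ..
  also have "\<dots> = (\<integral>v. (\<integral>u. ?h x v u \<partial>lborel) \<partial>lborel)"
    by (rule lborel_pair.Fubini_integral[OF int])
  also have "\<dots> = fourier (\<lambda>v. of_real (f v)) x * fourier (\<lambda>v. of_real (g v)) x"
    unfolding inner_u by (simp add: fourier_def)
  finally show "fourier (\<lambda>u. of_real (\<integral>v. f v * g (u - v) \<partial>lborel)) x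
      = fourier (\<lambda>v. of_real (f v)) x * fourier (\<lambda>v. of_real (g v)) x" .
qed

section \<open>The smoothing kernel\<close>

lemma cosh_ge_quadratic: "cosh (pi * x) \<ge> 1 + (x::real)\<^sup>2"
proof -
  have cosh_ge: "cosh y \<ge> 1 + y\<^sup>2 / 4" if "y \<ge> 0" for y :: real
    using exp_lower_Taylor_quadratic[OF that] exp_ge_add_one_self[of "- y"]
    by (simp add: cosh_field_def)
  have "cosh (pi * x) = cosh (pi * \<bar>x\<bar>)" by (cases "x \<ge> 0") auto
  also have "\<dots> \<ge> 1 + (pi * \<bar>x\<bar>)\<^sup>2 / 4" by (rule cosh_ge) auto
  finally have "cosh (pi * x) \<ge> 1 + (pi / 2)\<^sup>2 * x\<^sup>2" by (simp add: power_mult_distrib power_divide)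
  moreover have "1 * x\<^sup>2 \<le> (pi / 2)\<^sup>2 * x\<^sup>2"
    using pi_ge_two by (intro mult_right_mono) (auto simp: one_le_power)
  ultimately show ?thesis by linarith
qed

lemma Re_cosh: "Re (cosh z) = cosh (Re z) * cos (Im z)"
  by (simp add: cosh_field_def Re_exp add_divide_distrib algebra_simps)

lemma norm_sinh_le: "cmod (sinh z) \<le> cosh (Re z)"
  using norm_triangle_ineq4[of "exp z" "exp (- z)"]
  by (simp add: sinh_field_def cosh_field_def norm_divide)

lemma cosh_complex_of_real: "cosh (complex_of_real x) = of_real (cosh x)"
  by (simp add: cosh_field_def flip: exp_of_real)

lemma exp_neg_mult_power_le:
  fixes c q v :: real
  assumes c: "c > 0" and q: "q \<ge> 1 + v\<^sup>2" and k: "k \<le> 3"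
  shows "exp (- c * q) * q ^ k \<le> 256 / c ^ 4 / (1 + v\<^sup>2)"
proof -
  have q1: "q \<ge> 1" using q zero_le_power2[of v] by linarith
  have "0 \<le> c * q / 4" using c q1 by simp
  then have "(c * q / 4) ^ 4 \<le> exp (c * q / 4) ^ 4"
    using exp_ge_add_one_self[of "c * q / 4"] by (intro power_mono) linarith+
  also have "\<dots> = exp (c * q)" using exp_of_nat_mult[of 4 "c * q / 4"] by simp
  finally have "exp (- c * q) \<le> 256 / c ^ 4 / q ^ 4"
    using c q1 by (simp add: exp_minus field_simps power_mult_distrib)
  moreover have "q ^ k \<le> q ^ 3" using k q1 by (rule power_increasing)
  ultimately have "exp (- c * q) * q ^ k \<le> 256 / c ^ 4 / q ^ 4 * q ^ 3"
    using q1 by (intro mult_mono) auto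
  also have "\<dots> = 256 / c ^ 4 / q"
    using q1 by (simp add: power4_eq_xxxx power3_eq_cube)
  also have "\<dots> \<le> 256 / c ^ 4 / (1 + v\<^sup>2)"
    using c q one_plus_square_pos[of v] by (intro divide_left_mono) auto
  finally show ?thesis .
qed

text \<open>The term \<open>cosh 2\<pi>v\<close> gives the double exponential decay but its real part vanishes on the
  lines \<open>Im v = \<plusminus>1/4\<close>; the term \<open>cosh \<pi>v\<close> keeps the integrals absolutely convergent there.\<close>

definition phi :: "real \<Rightarrow> real \<Rightarrow> real" where
  "phi c v = exp (- c * (cosh (2 * pi * v) + cosh (pi * v)))"

definition phi_cx :: "real \<Rightarrow> complex \<Rightarrow> complex" where
  "phi_cx c z = exp (- of_real c * (cosh (of_real (2 * pi) * z) + cosh (of_real pi * z)))"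

definition phi_cx_deriv :: "real \<Rightarrow> complex \<Rightarrow> complex" where
  "phi_cx_deriv c z = - of_real c *
    (of_real (2 * pi) * sinh (of_real (2 * pi) * z) + of_real pi * sinh (of_real pi * z)) *
    phi_cx c z"

lemma phi_cx_of_real: "phi_cx c (of_real v) = of_real (phi c v)"
proof -
  have "of_real (2 * pi) * complex_of_real v = of_real (2 * pi * v)"
    "of_real pi * complex_of_real v = of_real (pi * v)"
    by simp_all
  then show ?thesis unfolding phi_cx_def phi_def
    by (simp only: cosh_complex_of_real of_real_add[symmetric] of_real_mult[symmetric]
          of_real_minus[symmetric] exp_of_real)
qed

lemma phi_cx_has_field_derivative: "(phi_cx c has_field_derivative phi_cx_deriv c z) (at z)"
  unfolding phi_cx_def[abs_def] phi_cx_deriv_def phi_cx_def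
  by (auto intro!: derivative_eq_intros simp: algebra_simps)

lemma phi_cx_holomorphic: "phi_cx c holomorphic_on A"
  using phi_cx_has_field_derivative
  by (meson has_field_derivative_at_within field_differentiable_def holomorphic_on_def)

lemma phi_cx_deriv_holomorphic: "phi_cx_deriv c holomorphic_on A"
proof -
  have "(\<lambda>z. sinh (of_real a * z)) holomorphic_on A" for a :: real
    unfolding sinh_field_def by (intro holomorphic_intros) auto
  then show ?thesis
    unfolding phi_cx_deriv_def[abs_def] by (intro holomorphic_intros phi_cx_holomorphic)
qed

lemma phi_pos: "phi c v > 0"
  by (simp add: phi_def)

lemma phi_even: "phi c (- v) = phi c v"
  by (simp add: phi_def)

lemma norm_phi_cx_le:
  assumes c: "c > 0" and z: "\<bar>Im z\<bar> \<le> 1/4"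
  shows "cmod (phi_cx c z) \<le> exp (- (c / 2) * cosh (pi * Re z))"
proof -
  have bound: "\<bar>pi * Im z\<bar> \<le> pi / 4"
    using mult_left_mono[OF z, of pi] by (simp add: abs_mult)
  have "cos (pi / 4) \<le> cos \<bar>pi * Im z\<bar>"
    using bound by (intro cos_monotone_0_pi_le) auto
  moreover have "1 / 2 \<le> cos (pi / 4)" by (simp add: cos_45 real_le_rsqrt)
  ultimately have "1 / 2 \<le> cos (pi * Im z)" by simp
  then have "cosh (pi * Re z) * (1 / 2) \<le> cosh (pi * Re z) * cos (pi * Im z)"
    by (intro mult_left_mono) auto
  moreover have "0 \<le> cos (2 * pi * Im z)"
    using abs_le_D1[OF bound] abs_le_D2[OF bound] by (intro cos_ge_zero) linarith+
  then have "0 \<le> cosh (2 * pi * Re z) * cos (2 * pi * Im z)" by simp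
  ultimately have "c * (cosh (pi * Re z) * (1 / 2))
      \<le> c * (cosh (2 * pi * Re z) * cos (2 * pi * Im z) + cosh (pi * Re z) * cos (pi * Im z))"
    using c by (intro mult_left_mono) linarith+
  then show ?thesis
    unfolding phi_cx_def norm_exp_eq_Re by (simp add: Re_cosh)
qed

lemma norm_phi_cx_le_quadratic:
  assumes c: "c > 0" and z: "\<bar>Im z\<bar> \<le> 1/4"
  shows "cmod (phi_cx c z) \<le> 256 / (c / 2) ^ 4 / (1 + (Re z)\<^sup>2)"
    and "cmod (phi_cx_deriv c z) \<le> c * (5 * pi) * (256 / (c / 2) ^ 4) / (1 + (Re z)\<^sup>2)"
proof -
  define q where "q = cosh (pi * Re z)"
  have q: "q \<ge> 1 + (Re z)\<^sup>2" "q \<ge> 1"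
    unfolding q_def by (rule cosh_ge_quadratic cosh_real_ge_1)+
  have phi: "cmod (phi_cx c z) \<le> exp (- (c / 2) * q)"
    using norm_phi_cx_le[OF assms] by (simp add: q_def)
  then show "cmod (phi_cx c z) \<le> 256 / (c / 2) ^ 4 / (1 + (Re z)\<^sup>2)"
    using exp_neg_mult_power_le[of "c / 2" "Re z" q 0] c q by simp
  let ?D = "of_real (2 * pi) * sinh (of_real (2 * pi) * z) + of_real pi * sinh (of_real pi * z)"
  have "cosh (2 * pi * Re z) \<le> 2 * q\<^sup>2"
    using cosh_double_cosh[of "pi * Re z"] by (simp add: q_def mult.assoc)
  then have "cmod (sinh (of_real (2 * pi) * z)) \<le> 2 * q\<^sup>2"
    using norm_sinh_le[of "of_real (2 * pi) * z"] by simp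
  moreover have "cmod (sinh (of_real pi * z)) \<le> q\<^sup>2"
    using norm_sinh_le[of "of_real pi * z"] self_le_power[of q 2] q by (simp add: q_def)
  ultimately have "2 * pi * cmod (sinh (of_real (2 * pi) * z)) + pi * cmod (sinh (of_real pi * z))
      \<le> 2 * pi * (2 * q\<^sup>2) + pi * q\<^sup>2"
    by (intro add_mono mult_left_mono) auto
  then have "cmod ?D \<le> 5 * pi * q\<^sup>2"
    using norm_triangle_ineq[of "of_real (2 * pi) * sinh (of_real (2 * pi) * z)"
      "of_real pi * sinh (of_real pi * z)"]
    by (simp add: norm_mult)
  then have "cmod (phi_cx_deriv c z) \<le> c * (5 * pi * q\<^sup>2) * exp (- (c / 2) * q)"
    unfolding phi_cx_deriv_def norm_mult using c phi by (intro mult_mono) auto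
  also have "\<dots> = c * (5 * pi) * (exp (- (c / 2) * q) * q\<^sup>2)" by simp
  also have "\<dots> \<le> c * (5 * pi) * (256 / (c / 2) ^ 4 / (1 + (Re z)\<^sup>2))"
    using c q by (intro mult_left_mono exp_neg_mult_power_le) auto
  finally show "cmod (phi_cx_deriv c z) \<le> c * (5 * pi) * (256 / (c / 2) ^ 4) / (1 + (Re z)\<^sup>2)"
    by simp
qed

lemma phi_measurable [measurable]: "phi c \<in> borel_measurable borel"
  unfolding phi_def[abs_def] by (intro borel_measurable_continuous_onI continuous_intros)

lemma phi_integrable:
  assumes "c > 0"
  shows "integrable lborel (phi c)"
proof (rule integrable_quadratic_decay)
  show "norm (phi c v) \<le> 256 / (c / 2) ^ 4 / (1 + v\<^sup>2)" for v
    using norm_phi_cx_le_quadratic(1)[OF assms, of "of_real v"] by (simp add: phi_cx_of_real)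
qed simp

definition phi_hat :: "real \<Rightarrow> real \<Rightarrow> real" where
  "phi_hat c x = (\<integral>v. phi c v * cos (x * v) \<partial>lborel)"

lemma phi_cos_integrable:
  assumes "c > 0"
  shows "integrable lborel (\<lambda>v. phi c v * cos (x * v))"
  by (rule Bochner_Integration.integrable_bound[OF phi_integrable[OF assms]])
     (auto simp: abs_mult mult_left_le)

lemma fourier_phi: "c > 0 \<Longrightarrow> fourier (\<lambda>v. of_real (phi c v)) x = of_real (phi_hat c x)"
  unfolding phi_hat_def by (intro fourier_even phi_integrable phi_even)

lemma phi_hat_0: "phi_hat c 0 = (\<integral>v. phi c v \<partial>lborel)"
  by (simp add: phi_hat_def)

lemma abs_phi_hat_le:
  assumes c: "c > 0"
  obtains A B where "\<And>x. x \<ge> 0 \<Longrightarrow> \<bar>phi_hat c x\<bar> \<le> A * exp (- x / 4)"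
    "\<And>x. x \<ge> 0 \<Longrightarrow> \<bar>x * phi_hat c x\<bar> \<le> B * exp (- x / 4)"
proof -
  define A where "A = 256 / (c / 2) ^ 4"
  define B where "B = c * (5 * pi) * A"
  interpret phi: strip_decay "phi_cx c" "1/4" A
    by unfold_locales
       (use norm_phi_cx_le_quadratic(1)[OF c] in
        \<open>auto simp: A_def intro: phi_cx_holomorphic\<close>)
  interpret deriv: strip_decay "phi_cx_deriv c" "1/4" B
    by unfold_locales
       (use norm_phi_cx_le_quadratic(2)[OF c] in
        \<open>auto simp: A_def B_def intro: phi_cx_deriv_holomorphic\<close>)
  have phi: "fourier (\<lambda>v. phi_cx c (of_real v)) x = of_real (phi_hat c x)" for x
    using fourier_phi[OF c] by (simp add: phi_cx_of_real)
  have deriv: "fourier (\<lambda>v. phi_cx_deriv c (of_real v)) x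
      = \<i> * of_real x * fourier (\<lambda>v. phi_cx c (of_real v)) x" for x
  proof (rule fourier_derivative)
    show "((\<lambda>v. phi_cx c (of_real v)) has_vector_derivative phi_cx_deriv c (of_real v)) (at v)" for v
      using has_vector_derivative_real_field[OF phi_cx_has_field_derivative] by (simp add: o_def)
    show "continuous_on UNIV (\<lambda>v. phi_cx_deriv c (complex_of_real v))"
      by (intro continuous_on_compose2[OF
              holomorphic_on_imp_continuous_on[OF phi_cx_deriv_holomorphic]]
            continuous_intros) auto
    show "cmod (phi_cx c (of_real v)) \<le> A / (1 + v\<^sup>2)"
      "cmod (phi_cx_deriv c (of_real v)) \<le> B / (1 + v\<^sup>2)" for v
      using phi.decay[of "of_real v"] deriv.decay[of "of_real v"] by auto
  qed
  show ?thesis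
  proof (rule that)
    fix x :: real assume x: "x \<ge> 0"
    show "\<bar>phi_hat c x\<bar> \<le> A * pi * exp (- x / 4)"
      using phi.norm_fourier_le[OF x] unfolding phi by simp
    show "\<bar>x * phi_hat c x\<bar> \<le> B * pi * exp (- x / 4)"
      using deriv.norm_fourier_le[OF x] unfolding deriv phi by (simp add: norm_mult abs_mult)
  qed
qed

lemma phi_hat_decay:
  assumes c: "c > 0"
  obtains C where "\<And>x. x \<ge> 0 \<Longrightarrow> (phi_hat c x)\<^sup>2 \<le> C * exp (- x / 2) / (1 + x\<^sup>2)"
proof -
  obtain A B where A: "\<And>x. x \<ge> 0 \<Longrightarrow> \<bar>phi_hat c x\<bar> \<le> A * exp (- x / 4)"
    and B: "\<And>x. x \<ge> 0 \<Longrightarrow> \<bar>x * phi_hat c x\<bar> \<le> B * exp (- x / 4)"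
    using abs_phi_hat_le[OF c] by blast
  have "(phi_hat c x)\<^sup>2 \<le> (A\<^sup>2 + B\<^sup>2) * exp (- x / 2) / (1 + x\<^sup>2)" if x: "x \<ge> 0" for x
  proof -
    have "(phi_hat c x)\<^sup>2 \<le> (A * exp (- x / 4))\<^sup>2" "(x * phi_hat c x)\<^sup>2 \<le> (B * exp (- x / 4))\<^sup>2"
      using power_mono[OF A[OF x], of 2] power_mono[OF B[OF x], of 2] by simp_all
    then have "(phi_hat c x)\<^sup>2 * (1 + x\<^sup>2) \<le> (A * exp (- x / 4))\<^sup>2 + (B * exp (- x / 4))\<^sup>2"
      by (simp add: algebra_simps power_mult_distrib)
    also have "\<dots> = (A\<^sup>2 + B\<^sup>2) * (exp (- x / 4))\<^sup>2"
      by (simp add: power_mult_distrib distrib_right)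
    also have "(exp (- x / 4))\<^sup>2 = exp (- x / 2)" by (simp flip: exp_double)
    finally show ?thesis using one_plus_square_pos[of x] by (simp add: pos_le_divide_eq)
  qed
  then show ?thesis by (rule that)
qed

lemma phi_hat_continuous:
  assumes c: "c > 0"
  shows "continuous_on UNIV (phi_hat c)"
  unfolding continuous_on_def phi_hat_def
proof (intro ballI integral_dominated_convergence_at_within[OF _ _ phi_integrable[OF c]])
  fix x :: real
  show "AE v in lborel. ((\<lambda>y. phi c v * cos (y * v)) \<longlongrightarrow> phi c v * cos (x * v)) (at x)"
    by (intro AE_I2 tendsto_intros)
  show "AE v in lborel. norm (phi c v * cos (x * v)) \<le> phi c v"
    using phi_pos[of c] by (intro AE_I2) (simp add: abs_mult mult_left_le abs_of_pos)
qed auto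

subsection \<open>Concentration at the origin\<close>

lemma phi_hat_0_ge:
  assumes \<epsilon>: "\<epsilon> > 0"
  obtains \<eta> where "\<eta> > 0" "\<And>c. c > 0 \<Longrightarrow> \<eta> * exp (- c * (2 + \<epsilon>)) \<le> phi_hat c 0"
proof -
  define m where "m = (\<lambda>v::real. cosh (2 * pi * v) + cosh (pi * v))"
  have "isCont m 0" unfolding m_def by (intro continuous_intros)
  then obtain d where d: "d > 0" "\<And>v. dist v 0 < d \<Longrightarrow> dist (m v) (m 0) < \<epsilon>"
    using \<epsilon> unfolding continuous_at_eps_delta by metis
  have "d * exp (- c * (2 + \<epsilon>)) \<le> phi_hat c 0" if c: "c > 0" for c
  proof -
    have "(\<integral>v. exp (- c * (2 + \<epsilon>)) * indicator {-d/2..d/2} v \<partial>lborel) \<le> (\<integral>v. phi c v \<partial>lborel)"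
    proof (rule integral_mono)
      show "integrable lborel (\<lambda>v. exp (- c * (2 + \<epsilon>)) * indicator {-d/2..d/2} v)"
        by (intro integrable_mult_right integrable_real_indicator)
           (auto simp: emeasure_lborel_Icc_eq)
      fix v :: real
      have "exp (- c * (2 + \<epsilon>)) \<le> phi c v" if "v \<in> {-d/2..d/2}"
      proof -
        have "m v \<le> 2 + \<epsilon>"
          using d(2)[of v] d(1) that by (auto simp: dist_real_def m_def abs_less_iff)
        then have "c * m v \<le> c * (2 + \<epsilon>)" using c by (intro mult_left_mono) auto
        then show ?thesis unfolding phi_def by (simp add: m_def)
      qed
      then show "exp (- c * (2 + \<epsilon>)) * indicator {-d/2..d/2} v \<le> phi c v"
        using phi_pos[of c v] by (auto simp: indicator_def)
    qed (rule phi_integrable[OF c])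
    then show ?thesis using d(1) by (simp add: phi_hat_0 mult.commute)
  qed
  then show ?thesis using that[of d] d(1) by blast
qed

lemma phi_hat_0_pos: "c > 0 \<Longrightarrow> phi_hat c 0 > 0"
  using phi_hat_0_ge[of 1] by (metis exp_gt_zero less_le_trans mult_pos_pos zero_less_one)

lemma phi_tail_le:
  assumes c: "c \<ge> 1" and v: "\<bar>v\<bar> \<ge> \<delta>" "\<delta> \<ge> 0"
  shows "phi c v \<le> exp (- (c - 1) * (2 + \<delta>\<^sup>2)) * phi 1 v"
proof -
  let ?m = "cosh (2 * pi * v) + cosh (pi * v)"
  have "\<delta>\<^sup>2 \<le> v\<^sup>2" using v by (metis abs_le_square_iff abs_of_nonneg)
  then have "2 + \<delta>\<^sup>2 \<le> ?m"
    using cosh_ge_quadratic[of v] cosh_real_ge_1[of "2 * pi * v"] by linarith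
  then have "(c - 1) * (2 + \<delta>\<^sup>2) \<le> (c - 1) * ?m" using c by (intro mult_left_mono) auto
  then show ?thesis unfolding phi_def exp_add[symmetric] by (simp add: algebra_simps)
qed

lemma phi_tail_negligible:
  assumes \<delta>: "\<delta> > 0" and \<epsilon>: "\<epsilon> > 0"
  obtains c where "c \<ge> 1" "exp (- (c - 1) * (2 + \<delta>\<^sup>2)) * phi_hat 1 0 \<le> \<epsilon> * phi_hat c 0"
proof -
  obtain \<eta> where \<eta>: "\<eta> > 0" "\<And>c. c > 0 \<Longrightarrow> \<eta> * exp (- c * (2 + \<delta>\<^sup>2 / 2)) \<le> phi_hat c 0"
    using phi_hat_0_ge[of "\<delta>\<^sup>2 / 2"] \<delta> by auto
  have "((\<lambda>c. exp (2 + \<delta>\<^sup>2) * phi_hat 1 0 * exp (- c * (\<delta>\<^sup>2 / 2))) \<longlongrightarrow> 0) at_top"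
    using \<delta> by real_asymp
  then have "\<forall>\<^sub>F c in at_top. exp (2 + \<delta>\<^sup>2) * phi_hat 1 0 * exp (- c * (\<delta>\<^sup>2 / 2)) < \<epsilon> * \<eta>"
    by (rule order_tendstoD) (use \<epsilon> \<eta> in simp)
  moreover have "\<forall>\<^sub>F c in at_top. c \<ge> (1::real)" by (rule eventually_ge_at_top)
  ultimately obtain c where c: "c \<ge> 1" "exp (2 + \<delta>\<^sup>2) * phi_hat 1 0 * exp (- c * (\<delta>\<^sup>2 / 2)) < \<epsilon> * \<eta>"
    using eventually_happens'[OF trivial_limit_at_top_linorder] by (metis (lifting) eventually_conj)
  have "- (c - 1) * (2 + \<delta>\<^sup>2) = - c * (\<delta>\<^sup>2 / 2) + (2 + \<delta>\<^sup>2) + (- c * (2 + \<delta>\<^sup>2 / 2))"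
    by (simp add: algebra_simps)
  then have "exp (- (c - 1) * (2 + \<delta>\<^sup>2)) * phi_hat 1 0
      = (exp (2 + \<delta>\<^sup>2) * phi_hat 1 0 * exp (- c * (\<delta>\<^sup>2 / 2))) * exp (- c * (2 + \<delta>\<^sup>2 / 2))"
    by (simp only: exp_add mult_ac)
  also have "\<dots> \<le> \<epsilon> * \<eta> * exp (- c * (2 + \<delta>\<^sup>2 / 2))"
    using c(2) by (intro mult_right_mono) auto
  also have "\<dots> \<le> \<epsilon> * phi_hat c 0"
    using mult_left_mono[OF \<eta>(2)[of c], of \<epsilon>] c \<epsilon> by (simp add: mult.assoc)
  finally show ?thesis using that c(1) by blast
qed

lemma cos_ge_three_quarters:
  assumes "\<bar>y\<bar> \<le> 1/2"
  shows "3/4 \<le> cos (y::real)"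
proof -
  have "(sin (y / 2))\<^sup>2 \<le> (1/4)\<^sup>2"
    using abs_sin_x_le_abs_x[of "y / 2"] assms by (intro power2_le_iff_abs_le[THEN iffD2]) auto
  then show ?thesis using cos_double_sin[of "y / 2"] by (simp add: power2_eq_square)
qed

lemma phi_hat_concentration:
  assumes X: "X \<ge> 0"
  obtains c where "c > 0" "\<And>x. 0 \<le> x \<Longrightarrow> x \<le> X \<Longrightarrow> phi_hat c x \<ge> phi_hat c 0 / 2"
proof -
  define \<delta> where "\<delta> = 1 / (2 * (X + 1))"
  have \<delta>: "\<delta> > 0" using X by (simp add: \<delta>_def)
  then obtain c where c: "c \<ge> 1"
    and tail: "exp (- (c - 1) * (2 + \<delta>\<^sup>2)) * phi_hat 1 0 \<le> 1/7 * phi_hat c 0"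
    using phi_tail_negligible[OF \<delta>, of "1/7"] by auto
  define g where "g = (\<lambda>v. exp (- (c - 1) * (2 + \<delta>\<^sup>2)) * phi 1 v)"
  have g: "integrable lborel g" unfolding g_def by (intro integrable_mult_right phi_integrable) auto
  have "phi_hat c x \<ge> phi_hat c 0 / 2" if x: "0 \<le> x" "x \<le> X" for x
  proof -
    have pointwise: "3/4 * phi c v - 7/4 * g v \<le> phi c v * cos (x * v)" for v
    proof (cases "\<bar>v\<bar> \<ge> \<delta>")
      case True
      have "phi c v * (-1) \<le> phi c v * cos (x * v)"
        using phi_pos[of c v] by (intro mult_left_mono) auto
      then show ?thesis using phi_tail_le[OF c True] \<delta> by (simp add: g_def)
    next
      case False
      have "\<bar>x * v\<bar> \<le> X * \<delta>" unfolding abs_mult using x False by (intro mult_mono) auto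
      also have "\<dots> \<le> 1/2" using X by (simp add: \<delta>_def field_simps)
      finally have "phi c v * (3/4) \<le> phi c v * cos (x * v)"
        using phi_pos[of c v] by (intro mult_left_mono cos_ge_three_quarters) auto
      moreover have "g v \<ge> 0" using phi_pos[of 1 v] by (simp add: g_def)
      ultimately show ?thesis by simp
    qed
    have int: "integrable lborel (phi c)" "integrable lborel (\<lambda>v. phi c v * cos (x * v))"
      using c by (auto intro: phi_integrable phi_cos_integrable)
    have "3/4 * phi_hat c 0 - 7/4 * (\<integral>v. g v \<partial>lborel) = (\<integral>v. 3/4 * phi c v - 7/4 * g v \<partial>lborel)"
      unfolding phi_hat_0 using int g by simp
    also have "\<dots> \<le> phi_hat c x"
      unfolding phi_hat_def using int g by (intro integral_mono pointwise) auto
    finally show ?thesis using tail by (simp add: g_def phi_hat_0)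
  qed
  then show ?thesis using that[of c] c by simp
qed

subsection \<open>The autocorrelation of \<open>phi\<close>\<close>

definition phi_conv :: "real \<Rightarrow> real \<Rightarrow> real" where
  "phi_conv c u = (\<integral>v. phi c v * phi c (u - v) \<partial>lborel)"

lemma phi_conv_measurable: "phi_conv c \<in> borel_measurable borel"
  unfolding phi_conv_def[abs_def] by measurable

lemma phi_conv_nonneg: "phi_conv c u \<ge> 0"
  unfolding phi_conv_def using phi_pos[of c]
  by (intro Bochner_Integration.integral_nonneg mult_nonneg_nonneg) (auto intro: less_imp_le)

lemma phi_conv_integrable: "c > 0 \<Longrightarrow> integrable lborel (phi_conv c)"
  unfolding phi_conv_def[abs_def] by (intro convolution_fourier phi_integrable)

lemma fourier_phi_conv:
  "c > 0 \<Longrightarrow> fourier (\<lambda>u. of_real (phi_conv c u)) x = of_real ((phi_hat c x)\<^sup>2)"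
  unfolding phi_conv_def
  by (simp add: convolution_fourier(2) phi_integrable fourier_phi power2_eq_square)

lemma phi_mult_phi_le:
  assumes c: "c > 0"
  shows "phi c v * phi c (u - v) \<le> exp (- c * exp (pi * \<bar>u\<bar>)) * exp (- c * cosh (pi * v))"
proof -
  define p q where "p = pi * u" and "q = 2 * pi * v - pi * u"
  have "cosh (2 * pi * v) + cosh (2 * pi * (u - v)) = cosh (p + q) + cosh (p - q)"
    by (simp add: p_def q_def algebra_simps)
  also have "\<dots> = 2 * cosh p * cosh q" by (simp add: cosh_add cosh_diff)
  also have "\<dots> \<ge> 2 * cosh p * 1" using cosh_real_ge_1[of q] by (intro mult_left_mono) auto
  finally have "2 * cosh p \<le> cosh (2 * pi * v) + cosh (2 * pi * (u - v))" by simp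
  moreover have "exp (pi * \<bar>u\<bar>) \<le> 2 * cosh p" by (cases "u \<ge> 0") (auto simp: p_def cosh_field_def)
  moreover have "cosh (pi * (u - v)) \<ge> 0" by simp
  ultimately have "exp (pi * \<bar>u\<bar>) + cosh (pi * v)
      \<le> (cosh (2 * pi * v) + cosh (pi * v)) + (cosh (2 * pi * (u - v)) + cosh (pi * (u - v)))"
    by linarith
  then have "c * (exp (pi * \<bar>u\<bar>) + cosh (pi * v))
      \<le> c * ((cosh (2 * pi * v) + cosh (pi * v)) + (cosh (2 * pi * (u - v)) + cosh (pi * (u - v))))"
    using c by (intro mult_left_mono) auto
  then show ?thesis
    unfolding phi_def exp_add[symmetric] exp_le_cancel_iff distrib_left mult_minus_left by linarith
qed

lemma exp_cosh_integrable:
  assumes c: "c > 0"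
  shows "integrable lborel (\<lambda>v. exp (- c * cosh (pi * v)))"
proof (rule integrable_quadratic_decay)
  show "(\<lambda>v. exp (- c * cosh (pi * v))) \<in> borel_measurable borel"
    by (intro borel_measurable_continuous_onI continuous_intros)
  show "norm (exp (- c * cosh (pi * v))) \<le> 256 / c ^ 4 / (1 + v\<^sup>2)" for v
    using exp_neg_mult_power_le[OF c cosh_ge_quadratic, of 0 v] by simp
qed

lemma phi_conv_decay:
  assumes c: "c > 0"
  obtains B where "B \<ge> 0" "\<And>u. phi_conv c u \<le> B * exp (- c * exp (pi * \<bar>u\<bar>))"
proof -
  define B where "B = (\<integral>v. exp (- c * cosh (pi * v)) \<partial>lborel)"
  have "B \<ge> 0" unfolding B_def by (intro Bochner_Integration.integral_nonneg) auto
  moreover have "phi_conv c u \<le> B * exp (- c * exp (pi * \<bar>u\<bar>))" for u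
  proof -
    let ?g = "\<lambda>v. exp (- c * exp (pi * \<bar>u\<bar>)) * exp (- c * cosh (pi * v))"
    have g: "integrable lborel ?g" by (rule integrable_mult_right[OF exp_cosh_integrable[OF c]])
    have "norm (phi c v * phi c (u - v)) \<le> ?g v" for v
      using phi_mult_phi_le[OF c, of v u] phi_pos[of c v] phi_pos[of c "u - v"] by simp
    then have "integrable lborel (\<lambda>v. phi c v * phi c (u - v))"
      by (intro Bochner_Integration.integrable_bound[OF g]) auto
    then have "phi_conv c u \<le> (\<integral>v. ?g v \<partial>lborel)"
      unfolding phi_conv_def by (intro integral_mono g phi_mult_phi_le c)
    then show ?thesis by (simp add: B_def mult.commute)
  qed
  ultimately show ?thesis by (rule that)
qed

locale kernel =
  fixes K K_hat :: "real \<Rightarrow> real" and B c C :: real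
  assumes K_measurable [measurable]: "K \<in> borel_measurable borel"
    and K_nonneg: "K u \<ge> 0"
    and K_integrable: "integrable lborel K"
    and c_pos: "c > 0" and B_nonneg: "B \<ge> 0"
    and K_decay: "K u \<le> B * exp (- c * exp (pi * \<bar>u\<bar>))"
    and fourier_K: "fourier (\<lambda>u. of_real (K u)) x = of_real (K_hat x)"
    and K_hat_continuous: "continuous_on UNIV K_hat"
    and K_hat_nonneg: "K_hat x \<ge> 0"
    and K_hat_0: "K_hat 0 > 0"
    and K_hat_decay: "x \<ge> 0 \<Longrightarrow> K_hat x \<le> C * exp (- x / 2) / (1 + x\<^sup>2)"

lemma kernel_exists:
  assumes X: "X \<ge> 0"
  obtains K K_hat B c C where "kernel K K_hat B c C"
    "\<And>x. 0 \<le> x \<Longrightarrow> x \<le> X \<Longrightarrow> K_hat x \<ge> K_hat 0 / 4"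
proof -
  obtain c where c: "c > 0" and half: "\<And>x. 0 \<le> x \<Longrightarrow> x \<le> X \<Longrightarrow> phi_hat c x \<ge> phi_hat c 0 / 2"
    using phi_hat_concentration[OF X] by blast
  obtain B where B: "B \<ge> 0" "\<And>u. phi_conv c u \<le> B * exp (- c * exp (pi * \<bar>u\<bar>))"
    using phi_conv_decay[OF c] by blast
  obtain C where C: "\<And>x. x \<ge> 0 \<Longrightarrow> (phi_hat c x)\<^sup>2 \<le> C * exp (- x / 2) / (1 + x\<^sup>2)"
    using phi_hat_decay[OF c] by blast
  have "kernel (phi_conv c) (\<lambda>x. (phi_hat c x)\<^sup>2) B c C"
    using B C c phi_hat_0_pos[OF c]
    by unfold_locales
       (auto intro!: phi_conv_measurable phi_conv_nonneg phi_conv_integrable continuous_intros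
          phi_hat_continuous simp: fourier_phi_conv)
  moreover have "(phi_hat c 0)\<^sup>2 / 4 \<le> (phi_hat c x)\<^sup>2" if "0 \<le> x" "x \<le> X" for x
    using power_mono[OF half[OF that], of 2] phi_hat_0_pos[OF c] by (simp add: power_divide)
  ultimately show ?thesis by (rule that)
qed

section \<open>The logarithm of zeta to the right of the critical line\<close>

lemma exp_eq_1_imp_constant_on:
  fixes f :: "'a::topological_space \<Rightarrow> complex"
  assumes "connected A" "continuous_on A f" and exp: "\<And>x. x \<in> A \<Longrightarrow> exp (f x) = 1"
  shows "f constant_on A"
proof (rule continuous_discrete_range_constant[OF assms(1,2)])
  fix x assume x: "x \<in> A"
  have "2 * pi \<le> norm (f y - f x)" if y: "y \<in> A" "f y \<noteq> f x" for y
  proof -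
    obtain m n :: int where mn: "Im (f x) = of_int (2 * m) * pi" "Im (f y) = of_int (2 * n) * pi"
      and Re: "Re (f x) = 0" "Re (f y) = 0"
      using exp[OF x] exp[OF y(1)] by (auto simp: exp_eq_1)
    then have diff: "f y - f x = \<i> * of_real (2 * pi * of_int (n - m))"
      by (simp add: complex_eq_iff algebra_simps)
    then have "n - m \<noteq> 0" using y(2) by auto
    then have "1 \<le> \<bar>real_of_int (n - m)\<bar>" by linarith
    then have "2 * pi * 1 \<le> 2 * pi * \<bar>real_of_int (n - m)\<bar>" by (intro mult_left_mono) auto
    then show ?thesis unfolding diff norm_mult norm_of_real by (simp add: abs_mult)
  qed
  then show "\<exists>e>0. \<forall>y. y \<in> A \<and> f y \<noteq> f x \<longrightarrow> e \<le> norm (f y - f x)"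
    by (intro exI[of _ "2 * pi"]) auto
qed

locale log_zeta_branch =
  fixes g :: "complex \<Rightarrow> complex"
  assumes RH: riemann_hypothesis
    and g_holomorphic: "g holomorphic_on {s. Re s > 1/2}"
    and exp_g: "Re s > 1/2 \<Longrightarrow> exp (g s) = zeta_reg s"
    and g_eq: "Re s > 1 \<Longrightarrow> g s = log_zeta_series s + Ln (s - 1)"

lemma log_zeta_branch_exists:
  assumes RH: riemann_hypothesis
  obtains g where "log_zeta_branch g"
proof -
  let ?U = "{s::complex. Re s > 1/2}" and ?f = "\<lambda>s. log_zeta_series s + Ln (s - 1)"
  have nonzero: "zeta_reg s \<noteq> 0" if "s \<in> ?U" for s
    using zeta_reg_zero_imp_Re_le[OF RH, of s] that by force
  obtain l where l: "l holomorphic_on ?U" "\<And>z. z \<in> ?U \<Longrightarrow> exp (l z) = zeta_reg z"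
    using holomorphic_logarithm_exists[of ?U zeta_reg 1,
        OF convex_halfspace_Re_gt open_half zeta_reg_holomorphic nonzero]
    by auto
  have exp_f: "exp (?f s) = zeta_reg s" if "Re s > 1" for s
  proof -
    have "s \<noteq> 1" using that by auto
    then show ?thesis using that by (simp add: exp_add exp_log_zeta_series zeta_reg_def)
  qed
  have "(\<lambda>s. l s - ?f s) constant_on {s. Re s > 1}"
  proof (rule exp_eq_1_imp_constant_on)
    show "connected {s::complex. Re s > 1}" by (intro convex_connected convex_halfspace_Re_gt)
    show "continuous_on {s. Re s > 1} (\<lambda>s. l s - ?f s)"
      by (intro holomorphic_on_imp_continuous_on holomorphic_intros log_zeta_series_holomorphic
            holomorphic_on_subset[OF l(1)]) (auto simp: complex_nonpos_Reals_iff)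
    show "exp (l s - ?f s) = 1" if "s \<in> {s. Re s > 1}" for s
      unfolding exp_diff using that l(2)[of s] exp_f[of s] nonzero[of s] by simp
  qed
  then obtain k where k: "\<And>s. Re s > 1 \<Longrightarrow> l s = ?f s + k"
    unfolding constant_on_def by (auto simp: algebra_simps)
  have "exp k = 1" using l(2)[of 2] exp_f[of 2] k[of 2] nonzero[of 2] by (simp add: exp_add)
  then have "log_zeta_branch (\<lambda>s. l s - k)"
    using RH l k by unfold_locales (auto intro!: holomorphic_intros simp: exp_diff)
  then show ?thesis by (rule that)
qed

context log_zeta_branch
begin

lemma zeta_reg_nonzero: "Re s > 1/2 \<Longrightarrow> zeta_reg s \<noteq> 0"
  using exp_g[of s] by (metis exp_not_eq_zero)

lemma Re_g: "Re s > 1/2 \<Longrightarrow> exp (Re (g s)) = cmod (zeta_reg s)"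
  using exp_g[of s] by (metis norm_exp_eq_Re)

lemma g_has_field_derivative:
  assumes s: "Re s > 1/2"
  shows "(g has_field_derivative deriv zeta_reg s / zeta_reg s) (at s)"
proof -
  have deriv: "(g has_field_derivative deriv g s) (at s)"
    by (rule holomorphic_derivI[OF g_holomorphic open_half]) (use s in simp)
  have "((\<lambda>s. exp (g s)) has_field_derivative exp (g s) * deriv g s) (at s)"
    by (intro DERIV_fun_exp deriv)
  then have "(zeta_reg has_field_derivative exp (g s) * deriv g s) (at s)"
    by (rule has_field_derivative_transform_within_open[OF _ open_half[of "1/2"]])
       (use s exp_g in auto)
  then have "deriv zeta_reg s = zeta_reg s * deriv g s"
    using exp_g[OF s] by (simp add: DERIV_imp_deriv)
  then show ?thesis using deriv zeta_reg_nonzero[OF s] by simp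
qed

lemma norm_g_line_2:
  obtains C where "C > 0" "\<And>t. cmod (g (Complex 2 t)) \<le> C * log_height t"
proof -
  define M where "M = (\<Sum>n. 1 * real n powr (0 - 2))"
  have M: "M \<ge> 0" unfolding M_def by (rule suminf_nonneg[OF log_zeta.summable_bound]) auto
  have "cmod (g (Complex 2 t)) \<le> (M + 1 + pi) * log_height t" for t
  proof -
    let ?s = "Complex 2 t"
    have nonzero: "?s - 1 \<noteq> 0" by (simp add: complex_eq_iff)
    have "1 \<le> cmod (?s - 1)" "cmod (?s - 1) \<le> \<bar>t\<bar> + 3"
      using abs_Re_le_cmod[of "?s - 1"] cmod_le[of "?s - 1"] by auto
    then have "0 \<le> ln (cmod (?s - 1))" "ln (cmod (?s - 1)) \<le> log_height t"
      unfolding log_height_def by (simp, subst ln_le_cancel_iff, auto)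
    then have "\<bar>Re (Ln (?s - 1))\<bar> \<le> log_height t" using nonzero by (simp add: Re_Ln)
    moreover have "\<bar>Im (Ln (?s - 1))\<bar> \<le> pi"
      using mpi_less_Im_Ln[OF nonzero] Im_Ln_le_pi[OF nonzero] by (simp add: abs_le_iff)
    ultimately have "cmod (Ln (?s - 1)) \<le> log_height t + pi"
      using cmod_le[of "Ln (?s - 1)"] by linarith
    moreover have "cmod (log_zeta_series ?s) \<le> M"
      unfolding M_def log_zeta_series_def by (rule log_zeta.norm_le) auto
    moreover have "g ?s = log_zeta_series ?s + Ln (?s - 1)" by (rule g_eq) simp
    ultimately have "cmod (g ?s) \<le> (M + pi) * 1 + log_height t"
      using norm_triangle_ineq[of "log_zeta_series ?s" "Ln (?s - 1)"] by simp
    also have "\<dots> \<le> (M + pi) * log_height t + log_height t"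
      using M pi_ge_zero log_height_ge_1 by (intro add_right_mono mult_left_mono) auto
    finally show ?thesis by (simp add: algebra_simps)
  qed
  moreover have "M + 1 + pi > 0" using M pi_gt_zero by linarith
  ultimately show ?thesis by (rule that[rotated])
qed

lemma Re_g_le:
  obtains C where "C > 0"
    "\<And>s. 1/2 < Re s \<Longrightarrow> Re s \<le> 4 \<Longrightarrow> Re (g s) \<le> C * log_height (Im s)"
proof -
  obtain C where C: "C > 0"
    "\<And>s. 1/8 \<le> Re s \<Longrightarrow> Re s \<le> 4 \<Longrightarrow> cmod (zeta_reg s) \<le> exp (C * log_height (Im s))"
    using zeta_reg_growth by blast
  have "exp (Re (g s)) \<le> exp (C * log_height (Im s))" if "1/2 < Re s" "Re s \<le> 4" for s
    using C(2)[of s] Re_g[of s] that by simp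
  then have "Re (g s) \<le> C * log_height (Im s)" if "1/2 < Re s" "Re s \<le> 4" for s
    using that by simp
  with C(1) show ?thesis by (rule that)
qed

lemma Re_g_diff_less:
  obtains E where "E > 0" "\<And>s t. s \<in> ball (Complex 2 t) (3/2) \<Longrightarrow>
    1/2 < Re s \<and> Re (g s - g (Complex 2 t)) < E * log_height t"
proof -
  obtain C where C: "C > 0"
    "\<And>s. 1/2 < Re s \<Longrightarrow> Re s \<le> 4 \<Longrightarrow> Re (g s) \<le> C * log_height (Im s)"
    using Re_g_le by blast
  obtain D where D: "D > 0" "\<And>t. cmod (g (Complex 2 t)) \<le> D * log_height t"
    using norm_g_line_2 by blast
  define E where "E = C * (1 + 3/2) + D + 1"
  have "1/2 < Re s \<and> Re (g s - g (Complex 2 t)) < E * log_height t"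
    if "s \<in> ball (Complex 2 t) (3/2)" for s t
  proof -
    have s: "1/2 < Re s" "Re s \<le> 4" "\<bar>Im s - t\<bar> \<le> 3/2"
      using that abs_Re_le_cmod[of "Complex 2 t - s"] abs_Im_le_cmod[of "Complex 2 t - s"]
      by (auto simp: dist_norm abs_minus_commute)
    have "C * log_height (Im s) \<le> C * (log_height t * (1 + 3/2))"
      using s C(1) by (intro mult_left_mono log_height_near) auto
    then have "Re (g s) \<le> C * (1 + 3/2) * log_height t" using C(2)[OF s(1,2)] by (simp add: mult_ac)
    moreover have "- Re (g (Complex 2 t)) \<le> D * log_height t"
      using D(2)[of t] abs_Re_le_cmod[of "g (Complex 2 t)"] by simp
    ultimately show ?thesis
      using s(1) log_height_ge_1[of t] by (simp add: E_def distrib_right)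
  qed
  moreover have "E > 0" using C(1) D(1) by (simp add: E_def)
  ultimately show ?thesis by (rule that[rotated])
qed

lemma norm_g_growth:
  assumes \<delta>: "\<delta> > 0"
  obtains C where "C > 0"
    "\<And>\<sigma> t. 1/2 + \<delta> \<le> \<sigma> \<Longrightarrow> \<sigma> \<le> 2 \<Longrightarrow> cmod (g (Complex \<sigma> t)) \<le> C * log_height t"
proof -
  obtain E where E: "E > 0" "\<And>s t. s \<in> ball (Complex 2 t) (3/2) \<Longrightarrow>
      1/2 < Re s \<and> Re (g s - g (Complex 2 t)) < E * log_height t"
    using Re_g_diff_less by blast
  obtain D where D: "D > 0" "\<And>t. cmod (g (Complex 2 t)) \<le> D * log_height t"
    using norm_g_line_2 by blast
  have "cmod (g (Complex \<sigma> t)) \<le> (3 * E / \<delta> + D) * log_height t"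
    if \<sigma>: "1/2 + \<delta> \<le> \<sigma>" "\<sigma> \<le> 2" for \<sigma> t
  proof -
    define l where "l = log_height t"
    have l: "E * l > 0" unfolding l_def using log_height_ge_1[of t] E(1) by simp
    define s\<^sub>0 where "s\<^sub>0 = Complex 2 t"
    have dist: "dist s\<^sub>0 (Complex \<sigma> t) = 2 - \<sigma>"
      using \<sigma> by (simp add: s\<^sub>0_def dist_norm complex_norm minus_complex.code)
    have "cmod (g (Complex \<sigma> t) - g s\<^sub>0)
        \<le> 2 * (E * l) * dist s\<^sub>0 (Complex \<sigma> t) / (3/2 - dist s\<^sub>0 (Complex \<sigma> t))"
    proof (rule Borel_Caratheodory[where f = "\<lambda>s. g s - g s\<^sub>0"])
      show "(\<lambda>s. g s - g s\<^sub>0) holomorphic_on ball s\<^sub>0 (3/2)"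
        using E(2) unfolding s\<^sub>0_def
        by (intro holomorphic_intros holomorphic_on_subset[OF g_holomorphic]) blast
      show "Complex \<sigma> t \<in> ball s\<^sub>0 (3/2)" using \<sigma> \<delta> dist by simp
      show "Re (g s - g s\<^sub>0) < E * l" if "s \<in> ball s\<^sub>0 (3/2)" for s
        using E(2) that unfolding s\<^sub>0_def l_def by blast
    qed (use l in auto)
    also have "\<dots> \<le> 2 * (E * l) * (3/2) / \<delta>"
      unfolding dist using \<sigma> \<delta> l by (intro frac_le mult_left_mono) auto
    finally have "cmod (g (Complex \<sigma> t) - g s\<^sub>0) \<le> 3 * E / \<delta> * l" by simp
    then show ?thesis
      using D(2)[of t] norm_triangle_sub[of "g (Complex \<sigma> t)" "g s\<^sub>0"]
      by (simp add: s\<^sub>0_def l_def distrib_right)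
  qed
  moreover have "3 * E / \<delta> + D > 0" using D E \<delta> by (simp add: add_pos_pos)
  ultimately show ?thesis by (rule that[rotated])
qed

lemma zeta_reg_relative_growth:
  obtains E where "E > 0" "\<And>s t. s \<in> cball (Complex (3/4) t) (5/8) \<Longrightarrow>
    cmod (zeta_reg s) \<le> exp (E * log_height t) * cmod (zeta_reg (Complex (3/4) t))"
proof -
  obtain C where C: "C > 0"
    "\<And>s. 1/8 \<le> Re s \<Longrightarrow> Re s \<le> 4 \<Longrightarrow> cmod (zeta_reg s) \<le> exp (C * log_height (Im s))"
    using zeta_reg_growth by blast
  obtain D where D: "D > 0"
    "\<And>\<sigma> t. 1/2 + 1/4 \<le> \<sigma> \<Longrightarrow> \<sigma> \<le> 2 \<Longrightarrow> cmod (g (Complex \<sigma> t)) \<le> D * log_height t"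
    using norm_g_growth[of "1/4"] by auto
  define E where "E = C * (1 + 5/8) + D"
  have "cmod (zeta_reg s) \<le> exp (E * log_height t) * cmod (zeta_reg (Complex (3/4) t))"
    if "s \<in> cball (Complex (3/4) t) (5/8)" for s t
  proof -
    let ?s\<^sub>0 = "Complex (3/4) t"
    have s: "1/8 \<le> Re s" "Re s \<le> 4" "\<bar>Im s - t\<bar> \<le> 5/8"
      using that abs_Re_le_cmod[of "?s\<^sub>0 - s"] abs_Im_le_cmod[of "?s\<^sub>0 - s"]
      by (auto simp: dist_norm abs_minus_commute)
    have "- (D * log_height t) \<le> Re (g ?s\<^sub>0)"
      using D(2)[of "3/4" t] abs_Re_le_cmod[of "g ?s\<^sub>0"] by simp
    moreover have "C * log_height (Im s) \<le> C * (log_height t * (1 + 5/8))"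
      using C(1) s by (intro mult_left_mono log_height_near) auto
    ultimately have "C * log_height (Im s) \<le> E * log_height t + Re (g ?s\<^sub>0)"
      by (simp add: E_def algebra_simps)
    then have "exp (C * log_height (Im s)) \<le> exp (E * log_height t) * cmod (zeta_reg ?s\<^sub>0)"
      using Re_g[of ?s\<^sub>0, symmetric] by (simp flip: exp_add)
    then show ?thesis using C(2)[OF s(1,2)] by linarith
  qed
  moreover have "E > 0" using C(1) D(1) by (simp add: E_def)
  ultimately show ?thesis by (rule that[rotated])
qed

lemma Re_logderiv_zeta_reg_ge:
  obtains C where "C > 0"
    "\<And>\<sigma> t. 1/2 < \<sigma> \<Longrightarrow> \<sigma> \<le> 3/4 \<Longrightarrow>
       Re (deriv zeta_reg (Complex \<sigma> t) / zeta_reg (Complex \<sigma> t)) \<ge> - (C * log_height t)"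
proof -
  obtain E where E: "E > 0" "\<And>s t. s \<in> cball (Complex (3/4) t) (5/8) \<Longrightarrow>
      cmod (zeta_reg s) \<le> exp (E * log_height t) * cmod (zeta_reg (Complex (3/4) t))"
    using zeta_reg_relative_growth by blast
  have "Re (deriv zeta_reg (Complex \<sigma> t) / zeta_reg (Complex \<sigma> t)) \<ge> - (1280 * E * log_height t)"
    if \<sigma>: "1/2 < \<sigma>" "\<sigma> \<le> 3/4" for \<sigma> t
  proof -
    define A where "A = E * log_height t"
    have A: "A > 0" using E(1) log_height_ge_1[of t] by (simp add: A_def)
    define s\<^sub>0 where "s\<^sub>0 = Complex (3/4) t"
    have dist: "dist s\<^sub>0 (Complex \<sigma> t) = 3/4 - \<sigma>"
      using \<sigma> by (simp add: s\<^sub>0_def dist_norm complex_norm minus_complex.code)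
    have "- (16 * A * (5/16) / (5/16 - dist s\<^sub>0 (Complex \<sigma> t))\<^sup>2)
        \<le> Re (deriv zeta_reg (Complex \<sigma> t) / zeta_reg (Complex \<sigma> t))"
    proof (rule Re_logderiv_ge[OF zeta_reg_holomorphic open_UNIV connected_UNIV])
      show "zeta_reg s\<^sub>0 \<noteq> 0" by (rule zeta_reg_nonzero) (simp add: s\<^sub>0_def)
      show "Complex \<sigma> t \<in> ball s\<^sub>0 (5/16)" using \<sigma> dist by simp
      show "Re \<rho> < Re (Complex \<sigma> t)" if "zeta_reg \<rho> = 0" for \<rho>
        using zeta_reg_zero_imp_Re_le[OF RH that] \<sigma> by simp
      show "cmod (zeta_reg s) \<le> exp A * cmod (zeta_reg s\<^sub>0)" if "s \<in> cball s\<^sub>0 (2 * (5/16))" for s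
        unfolding A_def s\<^sub>0_def by (rule E(2)) (use that in \<open>simp add: s\<^sub>0_def\<close>)
    qed (use A in auto)
    moreover have "16 * A * (5/16) / (5/16 - dist s\<^sub>0 (Complex \<sigma> t))\<^sup>2 \<le> 16 * A * (5/16) / (1/16)\<^sup>2"
      unfolding dist using \<sigma> A by (intro divide_left_mono power_mono mult_pos_pos) auto
    ultimately show ?thesis by (simp add: A_def power2_eq_square)
  qed
  then show ?thesis using that[of "1280 * E"] E(1) by simp
qed

lemma Im_g_has_real_derivative:
  assumes "\<sigma> > 1/2"
  shows "((\<lambda>y. Im (g (Complex \<sigma> y))) has_real_derivative
    Re (deriv zeta_reg (Complex \<sigma> y) / zeta_reg (Complex \<sigma> y))) (at y)"
proof -
  let ?d = "deriv zeta_reg (Complex \<sigma> y) / zeta_reg (Complex \<sigma> y)"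
  have "((\<lambda>y. Complex \<sigma> y) has_vector_derivative \<i>) (at y)"
    unfolding Complex_eq by (auto intro!: derivative_eq_intros)
  from field_vector_diff_chain_at[OF this g_has_field_derivative]
  have "((\<lambda>y. g (Complex \<sigma> y)) has_vector_derivative \<i> * ?d) (at y)"
    using assms by (simp add: o_def)
  then have "((\<lambda>y. Im (g (Complex \<sigma> y))) has_vector_derivative Im (\<i> * ?d)) (at y)"
    by (rule bounded_linear.has_vector_derivative[OF bounded_linear_Im])
  then show ?thesis
    by (simp add: has_real_derivative_iff_has_vector_derivative del: times_divide_eq_right)
qed

lemma Im_g_increment_ge:
  assumes h: "h > 0"
  obtains C where "C > 0"
    "\<And>\<sigma> t. 1/2 < \<sigma> \<Longrightarrow> \<sigma> \<le> 3/4 \<Longrightarrow>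
       Im (g (Complex \<sigma> (t + h))) - Im (g (Complex \<sigma> (t - h))) \<ge> - (C * log_height t)"
proof -
  obtain C where C: "C > 0" "\<And>\<sigma> t. 1/2 < \<sigma> \<Longrightarrow> \<sigma> \<le> 3/4 \<Longrightarrow>
      Re (deriv zeta_reg (Complex \<sigma> t) / zeta_reg (Complex \<sigma> t)) \<ge> - (C * log_height t)"
    using Re_logderiv_zeta_reg_ge by blast
  have "Im (g (Complex \<sigma> (t + h))) - Im (g (Complex \<sigma> (t - h)))
      \<ge> - (2 * h * C * (1 + h) * log_height t)"
    if \<sigma>: "1/2 < \<sigma>" "\<sigma> \<le> 3/4" for \<sigma> t
  proof -
    define M where "M = C * (log_height t * (1 + h))"
    have "Im (g (Complex \<sigma> (t - h))) + M * (t - h) \<le> Im (g (Complex \<sigma> (t + h))) + M * (t + h)"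
    proof (rule DERIV_nonneg_imp_nondecreasing[of "t - h" "t + h"
      "\<lambda>y. Im (g (Complex \<sigma> y)) + M * y"])
      fix y assume y: "t - h \<le> y" "y \<le> t + h"
      let ?d = "Re (deriv zeta_reg (Complex \<sigma> y) / zeta_reg (Complex \<sigma> y))"
      have "C * log_height y \<le> M"
        unfolding M_def using y C(1) by (intro mult_left_mono log_height_near) auto
      then have "0 \<le> ?d + M" using C(2)[OF \<sigma>, of y] by linarith
      moreover have "((\<lambda>y. Im (g (Complex \<sigma> y)) + M * y) has_real_derivative ?d + M) (at y)"
        using DERIV_add[OF Im_g_has_real_derivative[OF \<sigma>(1)] DERIV_cmult[OF DERIV_ident, of M]]
        by simp
      ultimately show
        "\<exists>d. ((\<lambda>y. Im (g (Complex \<sigma> y)) + M * y) has_real_derivative d) (at y) \<and> 0 \<le> d"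
        by blast
    qed (use h in simp)
    then show ?thesis by (simp add: M_def algebra_simps)
  qed
  then show ?thesis using that[of "2 * h * C * (1 + h)"] C(1) h by simp
qed

lemma local_extension:
  assumes w: "Re w = 1/2" and nonzero: "zeta_reg w \<noteq> 0"
  obtains r l where "r > 0" "l holomorphic_on ball w r"
    "\<And>s. s \<in> ball w r \<Longrightarrow> exp (l s) = zeta_reg s"
    "\<And>s. s \<in> ball w r \<Longrightarrow> Re s > 1/2 \<Longrightarrow> g s = l s"
proof -
  let ?U = "{s::complex. Re s > 1/2}"
  obtain r where r: "r > 0" "\<And>s. dist w s < r \<Longrightarrow> zeta_reg s \<noteq> 0"
    using continuous_at_avoid[OF isCont_zeta_reg[of w], of 0] nonzero by blast
  then obtain l where l: "l holomorphic_on ball w r" "\<And>z. z \<in> ball w r \<Longrightarrow> exp (l z) = zeta_reg z"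
    using holomorphic_logarithm_exists[OF convex_ball open_ball zeta_reg_holomorphic, of w r w]
    by auto
  have "(\<lambda>s. g s - l s) constant_on (?U \<inter> ball w r)"
  proof (rule exp_eq_1_imp_constant_on)
    show "connected (?U \<inter> ball w r)"
      by (intro convex_connected convex_Int convex_ball convex_halfspace_Re_gt)
    show "continuous_on (?U \<inter> ball w r) (\<lambda>s. g s - l s)"
      by (intro holomorphic_on_imp_continuous_on holomorphic_intros
            holomorphic_on_subset[OF g_holomorphic] holomorphic_on_subset[OF l(1)]) auto
    show "exp (g s - l s) = 1" if "s \<in> ?U \<inter> ball w r" for s
      using that l(2)[of s] exp_g[of s] r(2)[of s] by (simp add: exp_diff)
  qed
  then obtain k where k: "\<And>s. s \<in> ?U \<Longrightarrow> s \<in> ball w r \<Longrightarrow> g s = l s + k"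
    unfolding constant_on_def by (metis Int_iff add.commute diff_add_cancel)
  define s where "s = w + of_real (r / 2)"
  have "Re s > 1/2" "s \<in> ball w r" using r(1) w by (simp_all add: s_def dist_norm)
  then have "exp k = 1"
    using l(2)[of s] exp_g[of s] k[of s] r(2)[of s] by (simp add: exp_add)
  then show ?thesis
    using r(1) l k
    by (intro that[of r "\<lambda>s. l s + k"]) (auto intro!: holomorphic_intros simp: exp_add)
qed

lemma extend_to_critical_line:
  assumes nonzero: "zeta_reg (Complex (1/2) t) \<noteq> 0"
  obtains \<gamma> where "continuous_on {1/2..} \<gamma>" "\<And>\<sigma>. \<sigma> \<ge> 1/2 \<Longrightarrow> exp (\<gamma> \<sigma>) = zeta_reg (Complex \<sigma> t)"
    "\<And>\<sigma>. \<sigma> > 1/2 \<Longrightarrow> \<gamma> \<sigma> = g (Complex \<sigma> t)"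
proof -
  let ?U = "{s::complex. Re s > 1/2}"
  define w where "w = Complex (1/2) t"
  obtain r l where r: "r > 0" and l: "l holomorphic_on ball w r"
      "\<And>s. s \<in> ball w r \<Longrightarrow> exp (l s) = zeta_reg s"
    and g_eq_l: "\<And>s. s \<in> ball w r \<Longrightarrow> Re s > 1/2 \<Longrightarrow> g s = l s"
    using local_extension[of w] nonzero unfolding w_def by auto
  define G where "G = (\<lambda>s. if s \<in> ?U then g s else l s)"
  have G: "G holomorphic_on ?U \<union> ball w r"
    unfolding G_def
    by (intro holomorphic_on_If_Un g_holomorphic l(1) open_half open_ball) (use g_eq_l in auto)
  show ?thesis
  proof (rule that[of "\<lambda>\<sigma>. G (Complex \<sigma> t)"])
    have edge: "\<sigma> > 1/2 \<or> Complex \<sigma> t = w" if "\<sigma> \<ge> 1/2" for \<sigma>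
      using that unfolding w_def by (metis le_less)
    have mem: "Complex \<sigma> t \<in> ?U \<union> ball w r" if "\<sigma> \<ge> 1/2" for \<sigma>
      using edge[OF that] r by force
    show "continuous_on {1/2..} (\<lambda>\<sigma>. G (Complex \<sigma> t))"
    proof (rule continuous_on_compose2[OF holomorphic_on_imp_continuous_on[OF G]])
      show "(\<lambda>\<sigma>. Complex \<sigma> t) ` {1/2..} \<subseteq> ?U \<union> ball w r" by (intro image_subsetI mem) simp
    qed (intro continuous_intros)
    have "exp (G w) = zeta_reg w" using l(2)[of w] r by (simp add: G_def w_def)
    then show "exp (G (Complex \<sigma> t)) = zeta_reg (Complex \<sigma> t)" if "\<sigma> \<ge> 1/2" for \<sigma>
      using edge[OF that] exp_g by (auto simp: G_def)
  qed (simp add: G_def)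
qed

end

section \<open>The argument of zeta on the critical line\<close>

lemma is_arg_zeta_unique:
  assumes \<theta>: "is_arg_zeta t \<theta>" and \<phi>: "is_arg_zeta t \<phi>" and t: "\<not> zeta_zero_ordinate t"
  shows "\<theta> (1/2) = \<phi> (1/2)"
proof -
  define d where "d = (\<lambda>\<sigma>. \<i> * of_real (\<theta> \<sigma> - \<phi> \<sigma>))"
  have "d constant_on {1/2..}"
  proof (rule exp_eq_1_imp_constant_on)
    show "continuous_on {1/2..} d"
      using \<theta> \<phi> unfolding d_def is_arg_zeta_def by (intro continuous_intros) auto
    fix \<sigma> :: real assume \<sigma>: "\<sigma> \<in> {1/2..}"
    let ?z = "zeta (Complex \<sigma> t)"
    have "?z \<noteq> 0" using t by (auto simp: zeta_zero_ordinate_def)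
    moreover have "of_real (cmod ?z) * cis (\<theta> \<sigma>) = of_real (cmod ?z) * cis (\<phi> \<sigma>)"
      using \<theta> \<phi> \<sigma> unfolding is_arg_zeta_def by (metis atLeast_iff)
    ultimately have "cis (\<theta> \<sigma> - \<phi> \<sigma>) = 1" by (simp flip: cis_divide)
    then show "exp (d \<sigma>) = 1" by (simp add: d_def cis_conv_exp)
  qed (intro convex_connected convex_real_interval)
  then obtain k where k: "\<And>\<sigma>. \<sigma> \<ge> 1/2 \<Longrightarrow> d \<sigma> = k" unfolding constant_on_def by auto
  have "(d \<longlongrightarrow> \<i> * of_real (0 - 0)) at_top"
    using \<theta> \<phi> unfolding d_def is_arg_zeta_def by (intro tendsto_intros) auto
  moreover have "\<forall>\<^sub>F \<sigma> in at_top. d \<sigma> = k"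
    using eventually_ge_at_top[of "1/2"] by eventually_elim (rule k)
  then have "(d \<longlongrightarrow> k) at_top" by (rule tendsto_eventually)
  ultimately have "k = 0" using tendsto_unique[OF trivial_limit_at_top_linorder] by force
  then show ?thesis using k[of "1/2"] by (simp add: d_def)
qed

lemma S_eq:
  assumes t: "\<not> zeta_zero_ordinate t" and \<theta>: "is_arg_zeta t \<theta>"
  shows "pi * S t = \<theta> (1/2)"
proof -
  have "S_regular t = \<theta> (1/2) / pi"
    unfolding S_regular_def using \<theta> is_arg_zeta_unique[OF _ _ t] by (intro the_equality) auto
  then show ?thesis using t by (simp add: S_def)
qed

lemma zeta_zero_ordinate_0: "zeta_zero_ordinate 0"
  unfolding zeta_zero_ordinate_def using zeta_1 by (intro exI[of _ 1]) simp

context log_zeta_branch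
begin

lemma is_arg_zeta_extension:
  assumes t: "\<not> zeta_zero_ordinate t"
  obtains \<gamma> where "continuous_on {1/2..} \<gamma>" "\<And>\<sigma>. \<sigma> > 1/2 \<Longrightarrow> \<gamma> \<sigma> = g (Complex \<sigma> t)"
    "is_arg_zeta t (\<lambda>\<sigma>. Im (\<gamma> \<sigma> - Ln (Complex (\<sigma> - 1) t)))"
proof -
  have t0: "t \<noteq> 0" using t zeta_zero_ordinate_0 by blast
  have ne: "Complex a t \<notin> \<real>\<^sub>\<le>\<^sub>0" "Complex a t \<noteq> 0" for a
    using t0 by (auto simp: complex_nonpos_Reals_iff complex_eq_iff)
  have minus_1: "Complex \<sigma> t - 1 = Complex (\<sigma> - 1) t" for \<sigma> by (simp add: complex_eq_iff)
  have "zeta (Complex (1/2) t) \<noteq> 0" using t by (auto simp: zeta_zero_ordinate_def)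
  then have "zeta_reg (Complex (1/2) t) \<noteq> 0" by (auto simp: zeta_eq_zeta_reg)
  then obtain \<gamma> where \<gamma>: "continuous_on {1/2..} \<gamma>"
      "\<And>\<sigma>. \<sigma> \<ge> 1/2 \<Longrightarrow> exp (\<gamma> \<sigma>) = zeta_reg (Complex \<sigma> t)"
    and g: "\<And>\<sigma>. \<sigma> > 1/2 \<Longrightarrow> \<gamma> \<sigma> = g (Complex \<sigma> t)"
    using extend_to_critical_line by blast
  define w where "w = (\<lambda>\<sigma>. \<gamma> \<sigma> - Ln (Complex (\<sigma> - 1) t))"
  have "is_arg_zeta t (\<lambda>\<sigma>. Im (w \<sigma>))"
    unfolding is_arg_zeta_def
  proof (intro conjI allI impI)
    have "continuous_on {1/2..} (\<lambda>\<sigma>. Ln (Complex (\<sigma> - 1) t))"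
      by (intro continuous_on_Ln continuous_on_Complex_left continuous_intros) (use ne(1) in auto)
    then show "continuous_on {1/2..} (\<lambda>\<sigma>. Im (w \<sigma>))"
      unfolding w_def by (intro continuous_on_Im continuous_on_diff \<gamma>(1))
    fix \<sigma> :: real assume "\<sigma> \<ge> 1/2"
    then have "zeta (Complex \<sigma> t) = exp (w \<sigma>)"
      using ne(2) by (simp add: w_def \<gamma>(2) zeta_eq_zeta_reg exp_diff minus_1)
    then show "zeta (Complex \<sigma> t) = of_real (cmod (zeta (Complex \<sigma> t))) * cis (Im (w \<sigma>))"
      by (metis exp_eq_polar norm_exp_eq_Re)
  next
    have "((\<lambda>\<sigma>. Im (log_zeta_series (Complex \<sigma> t))) \<longlongrightarrow> Im (of_real (log_coeff 1))) at_top"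
      unfolding log_zeta_series_def
      by (intro tendsto_intros log_zeta.tendsto_first) (simp add: filterlim_ident)
    moreover have "\<forall>\<^sub>F \<sigma> in at_top. Im (log_zeta_series (Complex \<sigma> t)) = Im (w \<sigma>)"
      using eventually_gt_at_top[of 1] by eventually_elim (simp add: w_def g g_eq minus_1)
    ultimately have "((\<lambda>\<sigma>. Im (w \<sigma>)) \<longlongrightarrow> Im (of_real (log_coeff 1))) at_top"
      by (rule Lim_transform_eventually)
    then show "((\<lambda>\<sigma>. Im (w \<sigma>)) \<longlongrightarrow> 0) at_top" by simp
  qed
  with \<gamma>(1) g show ?thesis unfolding w_def by (rule that)
qed

lemma Im_g_limit:
  assumes t: "\<not> zeta_zero_ordinate t"
  shows "((\<lambda>\<sigma>. Im (g (Complex \<sigma> t))) \<longlongrightarrow> pi * S t + Im (Ln (Complex (-1/2) t))) (at_right (1/2))"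
proof -
  obtain \<gamma> where \<gamma>: "continuous_on {1/2..} \<gamma>" and g: "\<And>\<sigma>. \<sigma> > 1/2 \<Longrightarrow> \<gamma> \<sigma> = g (Complex \<sigma> t)"
    and arg: "is_arg_zeta t (\<lambda>\<sigma>. Im (\<gamma> \<sigma> - Ln (Complex (\<sigma> - 1) t)))"
    by (rule is_arg_zeta_extension[OF t], rule that)
  have "Im (\<gamma> (1/2)) = pi * S t + Im (Ln (Complex (-1/2) t))"
    using S_eq[OF t arg] by simp
  moreover have "(\<gamma> \<longlongrightarrow> \<gamma> (1/2)) (at_right (1/2))"
    using \<gamma> by (force simp: continuous_on_def simp flip: at_within_Ici_at_right)
  then have "((\<lambda>\<sigma>. Im (\<gamma> \<sigma>)) \<longlongrightarrow> Im (\<gamma> (1/2))) (at_right (1/2))" by (rule tendsto_Im)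
  moreover have "\<forall>\<^sub>F \<sigma> in at_right (1/2). Im (\<gamma> \<sigma>) = Im (g (Complex \<sigma> t))"
    by (auto simp: eventually_at_filter g)
  ultimately show ?thesis by (auto intro: Lim_transform_eventually)
qed

text \<open>The factor \<open>s - 1\<close> changes the argument by at most \<open>\<pi>\<close>.\<close>

lemma Im_g_increment_limit:
  assumes "\<not> zeta_zero_ordinate a" "\<not> zeta_zero_ordinate b"
  obtains L where "((\<lambda>\<sigma>. Im (g (Complex \<sigma> a)) - Im (g (Complex \<sigma> b))) \<longlongrightarrow> L) (at_right (1/2))"
    "pi * (S a - S b) - 2 * pi \<le> L"
proof (rule that)
  let ?L = "\<lambda>t. pi * S t + Im (Ln (Complex (-1/2) t))"
  show "((\<lambda>\<sigma>. Im (g (Complex \<sigma> a)) - Im (g (Complex \<sigma> b))) \<longlongrightarrow> ?L a - ?L b) (at_right (1/2))"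
    by (intro tendsto_diff Im_g_limit assms)
  have "\<bar>Im (Ln (Complex (-1/2) t))\<bar> \<le> pi" for t
    using mpi_less_Im_Ln[of "Complex (-1/2) t"] Im_Ln_le_pi[of "Complex (-1/2) t"]
    by (force simp: complex_eq_iff abs_le_iff)
  from this[of a] this[of b] show "pi * (S a - S b) - 2 * pi \<le> ?L a - ?L b"
    by (simp add: right_diff_distrib)
qed

end

section \<open>Generalized Dirichlet series\<close>

definition laplace :: "'a measure \<Rightarrow> ('a \<Rightarrow> real) \<Rightarrow> ('a \<Rightarrow> real) \<Rightarrow> complex \<Rightarrow> complex" where
  "laplace M \<omega> \<phi> s = (\<integral>x. of_real (\<phi> x) * exp (- s * of_real (\<omega> x)) \<partial>M)"

definition vertical_diff :: "real \<Rightarrow> (complex \<Rightarrow> complex) \<Rightarrow> complex \<Rightarrow> complex" where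
  "vertical_diff h f s = f (s + \<i> * of_real h) - f (s - \<i> * of_real h)"

locale laplace_transform = sigma_finite_measure M for M :: "'a measure" +
  fixes \<omega> \<phi> :: "'a \<Rightarrow> real" and \<sigma> :: real
  assumes \<omega>_measurable [measurable]: "\<omega> \<in> borel_measurable M"
    and \<phi>_measurable [measurable]: "\<phi> \<in> borel_measurable M"
    and \<phi>_eq_0: "x \<in> space M \<Longrightarrow> \<omega> x < 0 \<Longrightarrow> \<phi> x = 0"
    and integrable_abscissa: "integrable M (\<lambda>x. \<phi> x * exp (- \<sigma> * \<omega> x))"
begin

lemma norm_integrand_le:
  assumes "Re s \<ge> \<sigma>" "x \<in> space M"
  shows "cmod (of_real (\<phi> x) * exp (- s * of_real (\<omega> x))) \<le> \<bar>\<phi> x * exp (- \<sigma> * \<omega> x)\<bar>"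
proof (cases "\<omega> x < 0")
  case False
  then have "exp (- Re s * \<omega> x) \<le> exp (- \<sigma> * \<omega> x)"
    using assms(1) by (simp add: mult_right_mono)
  then show ?thesis by (simp add: norm_mult abs_mult mult_left_mono)
qed (use \<phi>_eq_0 assms(2) in simp)

lemma integrable:
  assumes "Re s \<ge> \<sigma>"
  shows "integrable M (\<lambda>x. of_real (\<phi> x) * exp (- s * of_real (\<omega> x)))"
  using norm_integrand_le[OF assms]
  by (intro Bochner_Integration.integrable_bound[OF integrable_abscissa]) auto

lemma holomorphic: "laplace M \<omega> \<phi> holomorphic_on {s. Re s > \<sigma>}"
  unfolding laplace_def[abs_def]
proof (rule holomorphic_integral[OF open_half])
  show "(\<lambda>s. of_real (\<phi> x) * exp (- s * of_real (\<omega> x))) holomorphic_on {s. Re s > \<sigma>}" for x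
    by (intro holomorphic_intros)
  fix s :: complex assume "s \<in> {s. Re s > \<sigma>}"
  then obtain r where r: "r > 0" "cball s r \<subseteq> {s. Re s > \<sigma>}"
    using open_half unfolding open_contains_cball by blast
  moreover have "integrable M (\<lambda>x. \<bar>\<phi> x * exp (- \<sigma> * \<omega> x)\<bar>)"
    using integrable_abscissa by (rule integrable_abs)
  moreover have "Re z \<ge> \<sigma>" if "z \<in> cball s r" for z using r(2) that by (auto intro: less_imp_le)
  ultimately show "\<exists>r>0. \<exists>w. cball s r \<subseteq> {s. Re s > \<sigma>} \<and> integrable M w \<and>
      (\<forall>z\<in>cball s r. \<forall>x\<in>space M. cmod (of_real (\<phi> x) * exp (- z * of_real (\<omega> x))) \<le> w x)"
    using norm_integrand_le by blast
qed measurable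

lemma tendsto_at_right:
  "((\<lambda>a. laplace M \<omega> \<phi> (Complex a t)) \<longlongrightarrow> laplace M \<omega> \<phi> (Complex \<sigma> t)) (at_right \<sigma>)"
  unfolding laplace_def
proof (rule integral_dominated_convergence_at_within)
  show "integrable M (\<lambda>x. \<bar>\<phi> x * exp (- \<sigma> * \<omega> x)\<bar>)"
    using integrable_abscissa by (rule integrable_abs)
  show "AE x in M. cmod (of_real (\<phi> x) * exp (- Complex a t * of_real (\<omega> x)))
      \<le> \<bar>\<phi> x * exp (- \<sigma> * \<omega> x)\<bar>" if "a \<in> {\<sigma><..}" for a
    using that by (intro AE_I2 norm_integrand_le) auto
  show "AE x in M. ((\<lambda>a. of_real (\<phi> x) * exp (- Complex a t * of_real (\<omega> x))) \<longlongrightarrow>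
      of_real (\<phi> x) * exp (- Complex \<sigma> t * of_real (\<omega> x))) (at_right \<sigma>)"
    by (intro AE_I2 tendsto_intros)
qed measurable

lemma Re_laplace:
  assumes "Re s \<ge> \<sigma>"
  shows "integrable M (\<lambda>x. \<phi> x * exp (- Re s * \<omega> x) * cos (Im s * \<omega> x))"
    and "Re (laplace M \<omega> \<phi> s) = (\<integral>x. \<phi> x * exp (- Re s * \<omega> x) * cos (Im s * \<omega> x) \<partial>M)"
  using integrable_Re[OF integrable[OF assms]] integral_Re[OF integrable[OF assms]]
  by (simp_all add: laplace_def Re_exp mult.assoc)

lemma mult_bounded:
  assumes [measurable]: "\<psi> \<in> borel_measurable M" and bound: "\<And>x. x \<in> space M \<Longrightarrow> \<bar>\<psi> x\<bar> \<le> 1"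
  shows "laplace_transform M \<omega> (\<lambda>x. \<phi> x * \<psi> x) \<sigma>"
proof
  show "integrable M (\<lambda>x. \<phi> x * \<psi> x * exp (- \<sigma> * \<omega> x))"
    by (rule Bochner_Integration.integrable_bound[OF integrable_abscissa])
       (use bound in \<open>auto simp: abs_mult mult_left_le intro!: mult_right_mono\<close>)
qed (use \<phi>_eq_0 in auto)

lemma vertical_diff_laplace:
  assumes "Re s \<ge> \<sigma>"
  shows "vertical_diff h (laplace M \<omega> \<phi>) s
    = - 2 * \<i> * laplace M \<omega> (\<lambda>x. \<phi> x * sin (h * \<omega> x)) s"
proof -
  let ?f = "\<lambda>s x. of_real (\<phi> x) * exp (- s * of_real (\<omega> x)) :: complex"
  have shift: "exp (- (s + \<i> * of_real h) * of_real (\<omega> x))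
      = exp (- s * of_real (\<omega> x)) * cis (- (h * \<omega> x))"
    "exp (- (s - \<i> * of_real h) * of_real (\<omega> x)) = exp (- s * of_real (\<omega> x)) * cis (h * \<omega> x)" for x
    by (simp_all add: cis_conv_exp exp_add[symmetric] algebra_simps)
  have diff: "?f (s + \<i> * of_real h) x - ?f (s - \<i> * of_real h) x
      = - 2 * \<i> * (of_real (\<phi> x * sin (h * \<omega> x)) * exp (- s * of_real (\<omega> x)))" for x
    unfolding shift by (simp add: complex_eq_iff algebra_simps)
  have "vertical_diff h (laplace M \<omega> \<phi>) s
      = (\<integral>x. ?f (s + \<i> * of_real h) x - ?f (s - \<i> * of_real h) x \<partial>M)"
    unfolding vertical_diff_def laplace_def
    by (intro Bochner_Integration.integral_diff[symmetric] integrable) (use assms in auto)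
  then show ?thesis unfolding diff laplace_def by (simp only: integral_mult_right_zero)
qed

end

lemma log_coeff_laplace:
  assumes "\<sigma> > 1"
  shows "laplace_transform (count_space UNIV) (\<lambda>n. ln (real n)) log_coeff \<sigma>"
proof (intro laplace_transform.intro laplace_transform_axioms.intro)
  show "integrable (count_space UNIV) (\<lambda>n. log_coeff n * exp (- \<sigma> * ln (real n)))"
    using summable_norm_log_zeta_series[of "of_real \<sigma>"] assms
    by (simp add: integrable_count_space_nat_iff norm_mult abs_mult)
  show "log_coeff n = 0" if "ln (real n) < 0" for n
    using that by (cases "n = 0") auto
qed (auto intro: sigma_finite_measure_count_space)

lemma log_zeta_series_eq_laplace:
  assumes "Re s > 1"
  shows "log_zeta_series s = laplace (count_space UNIV) (\<lambda>n. ln (real n)) log_coeff s"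
proof -
  interpret laplace_transform "count_space UNIV" "\<lambda>n. ln (real n)" log_coeff "Re s"
    by (rule log_coeff_laplace[OF assms])
  show ?thesis
    using sums_unique2[OF log_zeta_series_sums[OF assms]
      sums_integral_count_space_nat[OF integrable]]
    by (simp add: laplace_def)
qed

lemma wsinc_laplace:
  assumes h: "h > 0" and \<sigma>: "\<sigma> > 0"
  shows "laplace_transform lborel (\<lambda>x. x) (\<lambda>x. indicator {0<..} x * wsinc h x) \<sigma>"
proof (intro laplace_transform.intro laplace_transform_axioms.intro)
  have "integrable lborel (\<lambda>x. h *
      cmod (of_real (indicator {0<..} x) * exp (- of_real \<sigma> * of_real x)))"
    using laplace_exp(1)[of "of_real \<sigma>"] \<sigma> by (intro integrable_mult_right integrable_norm) auto
  then show "integrable lborel (\<lambda>x. indicator {0<..} x * wsinc h x * exp (- \<sigma> * x))"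
    by (rule Bochner_Integration.integrable_bound)
       (use h in \<open>auto simp: norm_mult abs_mult indicator_def intro!: mult_right_mono abs_wsinc_le\<close>)
qed (auto intro: lborel.sigma_finite_measure_axioms)

lemma Ln_difference_eq_laplace:
  assumes s: "Re s > 1" and h: "h > 0"
  shows "vertical_diff h (\<lambda>s. Ln (s - 1)) s
    = 2 * \<i> * laplace lborel (\<lambda>x. x) (\<lambda>x. indicator {0<..} x * wsinc h x) (s - 1)"
  using Ln_difference_laplace[of "s - 1" h] assms
  by (simp add: vertical_diff_def laplace_def algebra_simps)

context log_zeta_branch
begin

lemma vertical_diff_g_eq:
  assumes s: "Re s > 1" and h: "h > 0"
  shows "vertical_diff h g s
    = 2 * \<i> * (laplace lborel (\<lambda>x. x) (\<lambda>x. indicator {0<..} x * wsinc h x) (s - 1)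
        - laplace (count_space UNIV) (\<lambda>n. ln (real n)) (\<lambda>n. log_coeff n * sin (h * ln (real n))) s)"
proof -
  interpret laplace_transform "count_space UNIV" "\<lambda>n. ln (real n)" log_coeff "Re s"
    by (rule log_coeff_laplace[OF s])
  have "vertical_diff h g s
      = vertical_diff h log_zeta_series s + vertical_diff h (\<lambda>s. Ln (s - 1)) s"
    using s by (simp add: vertical_diff_def g_eq)
  also have "vertical_diff h log_zeta_series s
      = vertical_diff h (laplace (count_space UNIV) (\<lambda>n. ln (real n)) log_coeff) s"
    using s by (simp add: vertical_diff_def log_zeta_series_eq_laplace)
  finally show ?thesis
    unfolding Ln_difference_eq_laplace[OF s h] vertical_diff_laplace[OF order_refl]
    by (simp add: algebra_simps)
qed

lemma vertical_diff_g_growth: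
  assumes "\<delta> > 0"
  obtains C where "C \<ge> 0" "\<And>s. 1/2 + \<delta> \<le> Re s \<Longrightarrow> Re s \<le> 2 \<Longrightarrow>
    cmod (vertical_diff h g s) \<le> C * (1 + \<bar>Im s\<bar>)"
proof -
  obtain C where C: "C > 0"
    "\<And>\<sigma> t. 1/2 + \<delta> \<le> \<sigma> \<Longrightarrow> \<sigma> \<le> 2 \<Longrightarrow> cmod (g (Complex \<sigma> t)) \<le> C * log_height t"
    using norm_g_growth[OF assms] by blast
  define D where "D = C * (log_height 0 * (1 + \<bar>h\<bar>))"
  have "cmod (vertical_diff h g s) \<le> 2 * D * (1 + \<bar>Im s\<bar>)" if s: "1/2 + \<delta> \<le> Re s" "Re s \<le> 2" for s
  proof -
    have bound: "cmod (g (s + \<i> * of_real a)) \<le> D * (1 + \<bar>Im s\<bar>)" if a: "\<bar>a\<bar> = \<bar>h\<bar>" for a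
    proof -
      have "log_height (Im s + a) \<le> log_height (0 + a) * (1 + \<bar>Im s\<bar>)"
        using log_height_add_le[of a "Im s"] by (simp add: add.commute)
      also have "\<dots> \<le> log_height 0 * (1 + \<bar>h\<bar>) * (1 + \<bar>Im s\<bar>)"
        using log_height_add_le[of 0 a] a by (intro mult_right_mono) auto
      finally have "C * log_height (Im s + a) \<le> D * (1 + \<bar>Im s\<bar>)"
        using C(1) by (simp add: D_def mult.assoc)
      moreover have "s + \<i> * of_real a = Complex (Re s) (Im s + a)" by (simp add: complex_eq_iff)
      ultimately show ?thesis using C(2)[OF s, of "Im s + a"] by simp
    qed
    show ?thesis
      using norm_triangle_ineq4[of "g (s + \<i> * of_real h)" "g (s - \<i> * of_real h)"]
        bound[of h] bound[of "- h"]
      by (simp add: vertical_diff_def)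
  qed
  moreover have "2 * D \<ge> 0" using C(1) log_height_ge_1[of 0] by (simp add: D_def)
  ultimately show ?thesis by (rule that[rotated])
qed

lemma vertical_diff_g_holomorphic: "vertical_diff h g holomorphic_on {s. Re s > 1/2}"
proof -
  have "(g \<circ> (\<lambda>s. s + \<i> * of_real a)) holomorphic_on {s. Re s > 1/2}" for a
    by (rule holomorphic_on_compose_gen[OF _ g_holomorphic]) (auto intro!: holomorphic_intros)
  from holomorphic_on_diff[OF this[of h] this[of "- h"]] show ?thesis
    by (simp add: vertical_diff_def[abs_def] o_def)
qed

end

section \<open>Smoothing along vertical lines\<close>

locale strip_growth =
  fixes f :: "complex \<Rightarrow> complex" and a b :: real
  assumes holomorphic: "f holomorphic_on {s. a < Re s \<and> Re s < b}"
    and growth: "\<delta> > 0 \<Longrightarrow> \<exists>C\<ge>0. \<forall>s. a + \<delta> \<le> Re s \<and> Re s \<le> b - \<delta> \<longrightarrow>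
      cmod (f s) \<le> C * (1 + \<bar>Im s\<bar>)"

lemma open_strip: "open {s. a < Re s \<and> Re s < b}"
  by (intro open_Collect_conj open_halfspace_Re_gt open_halfspace_Re_lt)

lemma summable_inverse_n_ln_square: "summable (\<lambda>n. 1 / (real n * (1 + (ln (real n))\<^sup>2)))"
  (is "summable ?f")
proof -
  have "summable ?f \<longleftrightarrow> summable (\<lambda>n. 2 ^ n * ?f (2 ^ n))"
  proof (rule condensation_test)
    fix m :: nat assume m: "0 < m"
    then have "(ln (real m))\<^sup>2 \<le> (ln (real (Suc m)))\<^sup>2" by (intro power_mono) auto
    then have "real m * (1 + (ln (real m))\<^sup>2) \<le> real (Suc m) * (1 + (ln (real (Suc m)))\<^sup>2)"
      by (intro mult_mono) auto
    then show "?f (Suc m) \<le> ?f m"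
      using m by (intro divide_left_mono mult_pos_pos one_plus_square_pos) auto
  qed auto
  moreover have "summable (\<lambda>n. 2 ^ n * ?f (2 ^ n))"
  proof (rule summable_comparison_test')
    show "summable (\<lambda>n. (1 / (ln 2)\<^sup>2) * (1 / real n ^ 2))"
      by (intro summable_mult) (simp add: inverse_power_summable flip: inverse_eq_divide)
    fix n :: nat assume n: "n \<ge> 1"
    have "norm (2 ^ n * ?f (2 ^ n)) = 1 / (1 + (real n * ln 2)\<^sup>2)" by (simp add: ln_realpow)
    also have "\<dots> \<le> 1 / (real n * ln 2)\<^sup>2"
      using n one_plus_square_pos by (intro divide_left_mono) auto
    finally show "norm (2 ^ n * ?f (2 ^ n)) \<le> (1 / (ln 2)\<^sup>2) * (1 / real n ^ 2)"
      by (simp add: power_mult_distrib mult.commute)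
  qed
  ultimately show ?thesis by blast
qed

lemma double_exp_moment_integrable:
  assumes c: "c > 0"
  shows "integrable lborel (\<lambda>u. exp (- c * exp (pi * \<bar>u\<bar>)) * (1 + \<bar>u\<bar>))"
proof (rule integrable_quadratic_decay)
  show "(\<lambda>u. exp (- c * exp (pi * \<bar>u\<bar>)) * (1 + \<bar>u\<bar>)) \<in> borel_measurable borel"
    by measurable
  fix u :: real
  let ?q = "exp (pi * \<bar>u\<bar>)"
  have "cosh (pi * u) \<le> ?q" by (cases "u \<ge> 0") (auto simp: cosh_field_def mult_le_0_iff)
  then have q: "?q \<ge> 1 + u\<^sup>2" using cosh_ge_quadratic[of u] by linarith
  have "1 * \<bar>u\<bar> \<le> pi * \<bar>u\<bar>" using pi_ge_two by (intro mult_right_mono) auto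
  then have "1 + \<bar>u\<bar> \<le> ?q" using exp_ge_add_one_self[of "pi * \<bar>u\<bar>"] by linarith
  then have "exp (- c * ?q) * (1 + \<bar>u\<bar>) \<le> exp (- c * ?q) * ?q ^ 1" by (simp add: mult_left_mono)
  also have "\<dots> \<le> 256 / c ^ 4 / (1 + u\<^sup>2)" by (rule exp_neg_mult_power_le[OF c q]) simp
  finally show "norm (exp (- c * ?q) * (1 + \<bar>u\<bar>)) \<le> 256 / c ^ 4 / (1 + u\<^sup>2)" by (simp add: abs_mult)
qed

context kernel
begin

lemma K_hat_measurable [measurable]: "K_hat \<in> borel_measurable borel"
  by (intro borel_measurable_continuous_onI K_hat_continuous)

lemma integral_K: "(\<integral>u. K u \<partial>lborel) = K_hat 0"
proof -
  have "complex_of_real (\<integral>u. K u \<partial>lborel) = of_real (K_hat 0)"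
    using fourier_K[of 0] by (simp add: fourier_def)
  then show ?thesis by (simp only: of_real_eq_iff)
qed

lemma K_moment_integrable: "integrable lborel (\<lambda>u. K u * (1 + \<bar>u\<bar>))"
proof (rule Bochner_Integration.integrable_bound)
  show "integrable lborel (\<lambda>u. B * (exp (- c * exp (pi * \<bar>u\<bar>)) * (1 + \<bar>u\<bar>)))"
    by (intro integrable_mult_right double_exp_moment_integrable c_pos)
  have "K u * (1 + \<bar>u\<bar>) \<le> B * exp (- c * exp (pi * \<bar>u\<bar>)) * (1 + \<bar>u\<bar>)" for u
    by (intro mult_right_mono K_decay) auto
  then show "AE u in lborel. norm (K u * (1 + \<bar>u\<bar>))
      \<le> norm (B * (exp (- c * exp (pi * \<bar>u\<bar>)) * (1 + \<bar>u\<bar>)))"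
    using K_nonneg B_nonneg by (intro AE_I2) (simp add: abs_mult mult.assoc)
qed measurable

lemma K_hat_mult_exp_le:
  assumes "x \<ge> 0"
  shows "K_hat x * exp (x / 2) \<le> C / (1 + x\<^sup>2)"
proof -
  have "K_hat x * exp (x / 2) \<le> C * exp (- x / 2) / (1 + x\<^sup>2) * exp (x / 2)"
    by (intro mult_right_mono K_hat_decay assms) auto
  also have "\<dots> = C / (1 + x\<^sup>2) * exp (- x / 2 + x / 2)" unfolding exp_add by simp
  finally show ?thesis by simp
qed

definition smooth :: "(complex \<Rightarrow> complex) \<Rightarrow> complex \<Rightarrow> complex" where
  "smooth f s = (\<integral>u. of_real (K u) * f (s + \<i> * of_real u) \<partial>lborel)"

lemma smooth_laplace:
  assumes "laplace_transform M \<omega> \<phi> \<sigma>" and s: "Re s \<ge> \<sigma>"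
  shows "integrable lborel (\<lambda>u. of_real (K u) * laplace M \<omega> \<phi> (s + \<i> * of_real u))"
    and "smooth (laplace M \<omega> \<phi>) s = laplace M \<omega> (\<lambda>x. \<phi> x * K_hat (\<omega> x)) s"
proof -
  interpret laplace_transform M \<omega> \<phi> \<sigma> by fact
  interpret pair_sigma_finite lborel M ..
  let ?k = "\<lambda>x. of_real (\<phi> x) * exp (- s * of_real (\<omega> x)) :: complex"
  let ?F = "\<lambda>u x. of_real (K u) * (of_real (\<phi> x) * exp (- (s + \<i> * of_real u) * of_real (\<omega> x)))"
  have F_eq: "?F u x = of_real (K u) * cis (- (\<omega> x * u)) * ?k x" for u x
    by (simp add: cis_conv_exp exp_add[symmetric] algebra_simps)
  have norm_F: "norm (?F u x) = K u * norm (?k x)" for u x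
    unfolding F_eq using K_nonneg[of u] by (simp add: norm_mult)
  have int: "integrable (lborel \<Otimes>\<^sub>M M) (\<lambda>(u, x). ?F u x)"
  proof (rule Fubini_integrable)
    show "(\<lambda>(u, x). ?F u x) \<in> borel_measurable (lborel \<Otimes>\<^sub>M M)" by measurable
    show "integrable lborel (\<lambda>u. \<integral>x. norm (case (u, x) of (u, x) \<Rightarrow> ?F u x) \<partial>M)"
      unfolding case_prod_conv norm_F integral_mult_right_zero
      by (intro integrable_mult_left K_integrable)
    show "AE u in lborel. integrable M (\<lambda>x. case (u, x) of (u, x) \<Rightarrow> ?F u x)"
      unfolding case_prod_conv using s by (intro AE_I2 integrable_mult_right integrable) simp
  qed
  have inner_x: "(\<integral>x. ?F u x \<partial>M) = of_real (K u) * laplace M \<omega> \<phi> (s + \<i> * of_real u)" for u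
    unfolding laplace_def by (rule integral_mult_right_zero)
  have inner_u: "(\<integral>u. ?F u x \<partial>lborel) = of_real (K_hat (\<omega> x)) * ?k x" for x
    by (simp only: F_eq integral_mult_left_zero fourier_def[symmetric] fourier_K)
  show "Bochner_Integration.integrable lborel
      (\<lambda>u. of_real (K u) * laplace M \<omega> \<phi> (s + \<i> * of_real u))"
    using integrable_fst[OF int] unfolding inner_x .
  have "smooth (laplace M \<omega> \<phi>) s = (\<integral>u. (\<integral>x. ?F u x \<partial>M) \<partial>lborel)"
    unfolding smooth_def inner_x ..
  also have "\<dots> = (\<integral>x. (\<integral>u. ?F u x \<partial>lborel) \<partial>M)"
    by (rule Fubini_integral[OF int, symmetric])
  also have "\<dots> = (\<integral>x. of_real (K_hat (\<omega> x)) * ?k x \<partial>M)" unfolding inner_u ..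
  finally show "smooth (laplace M \<omega> \<phi>) s = laplace M \<omega> (\<lambda>x. \<phi> x * K_hat (\<omega> x)) s"
    by (simp add: laplace_def mult_ac)
qed

lemma smooth_integrand_measurable:
  assumes "strip_growth f a b" "a < Re s" "Re s < b"
  shows "(\<lambda>u. of_real (K u) * f (s + \<i> * of_real u)) \<in> borel_measurable borel"
proof -
  interpret strip_growth f a b by fact
  have "(\<lambda>u. f (s + \<i> * of_real u)) \<in> borel_measurable borel"
    by (intro borel_measurable_continuous_onI
          continuous_on_compose2[OF holomorphic_on_imp_continuous_on[OF holomorphic]])
       (use assms in \<open>auto intro!: continuous_intros\<close>)
  then show ?thesis by measurable
qed

lemma smooth_dominated:
  assumes "strip_growth f a b" and s: "a < Re s" "Re s < b"
  obtains r w where "r > 0" "cball s r \<subseteq> {s. a < Re s \<and> Re s < b}" "integrable lborel w"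
    "\<And>z u. z \<in> cball s r \<Longrightarrow> cmod (of_real (K u) * f (z + \<i> * of_real u)) \<le> w u"
proof -
  interpret strip_growth f a b by fact
  define r where "r = min (Re s - a) (b - Re s) / 2"
  have r: "r > 0" using s by (simp add: r_def)
  then obtain D where D: "D \<ge> 0"
    "\<And>z. a + r \<le> Re z \<Longrightarrow> Re z \<le> b - r \<Longrightarrow> cmod (f z) \<le> D * (1 + \<bar>Im z\<bar>)"
    using growth by blast
  have near: "a + r \<le> Re z" "Re z \<le> b - r" "\<bar>Im z\<bar> \<le> \<bar>Im s\<bar> + r" if "z \<in> cball s r" for z
    using that abs_Re_le_cmod[of "s - z"] abs_Im_le_cmod[of "s - z"]
    by (auto simp: dist_norm r_def min_def field_simps)
  let ?A = "D * (1 + \<bar>Im s\<bar> + r)"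
  have "cmod (of_real (K u) * f (z + \<i> * of_real u)) \<le> ?A * (K u * (1 + \<bar>u\<bar>))"
    if z: "z \<in> cball s r" for z u
  proof -
    have "0 \<le> \<bar>Im s\<bar> * \<bar>u\<bar>" "0 \<le> r * \<bar>u\<bar>" using r by auto
    moreover have "\<bar>Im z + u\<bar> \<le> \<bar>Im s\<bar> + r + \<bar>u\<bar>" using near(3)[OF z] by linarith
    moreover have "(1 + \<bar>Im s\<bar> + r) * (1 + \<bar>u\<bar>)
        = 1 + \<bar>Im s\<bar> + r + \<bar>u\<bar> + \<bar>Im s\<bar> * \<bar>u\<bar> + r * \<bar>u\<bar>"
      by (simp add: algebra_simps)
    ultimately have "1 + \<bar>Im z + u\<bar> \<le> (1 + \<bar>Im s\<bar> + r) * (1 + \<bar>u\<bar>)" by linarith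
    then have "D * (1 + \<bar>Im z + u\<bar>) \<le> D * ((1 + \<bar>Im s\<bar> + r) * (1 + \<bar>u\<bar>))"
      by (intro mult_left_mono D(1))
    then have "cmod (f (z + \<i> * of_real u)) \<le> ?A * (1 + \<bar>u\<bar>)"
      using D(2)[of "z + \<i> * of_real u"] near(1,2)[OF z] by simp
    then have "K u * cmod (f (z + \<i> * of_real u)) \<le> K u * (?A * (1 + \<bar>u\<bar>))"
      by (intro mult_left_mono K_nonneg)
    then show ?thesis using K_nonneg[of u] by (simp add: norm_mult mult_ac)
  qed
  moreover have "integrable lborel (\<lambda>u. ?A * (K u * (1 + \<bar>u\<bar>)))"
    by (intro integrable_mult_right K_moment_integrable)
  moreover have "cball s r \<subseteq> {s. a < Re s \<and> Re s < b}" using near(1,2) r by fastforce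
  ultimately show ?thesis using r that by blast
qed

lemma smooth_integrable:
  assumes "strip_growth f a b" "a < Re s" "Re s < b"
  shows "integrable lborel (\<lambda>u. of_real (K u) * f (s + \<i> * of_real u))"
proof -
  obtain r w where r: "r > 0" "cball s r \<subseteq> {s. a < Re s \<and> Re s < b}" and w: "integrable lborel w"
    and bound: "\<And>z u. z \<in> cball s r \<Longrightarrow> cmod (of_real (K u) * f (z + \<i> * of_real u)) \<le> w u"
    by (rule smooth_dominated[OF assms], rule that)
  have "(\<lambda>u. of_real (K u) * f (s + \<i> * of_real u)) \<in> borel_measurable borel"
    by (rule smooth_integrand_measurable[OF assms])
  then show ?thesis
    using bound[of s] r(1)
    by (intro Bochner_Integration.integrable_bound[OF w])
       (auto intro!: AE_I2 order_trans[OF _ abs_ge_self])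
qed

lemma smooth_holomorphic:
  assumes f: "strip_growth f a b"
  shows "smooth f holomorphic_on {s. a < Re s \<and> Re s < b}"
  unfolding smooth_def[abs_def]
proof (rule holomorphic_integral[OF open_strip])
  interpret strip_growth f a b by fact
  fix u :: real
  have "(f \<circ> (\<lambda>s. s + \<i> * of_real u)) holomorphic_on {s. a < Re s \<and> Re s < b}"
    by (rule holomorphic_on_compose_gen[OF _ holomorphic]) (auto intro!: holomorphic_intros)
  then show "(\<lambda>s. of_real (K u) * f (s + \<i> * of_real u)) holomorphic_on {s. a < Re s \<and> Re s < b}"
    by (intro holomorphic_intros) (simp add: o_def)
next
  fix s assume "s \<in> {s. a < Re s \<and> Re s < b}"
  then have s: "a < Re s" "Re s < b" by auto
  then show "(\<lambda>u. of_real (K u) * f (s + \<i> * of_real u)) \<in> borel_measurable lborel"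
    using smooth_integrand_measurable[OF f] by simp
  show "\<exists>r>0. \<exists>w. cball s r \<subseteq> {s. a < Re s \<and> Re s < b} \<and> integrable lborel w \<and>
      (\<forall>z\<in>cball s r. \<forall>u\<in>space lborel. cmod (of_real (K u) * f (z + \<i> * of_real u)) \<le> w u)"
    by (rule smooth_dominated[OF f s]) blast
qed

lemma log_coeff_K_hat_laplace:
  "laplace_transform (count_space UNIV) (\<lambda>n. ln (real n))
    (\<lambda>n. log_coeff n * K_hat (ln (real n))) (1/2)"
proof (intro laplace_transform.intro laplace_transform_axioms.intro)
  show "integrable (count_space UNIV)
      (\<lambda>n. log_coeff n * K_hat (ln (real n)) * exp (- (1/2) * ln (real n)))"
    unfolding integrable_count_space_nat_iff
  proof (rule summable_comparison_test'[OF
      summable_mult[OF summable_inverse_n_ln_square, of C], of 1])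
    fix n :: nat assume n: "n \<ge> 1"
    define y where "y = ln (real n)"
    have y: "y \<ge> 0" "exp (- y) = 1 / real n"
      using n by (auto simp: y_def exp_minus inverse_eq_divide)
    have "log_coeff n * (K_hat y * exp (y / 2)) \<le> 1 * (C / (1 + y\<^sup>2))"
      using log_coeff_nonneg log_coeff_le_1 K_hat_nonneg y
      by (intro mult_mono K_hat_mult_exp_le) auto
    then have "log_coeff n * (K_hat y * exp (y / 2)) * exp (- y) \<le> C / (1 + y\<^sup>2) * exp (- y)"
      by (intro mult_right_mono) auto
    moreover have "exp (- (1/2) * y) = exp (y / 2) * exp (- y)" by (simp flip: exp_add)
    ultimately have "log_coeff n * K_hat y * exp (- (1/2) * y) \<le> C * (1 / (real n * (1 + y\<^sup>2)))"
      by (simp add: y(2) mult_ac)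
    then show "norm (norm (log_coeff n * K_hat (ln (real n)) * exp (- (1/2) * ln (real n))))
        \<le> C * (1 / (real n * (1 + (ln (real n))\<^sup>2)))"
      using log_coeff_nonneg[of n] K_hat_nonneg[of y] by (simp add: y_def abs_mult)
  qed
  show "log_coeff n * K_hat (ln (real n)) = 0" if "ln (real n) < 0" for n
    using that by (cases "n = 0") auto
qed (auto intro: sigma_finite_measure_count_space)

end

section \<open>The smoothed increments of the argument\<close>

locale smoothed = kernel K K_hat B c C + log_zeta_branch g for K K_hat B c C g +
  fixes h :: real
  assumes h_pos: "h > 0"
begin

definition prime_weight :: "nat \<Rightarrow> real" where
  "prime_weight n = log_coeff n * K_hat (ln (real n)) * sin (h * ln (real n))"

definition prime_sum :: "complex \<Rightarrow> complex" where
  "prime_sum s = laplace (count_space UNIV) (\<lambda>n. ln (real n)) prime_weight s"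

definition pole_weight :: "real \<Rightarrow> real" where
  "pole_weight x = indicator {0<..} x * wsinc h x * K_hat x"

definition pole_integral :: "complex \<Rightarrow> complex" where
  "pole_integral s = laplace lborel (\<lambda>x. x) pole_weight (s - 1)"

lemma prime_weight_laplace:
  "laplace_transform (count_space UNIV) (\<lambda>n. ln (real n)) prime_weight (1/2)"
  unfolding prime_weight_def[abs_def]
  by (rule laplace_transform.mult_bounded[OF log_coeff_K_hat_laplace]) auto

lemma abs_pole_weight_exp_le: "\<bar>pole_weight x * exp (x / 2)\<bar> \<le> h * C / (1 + x\<^sup>2)"
proof (cases "x > 0")
  case True
  have "\<bar>pole_weight x * exp (x / 2)\<bar> = \<bar>wsinc h x\<bar> * (K_hat x * exp (x / 2))"
    using True K_hat_nonneg[of x] by (simp add: pole_weight_def abs_mult)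
  also have "\<dots> \<le> h * (C / (1 + x\<^sup>2))"
    using True h_pos K_hat_nonneg[of x]
    by (intro mult_mono abs_wsinc_le K_hat_mult_exp_le) auto
  finally show ?thesis by simp
next
  case False
  have "C \<ge> 0" using K_hat_decay[of 0] K_hat_0 by simp
  then show ?thesis using False h_pos one_plus_square_pos[of x] by (simp add: pole_weight_def)
qed

lemma pole_weight_measurable [measurable]: "pole_weight \<in> borel_measurable borel"
  unfolding pole_weight_def[abs_def] by measurable

lemma pole_weight_laplace: "laplace_transform lborel (\<lambda>x. x) pole_weight (- (1/2))"
proof (intro laplace_transform.intro laplace_transform_axioms.intro)
  show "integrable lborel (\<lambda>x. pole_weight x * exp (- (- (1/2)) * x))"
    using abs_pole_weight_exp_le by (intro integrable_quadratic_decay[of _ "h * C"]) auto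
qed (auto simp: pole_weight_def lborel.sigma_finite_measure_axioms)

lemma smooth_vertical_diff_g_eq_right:
  assumes s: "Re s > 1"
  shows "smooth (vertical_diff h g) s = 2 * \<i> * (pole_integral s - prime_sum s)"
proof -
  let ?P = "laplace lborel (\<lambda>x. x) (\<lambda>x. indicator {0<..} x * wsinc h x)"
  let ?D = "laplace (count_space UNIV) (\<lambda>n. ln (real n)) (\<lambda>n. log_coeff n * sin (h * ln (real n)))"
  have "Re (s - 1) > 0" using s by simp
  note P = smooth_laplace[OF wsinc_laplace[OF h_pos this] order_refl]
  have "laplace_transform (count_space UNIV) (\<lambda>n. ln (real n))
      (\<lambda>n. log_coeff n * sin (h * ln (real n))) (Re s)"
    by (rule laplace_transform.mult_bounded[OF log_coeff_laplace[OF s]]) auto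
  note D = smooth_laplace[OF this order_refl]
  have "of_real (K u) * vertical_diff h g (s + \<i> * of_real u) = 2 * \<i> *
      (of_real (K u) * ?P (s - 1 + \<i> * of_real u) - of_real (K u) * ?D (s + \<i> * of_real u))" for u
    using s h_pos by (subst vertical_diff_g_eq) (auto simp: algebra_simps)
  then have "smooth (vertical_diff h g) s = 2 * \<i> * (smooth ?P (s - 1) - smooth ?D s)"
    unfolding smooth_def
    by (simp only: integral_mult_right_zero Bochner_Integration.integral_diff[OF P(1) D(1)])
  also have "smooth ?P (s - 1) = pole_integral s"
    unfolding P(2) pole_integral_def by (simp add: pole_weight_def[abs_def])
  also have "smooth ?D s = prime_sum s"
    unfolding D(2) prime_sum_def by (simp add: prime_weight_def[abs_def] mult_ac)
  finally show ?thesis .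
qed

lemma vertical_diff_g_strip_growth: "strip_growth (vertical_diff h g) (1/2) 2"
proof
  show "vertical_diff h g holomorphic_on {s. 1/2 < Re s \<and> Re s < 2}"
    by (rule holomorphic_on_subset[OF vertical_diff_g_holomorphic]) auto
  fix \<delta> :: real assume "\<delta> > 0"
  then obtain C where "C \<ge> 0" "\<And>s. 1/2 + \<delta> \<le> Re s \<Longrightarrow> Re s \<le> 2 \<Longrightarrow>
      cmod (vertical_diff h g s) \<le> C * (1 + \<bar>Im s\<bar>)"
    using vertical_diff_g_growth[of \<delta> h] by blast
  then show "\<exists>C\<ge>0. \<forall>s. 1/2 + \<delta> \<le> Re s \<and> Re s \<le> 2 - \<delta> \<longrightarrow>
      cmod (vertical_diff h g s) \<le> C * (1 + \<bar>Im s\<bar>)"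
    using \<open>\<delta> > 0\<close> by (intro exI[of _ C]) auto
qed

lemma smooth_vertical_diff_g_eq:
  assumes s: "1/2 < Re s" "Re s < 2"
  shows "smooth (vertical_diff h g) s = 2 * \<i> * (pole_integral s - prime_sum s)"
proof (rule analytic_continuation_open[of "{s. 1 < Re s \<and> Re s < 2}" "{s. 1/2 < Re s \<and> Re s < 2}"
      "smooth (vertical_diff h g)" "\<lambda>s. 2 * \<i> * (pole_integral s - prime_sum s)"])
  have "Complex (3/2) 0 \<in> {s. 1 < Re s \<and> Re s < 2}" by simp
  then show "{s. 1 < Re s \<and> Re s < 2} \<noteq> {}" by blast
  have "(laplace lborel (\<lambda>x. x) pole_weight \<circ> (\<lambda>s. s - 1))
      holomorphic_on {s. 1/2 < Re s \<and> Re s < 2}"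
    by (rule holomorphic_on_compose_gen[OF _ laplace_transform.holomorphic[OF pole_weight_laplace]])
       (auto intro!: holomorphic_intros)
  then have "pole_integral holomorphic_on {s. 1/2 < Re s \<and> Re s < 2}"
    by (simp add: pole_integral_def[abs_def] o_def)
  moreover have "prime_sum holomorphic_on {s. 1/2 < Re s \<and> Re s < 2}"
    unfolding prime_sum_def[abs_def]
    by (rule holomorphic_on_subset[OF laplace_transform.holomorphic[OF prime_weight_laplace]]) auto
  ultimately show "(\<lambda>s. 2 * \<i> * (pole_integral s - prime_sum s))
      holomorphic_on {s. 1/2 < Re s \<and> Re s < 2}"
    by (intro holomorphic_intros)
  show "connected {s. 1/2 < Re s \<and> Re s < 2}"
    unfolding Collect_conj_eq
    by (intro convex_connected convex_Int convex_halfspace_Re_gt convex_halfspace_Re_lt)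
qed (use s smooth_vertical_diff_g_eq_right smooth_holomorphic[OF vertical_diff_g_strip_growth]
      open_strip[of "1/2" 2] open_strip[of 1 2] in auto)

lemma smoothed_increment:
  assumes \<sigma>: "1/2 < \<sigma>" "\<sigma> < 2"
  shows "integrable lborel (\<lambda>u. K u * Im (vertical_diff h g (Complex \<sigma> (t + u))))"
    and "(\<integral>u. K u * Im (vertical_diff h g (Complex \<sigma> (t + u))) \<partial>lborel)
      = 2 * Re (pole_integral (Complex \<sigma> t)) - 2 * Re (prime_sum (Complex \<sigma> t))"
proof -
  let ?s = "Complex \<sigma> t"
  have int: "integrable lborel (\<lambda>u. of_real (K u) * vertical_diff h g (?s + \<i> * of_real u))"
    by (rule smooth_integrable[OF vertical_diff_g_strip_growth]) (use \<sigma> in auto)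
  have Im_eq: "Im (of_real (K u) * vertical_diff h g (?s + \<i> * of_real u))
      = K u * Im (vertical_diff h g (Complex \<sigma> (t + u)))" for u
    by (simp add: Complex_eq algebra_simps)
  show "integrable lborel (\<lambda>u. K u * Im (vertical_diff h g (Complex \<sigma> (t + u))))"
    using integrable_Im[OF int] unfolding Im_eq .
  have "(\<integral>u. K u * Im (vertical_diff h g (Complex \<sigma> (t + u))) \<partial>lborel)
      = Im (smooth (vertical_diff h g) ?s)"
    using integral_Im[OF int] unfolding Im_eq smooth_def .
  also have "\<dots> = 2 * Re (pole_integral ?s) - 2 * Re (prime_sum ?s)"
    using smooth_vertical_diff_g_eq[of ?s] \<sigma> by simp
  finally show "(\<integral>u. K u * Im (vertical_diff h g (Complex \<sigma> (t + u))) \<partial>lborel)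
      = 2 * Re (pole_integral ?s) - 2 * Re (prime_sum ?s)" .
qed

lemma smoothed_increment_tendsto:
  "((\<lambda>\<sigma>. 2 * Re (pole_integral (Complex \<sigma> t)) - 2 * Re (prime_sum (Complex \<sigma> t))) \<longlongrightarrow>
    2 * Re (pole_integral (Complex (1/2) t)) - 2 * Re (prime_sum (Complex (1/2) t)))
    (at_right (1/2))"
proof -
  have "filterlim (\<lambda>\<sigma>. \<sigma> - 1) (at_right (- (1/2))) (at_right (1/2::real))"
    by (intro tendsto_imp_filterlim_at_right)
       (auto intro!: tendsto_eq_intros simp: eventually_at_filter)
  from filterlim_compose[OF laplace_transform.tendsto_at_right[OF pole_weight_laplace] this]
  have "((\<lambda>\<sigma>. pole_integral (Complex \<sigma> t)) \<longlongrightarrow> pole_integral (Complex (1/2) t)) (at_right (1/2))"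
    by (simp add: pole_integral_def minus_complex.code one_complex.code)
  moreover have "((\<lambda>\<sigma>. prime_sum (Complex \<sigma> t)) \<longlongrightarrow> prime_sum (Complex (1/2) t)) (at_right (1/2))"
    unfolding prime_sum_def by (rule laplace_transform.tendsto_at_right[OF prime_weight_laplace])
  ultimately show ?thesis by (intro tendsto_intros)
qed

end

section \<open>Almost periods\<close>

lemma finite_range_bounded_representatives:
  fixes f :: "real \<Rightarrow> 'b"
  assumes fin: "finite (range f)"
  obtains l where "\<And>x. \<exists>r. \<bar>r\<bar> \<le> l \<and> f r = f x"
proof -
  define l where "l = Max ((\<lambda>k. \<bar>inv f k\<bar>) ` range f)"
  have "\<bar>inv f (f x)\<bar> \<le> l" for x unfolding l_def using fin by (intro Max_ge) auto
  moreover have "f (inv f (f x)) = f x" for x by (simp add: f_inv_into_f)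
  ultimately show ?thesis using that by blast
qed

lemma cos_ge_1_minus_abs: "cos (x::real) \<ge> 1 - \<bar>x\<bar>"
proof -
  have "\<bar>sin (x / 2)\<bar> * \<bar>sin (x / 2)\<bar> \<le> 1 * \<bar>x / 2\<bar>"
    by (intro mult_mono abs_sin_x_le_abs_x) auto
  then show ?thesis using cos_double_sin[of "x / 2"] by (simp add: power2_eq_square)
qed

lemma cos_diff_ge_of_same_cell:
  fixes x y M :: real
  assumes M: "M > 0" and cell: "\<lfloor>M * frac (x / (2 * pi))\<rfloor> = \<lfloor>M * frac (y / (2 * pi))\<rfloor>"
  shows "cos (x - y) \<ge> 1 - 8 / M"
proof -
  define d where "d = frac (x / (2 * pi)) - frac (y / (2 * pi))"
  define k where "k = \<lfloor>x / (2 * pi)\<rfloor> - \<lfloor>y / (2 * pi)\<rfloor>"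
  have "x - y = 2 * pi * (x / (2 * pi) - y / (2 * pi))" by (simp add: right_diff_distrib)
  also have "\<dots> = 2 * pi * d + 2 * pi * of_int k" by (simp add: d_def k_def frac_def algebra_simps)
  finally have "cos (x - y) = cos (2 * pi * d)"
    using sin_int_2pin[of k] cos_int_2pin[of k] by (simp add: cos_add)
  moreover have "\<bar>2 * pi * d\<bar> \<le> 8 / M"
  proof -
    have "\<bar>M * frac (x / (2 * pi)) - M * frac (y / (2 * pi))\<bar> < 1" using cell by linarith
    then have "\<bar>d\<bar> * M \<le> 1"
      using M by (simp add: d_def abs_mult mult.commute flip: right_diff_distrib)
    then have "\<bar>d\<bar> \<le> 1 / M" using M by (simp add: pos_le_divide_eq)
    moreover have "2 * pi \<le> 8" using pi_less_4 by simp
    ultimately have "2 * pi * \<bar>d\<bar> \<le> 8 * (1 / M)" by (intro mult_mono) auto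
    then show ?thesis by (simp add: abs_mult)
  qed
  ultimately show ?thesis using cos_ge_1_minus_abs[of "2 * pi * d"] by linarith
qed

lemma almost_periods:
  fixes \<omega> :: "'a \<Rightarrow> real"
  assumes A: "finite A" and \<epsilon>: "\<epsilon> > 0"
  obtains l where "\<And>T. \<exists>t. \<bar>t - T\<bar> \<le> l \<and> (\<forall>a\<in>A. cos (t * \<omega> a) \<ge> 1 - \<epsilon>)"
proof -
  define M where "M = real (nat \<lceil>8 / \<epsilon>\<rceil> + 1)"
  have M: "M \<ge> 8 / \<epsilon>" "M > 0" unfolding M_def by linarith+
  define code where "code = (\<lambda>T. \<lambda>a\<in>A. \<lfloor>M * frac (T * \<omega> a / (2 * pi))\<rfloor>)"
  have "\<lfloor>M * frac y\<rfloor> \<in> {0..\<lfloor>M\<rfloor>}" for y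
    using M(2) frac_lt_1[of y] by (auto intro!: floor_mono mult_left_le)
  then have "range code \<subseteq> A \<rightarrow>\<^sub>E {0..\<lfloor>M\<rfloor>}" by (auto simp: code_def)
  then have fin: "finite (range code)"
    using A by (meson finite_PiE finite_atLeastAtMost_int finite_subset)
  obtain l where l: "\<And>T. \<exists>r. \<bar>r\<bar> \<le> l \<and> code r = code T"
    by (rule finite_range_bounded_representatives[OF fin], rule that)
  have "\<exists>t. \<bar>t - T\<bar> \<le> l \<and> (\<forall>a\<in>A. cos (t * \<omega> a) \<ge> 1 - \<epsilon>)" for T
  proof -
    obtain r where r: "\<bar>r\<bar> \<le> l" "code r = code T" using l by blast
    have "1 - \<epsilon> \<le> cos ((T - r) * \<omega> a)" if a: "a \<in> A" for a
    proof -
      have "1 - 8 / M \<le> cos (T * \<omega> a - r * \<omega> a)"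
        using fun_cong[OF r(2), of a] a by (intro cos_diff_ge_of_same_cell M) (simp add: code_def)
      moreover have "8 / M \<le> \<epsilon>" using M \<epsilon> by (simp add: field_simps)
      ultimately show ?thesis by (simp add: left_diff_distrib)
    qed
    then show ?thesis using r(1) by (intro exI[of _ "T - r"]) auto
  qed
  then show ?thesis by (rule that)
qed

lemma suminf_cosine_deficit_le:
  fixes p \<theta> :: "nat \<Rightarrow> real"
  assumes p: "summable (\<lambda>n. \<bar>p n\<bar>)" and \<epsilon>: "\<epsilon> \<ge> 0" and cos: "\<And>n. n < N \<Longrightarrow> cos (\<theta> n) \<ge> 1 - \<epsilon>"
  shows "(\<Sum>n. p n) - (\<Sum>n. p n * cos (\<theta> n)) \<le> (\<Sum>n. \<bar>p n\<bar>) * \<epsilon> + 2 * (\<Sum>n. \<bar>p (n + N)\<bar>)"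
proof -
  define d where "d = (\<lambda>n. p n * (1 - cos (\<theta> n)))"
  have abs_d: "\<bar>d n\<bar> = \<bar>p n\<bar> * (1 - cos (\<theta> n))" for n by (simp add: d_def abs_mult)
  then have d_le: "\<bar>d n\<bar> \<le> 2 * \<bar>p n\<bar>" for n
    using mult_left_mono[of "1 - cos (\<theta> n)" 2 "\<bar>p n\<bar>"] cos_ge_minus_one[of "\<theta> n"] by simp
  have d: "summable (\<lambda>n. \<bar>d n\<bar>)"
    by (rule summable_comparison_test'[OF summable_mult[OF p]]) (use d_le in simp)
  have p_shift: "summable (\<lambda>n. \<bar>p (n + N)\<bar>)" and d_shift: "summable (\<lambda>n. \<bar>d (n + N)\<bar>)"
    using p d by (auto simp: summable_iff_shift[of "\<lambda>n. \<bar>_ n\<bar>"])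
  have "summable (\<lambda>n. \<bar>p n * cos (\<theta> n)\<bar>)"
    by (rule summable_comparison_test'[OF p]) (auto simp: abs_mult mult_left_le)
  then have "(\<Sum>n. p n) - (\<Sum>n. p n * cos (\<theta> n)) = (\<Sum>n. d n)"
    using p by (simp add: suminf_diff summable_rabs_cancel d_def right_diff_distrib)
  also have "\<dots> \<le> (\<Sum>n. \<bar>d n\<bar>)" using summable_rabs[OF d] by linarith
  also have "\<dots> = (\<Sum>n<N. \<bar>d n\<bar>) + (\<Sum>n. \<bar>d (n + N)\<bar>)"
    unfolding suminf_split_initial_segment[OF d, of N] by simp
  also have "\<dots> \<le> (\<Sum>n<N. \<bar>p n\<bar> * \<epsilon>) + (\<Sum>n. 2 * \<bar>p (n + N)\<bar>)"
  proof (rule add_mono)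
    show "(\<Sum>n<N. \<bar>d n\<bar>) \<le> (\<Sum>n<N. \<bar>p n\<bar> * \<epsilon>)"
      unfolding abs_d by (intro sum_mono mult_left_mono) (use cos in force)+
    show "(\<Sum>n. \<bar>d (n + N)\<bar>) \<le> (\<Sum>n. 2 * \<bar>p (n + N)\<bar>)"
      by (intro suminf_le d_le d_shift summable_mult p_shift)
  qed
  also have "\<dots> \<le> (\<Sum>n. \<bar>p n\<bar>) * \<epsilon> + 2 * (\<Sum>n. \<bar>p (n + N)\<bar>)"
    unfolding sum_distrib_right[symmetric] suminf_mult[OF p_shift]
    using \<epsilon> by (intro add_right_mono mult_right_mono sum_le_suminf p) auto
  finally show ?thesis .
qed

lemma cosine_series_almost_periods:
  fixes p \<omega> :: "nat \<Rightarrow> real"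
  assumes p: "summable (\<lambda>n. \<bar>p n\<bar>)" and \<delta>: "\<delta> > 0"
  obtains l where
    "\<And>T. \<exists>t. \<bar>t - T\<bar> \<le> l \<and> (\<Sum>n. p n * cos (t * \<omega> n)) \<ge> (\<Sum>n. p n) - \<delta>"
proof -
  define V where "V = (\<Sum>n. \<bar>p n\<bar>)"
  have V: "V \<ge> 0" unfolding V_def by (intro suminf_nonneg p) auto
  obtain N where N: "\<bar>\<Sum>n. \<bar>p (n + N)\<bar>\<bar> < \<delta> / 4"
    using suminf_exist_split[OF _ p, of "\<delta> / 4"] \<delta> by auto
  define \<epsilon> where "\<epsilon> = \<delta> / (2 * (V + 1))"
  have \<epsilon>: "\<epsilon> > 0" "V * \<epsilon> \<le> \<delta> / 2" using \<delta> V by (auto simp: \<epsilon>_def field_simps)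
  obtain l where l: "\<And>T. \<exists>t. \<bar>t - T\<bar> \<le> l \<and> (\<forall>n\<in>{..<N}. cos (t * \<omega> n) \<ge> 1 - \<epsilon>)"
    using almost_periods[OF finite_lessThan \<epsilon>(1)] by blast
  have "\<exists>t. \<bar>t - T\<bar> \<le> l \<and> (\<Sum>n. p n * cos (t * \<omega> n)) \<ge> (\<Sum>n. p n) - \<delta>" for T
  proof -
    obtain t where t: "\<bar>t - T\<bar> \<le> l" "\<And>n. n < N \<Longrightarrow> cos (t * \<omega> n) \<ge> 1 - \<epsilon>" using l[of T] by auto
    have "(\<Sum>n. p n) - (\<Sum>n. p n * cos (t * \<omega> n)) \<le> V * \<epsilon> + 2 * (\<Sum>n. \<bar>p (n + N)\<bar>)"
      unfolding V_def using \<epsilon>(1) t(2) by (intro suminf_cosine_deficit_le p) auto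
    then show ?thesis using t(1) N \<epsilon>(2) by (intro exI[of _ t]) auto
  qed
  then show ?thesis by (rule that)
qed

section \<open>Large sine sums over prime powers\<close>

lemma log_coeff_sum_unbounded: "\<exists>N. (\<Sum>n<N. log_coeff n / real n) > Q"
proof (rule ccontr)
  assume "\<not> ?thesis"
  then have partial: "(\<Sum>n<N. log_coeff n / real n) \<le> Q" for N by (auto simp: not_less)
  have "Re (log_zeta_series (Complex x 0)) \<le> Q" if x: "x > 1" for x
  proof -
    have sums: "(\<lambda>n. log_coeff n * exp (- x * ln (real n))) sums Re (log_zeta_series (Complex x 0))"
      using Re_log_zeta_series_sums[OF x, of 0] by simp
    have "log_coeff n * exp (- x * ln (real n)) \<le> log_coeff n / real n" for n
    proof (cases "n = 0")
      case False
      then have "exp (- x * ln (real n)) \<le> exp (- ln (real n))"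
        using x mult_right_mono[of 1 x "ln (real n)"] by simp
      also have "\<dots> = 1 / real n" using False by (simp add: exp_minus inverse_eq_divide)
      finally have "log_coeff n * exp (- x * ln (real n)) \<le> log_coeff n * (1 / real n)"
        by (intro mult_left_mono log_coeff_nonneg)
      then show ?thesis by simp
    qed simp
    then have "(\<Sum>n<N. log_coeff n * exp (- x * ln (real n))) \<le> Q" for N
      by (intro order_trans[OF sum_mono partial])
    then show ?thesis by (intro LIMSEQ_le_const2[OF sums[unfolded sums_def]]) auto
  qed
  then have "norm ((x - 1) * cmod (zeta (Complex x 0))) \<le> (x - 1) * exp Q" if "x > 1" for x
    using that by (simp add: norm_zeta_eq abs_mult)
  then have "\<forall>\<^sub>F x in at_right 1. norm ((x - 1) * cmod (zeta (Complex x 0))) \<le> (x - 1) * exp Q"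
    by (simp add: eventually_at_filter)
  moreover have "((\<lambda>x. (x - 1) * exp Q) \<longlongrightarrow> 0) (at_right (1::real))"
    by (auto intro!: tendsto_eq_intros)
  ultimately have "((\<lambda>x. (x - 1) * cmod (zeta (Complex x 0))) \<longlongrightarrow> 0) (at_right 1)"
    by (rule Lim_null_comparison)
  then show False using tendsto_unique[OF _ zeta_pole_limit] by force
qed

lemma exp_neg_le_half_weight:
  fixes y :: real
  assumes y: "y \<ge> 1/2"
  shows "exp (- y) / 16 \<le> exp (- (1/2) * y) * (y / (1 + y\<^sup>2))"
proof -
  have "1 + y / 2 + (y / 2)\<^sup>2 / 2 \<le> exp (y / 2)" using y by (intro exp_lower_Taylor_quadratic) auto
  then have "(1 + y\<^sup>2) / 8 \<le> exp (y / 2)" using y by (simp add: power_divide)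
  then have "(1 + y\<^sup>2) / 8 * (1/2) \<le> exp (y / 2) * y" using y by (intro mult_mono) auto
  then have "1 / 16 \<le> exp (y / 2) * (y / (1 + y\<^sup>2))"
    using one_plus_square_pos[of y] by (simp add: pos_le_divide_eq)
  then have "exp (- y) * (1 / 16) \<le> exp (- y) * (exp (y / 2) * (y / (1 + y\<^sup>2)))"
    by (intro mult_left_mono) auto
  moreover have "exp (- (1/2) * y) = exp (- y) * exp (y / 2)" by (simp flip: exp_add)
  ultimately show ?thesis by simp
qed

lemma weighted_log_coeff_sum_unbounded:
  "\<exists>N. (\<Sum>n<N. log_coeff n * exp (- (1/2) * ln (real n)) *
    (ln (real n) / (1 + (ln (real n))\<^sup>2))) > Q"
proof -
  obtain N where N: "(\<Sum>n<N. log_coeff n / real n) > 16 * Q"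
    using log_coeff_sum_unbounded by blast
  have "log_coeff n / real n / 16
      \<le> log_coeff n * exp (- (1/2) * ln (real n)) * (ln (real n) / (1 + (ln (real n))\<^sup>2))" for n
  proof (cases "n \<le> 1")
    case True
    then have "n = 0 \<or> n = 1" by auto
    then show ?thesis by auto
  next
    case False
    have "ln 2 \<le> ln (real n)" using False by simp
    then have "ln (real n) \<ge> 1/2" using ln2_ge_two_thirds by linarith
    from mult_left_mono[OF exp_neg_le_half_weight[OF this] log_coeff_nonneg[of n]] show ?thesis
      using False by (simp add: exp_minus inverse_eq_divide mult.assoc)
  qed
  then have "(\<Sum>n<N. log_coeff n / real n) / 16 \<le>
      (\<Sum>n<N. log_coeff n * exp (- (1/2) * ln (real n)) * (ln (real n) / (1 + (ln (real n))\<^sup>2)))"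
    unfolding sum_divide_distrib by (rule sum_mono)
  then show ?thesis using N by (intro exI[of _ N]) linarith
qed

lemma sine_series_laplace:
  fixes b \<omega> :: "nat \<Rightarrow> real"
  assumes b: "summable (\<lambda>n. \<bar>b n\<bar>)"
  defines "F \<equiv> \<lambda>y. indicator {0<..} y * exp (- y) * (\<Sum>n. b n * sin (\<omega> n * y))"
  shows "integrable lborel F"
    and "(\<lambda>n. b n * (\<omega> n / (1 + (\<omega> n)\<^sup>2))) sums (\<integral>y. F y \<partial>lborel)"
proof -
  define e where "e = (\<lambda>y::real. indicator {0<..} y * exp (- y) :: real)"
  define f where "f = (\<lambda>n y. b n * (e y * sin (\<omega> n * y)))"
  have f: "integrable lborel (f n)" for n
    unfolding f_def e_def by (intro integrable_mult_right laplace_sin(1))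
  have norm_f: "norm (f n y) \<le> \<bar>b n\<bar> * e y" for n y
    by (simp add: f_def e_def abs_mult mult_left_le mult_left_mono)
  have pointwise: "AE y in lborel. summable (\<lambda>n. norm (f n y))"
    by (intro AE_I2 summable_comparison_test'[OF summable_mult2[OF b]]) (use norm_f in auto)
  have "(\<integral>y. norm (f n y) \<partial>lborel) \<le> (\<integral>y. \<bar>b n\<bar> * e y \<partial>lborel)" for n
    unfolding e_def
    by (intro integral_mono integrable_norm f integrable_mult_right integral_exp_neg(1)
          norm_f[unfolded e_def])
  then have "norm (\<integral>y. norm (f n y) \<partial>lborel) \<le> \<bar>b n\<bar>" for n
    using integral_exp_neg(2) by (simp add: e_def)
  then have norms: "summable (\<lambda>n. \<integral>y. norm (f n y) \<partial>lborel)"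
    by (intro summable_comparison_test'[OF b])
  have "summable (\<lambda>n. b n * sin (\<omega> n * y))" for y
    by (rule summable_comparison_test'[OF b]) (simp add: abs_mult mult_left_le)
  moreover have "f n y = e y * (b n * sin (\<omega> n * y))" for n y by (simp add: f_def)
  ultimately have F: "F = (\<lambda>y. \<Sum>n. f n y)"
    unfolding F_def e_def by (simp only: suminf_mult)
  show "integrable lborel F" unfolding F by (rule integrable_suminf[OF f pointwise norms])
  have "(\<integral>y. f n y \<partial>lborel) = b n * (\<omega> n / (1 + (\<omega> n)\<^sup>2))" for n
    unfolding f_def e_def integral_mult_right_zero laplace_sin(2) ..
  then show "(\<lambda>n. b n * (\<omega> n / (1 + (\<omega> n)\<^sup>2))) sums (\<integral>y. F y \<partial>lborel)"
    using sums_integral[OF f pointwise norms] unfolding F by simp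
qed

text \<open>Averaging over \<open>y\<close> against the density \<open>exp (- y)\<close> turns the sines into the positive
  weights \<open>\<omega> / (1 + \<omega>\<^sup>2)\<close>.\<close>

lemma exists_large_sine_series:
  fixes b \<omega> :: "nat \<Rightarrow> real"
  assumes b: "summable (\<lambda>n. \<bar>b n\<bar>)" and large: "(\<Sum>n. b n * (\<omega> n / (1 + (\<omega> n)\<^sup>2))) > V"
  obtains y where "y > 0" "(\<Sum>n. b n * sin (\<omega> n * y)) > V"
proof (rule ccontr)
  assume "\<not> thesis"
  then have "(\<Sum>n. b n * sin (\<omega> n * y)) \<le> V" if "y > 0" for y
    using that \<open>\<And>y. _ y \<Longrightarrow> _ y \<Longrightarrow> thesis\<close> by force
  then have "indicator {0<..} y * exp (- y) * (\<Sum>n. b n * sin (\<omega> n * y))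
      \<le> indicator {0<..} y * exp (- y) * V" for y
    by (auto simp: indicator_def)
  then have "(\<integral>y. indicator {0<..} y * exp (- y) * (\<Sum>n. b n * sin (\<omega> n * y)) \<partial>lborel)
      \<le> (\<integral>y. indicator {0<..} y * exp (- y) * V \<partial>lborel)"
    by (intro integral_mono sine_series_laplace(1)[OF b] integrable_mult_left integral_exp_neg(1))
  also have "\<dots> = V" by (simp add: integral_exp_neg(2))
  finally show False using large sums_unique[OF sine_series_laplace(2)[OF b]] by simp
qed

lemma (in kernel) exists_large_prime_sine_series:
  fixes V :: real
  assumes N: "(\<Sum>n<N. log_coeff n * exp (- (1/2) * ln (real n)) *
      (ln (real n) / (1 + (ln (real n))\<^sup>2))) > 4 * V"
    and K_hat_large: "\<And>n. n < N \<Longrightarrow> K_hat (ln (real n)) \<ge> K_hat 0 / 4"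
  obtains h where "h > 0"
    "(\<Sum>n. log_coeff n * K_hat (ln (real n)) * exp (- (1/2) * ln (real n)) *
      sin (ln (real n) * h)) > V * K_hat 0"
proof -
  let ?a = "\<lambda>n. log_coeff n * exp (- (1/2) * ln (real n)) * (ln (real n) / (1 + (ln (real n))\<^sup>2))"
  define b where "b = (\<lambda>n. log_coeff n * K_hat (ln (real n)) * exp (- (1/2) * ln (real n)))"
  have a_nonneg: "?a n \<ge> 0" for n using log_coeff_nonneg[of n] by (cases "n = 0") auto
  have b: "summable (\<lambda>n. \<bar>b n\<bar>)"
    using laplace_transform.integrable_abscissa[OF log_coeff_K_hat_laplace]
    by (simp add: b_def integrable_count_space_nat_iff)
  have b_eq: "b n * (ln (real n) / (1 + (ln (real n))\<^sup>2)) = ?a n * K_hat (ln (real n))" for n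
    by (simp add: b_def)
  have b_nonneg: "b n * (ln (real n) / (1 + (ln (real n))\<^sup>2)) \<ge> 0" for n
    unfolding b_eq by (intro mult_nonneg_nonneg a_nonneg K_hat_nonneg)
  have "V * K_hat 0 < (\<Sum>n<N. ?a n) * (K_hat 0 / 4)" using N K_hat_0 by simp
  also have "\<dots> \<le> (\<Sum>n<N. b n * (ln (real n) / (1 + (ln (real n))\<^sup>2)))"
    unfolding sum_distrib_right b_eq using a_nonneg K_hat_large
    by (intro sum_mono mult_left_mono) auto
  also have "\<dots> \<le> (\<Sum>n. b n * (ln (real n) / (1 + (ln (real n))\<^sup>2)))"
    by (intro sum_le_suminf sums_summable[OF sine_series_laplace(2)[OF b]] b_nonneg) auto
  finally have large: "(\<Sum>n. b n * (ln (real n) / (1 + (ln (real n))\<^sup>2))) > V * K_hat 0" .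
  obtain h where "h > 0" "(\<Sum>n. b n * sin (ln (real n) * h)) > V * K_hat 0"
    by (rule exists_large_sine_series[OF b large], rule that)
  then show ?thesis unfolding b_def by (rule that)
qed

lemma kernel_with_large_prime_sine_series:
  fixes V :: real
  obtains K K_hat B c C h where "kernel K K_hat B c C" "h > 0"
    "(\<Sum>n. log_coeff n * K_hat (ln (real n)) * exp (- (1/2) * ln (real n)) *
      sin (ln (real n) * h)) > V * K_hat 0"
proof -
  obtain N where N: "(\<Sum>n<N. log_coeff n * exp (- (1/2) * ln (real n)) *
      (ln (real n) / (1 + (ln (real n))\<^sup>2))) > 4 * V"
    using weighted_log_coeff_sum_unbounded by blast
  have "ln (real (Suc N)) \<ge> 0" by simp
  then obtain K K_hat B c C where kernel: "kernel K K_hat B c C"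
    and K_hat: "\<And>x. 0 \<le> x \<Longrightarrow> x \<le> ln (real (Suc N)) \<Longrightarrow> K_hat x \<ge> K_hat 0 / 4"
    using kernel_exists by blast
  have K_hat_large: "K_hat (ln (real n)) \<ge> K_hat 0 / 4" if "n < N" for n
  proof (cases "n = 0")
    case False
    then show ?thesis using that by (intro K_hat) auto
  qed (use K_hat[of 0] in simp)
  show ?thesis
    by (rule kernel.exists_large_prime_sine_series[OF kernel N K_hat_large], assumption,
        rule that[OF kernel])
qed

section \<open>The smoothed inequality on the critical line\<close>

lemma integral_le_limit_of_integrals:
  fixes f :: "'b::first_countable_topology \<Rightarrow> 'a \<Rightarrow> real"
  assumes f: "\<And>s. s \<in> A \<Longrightarrow> integrable M (f s)" and w: "integrable M w" and \<psi>: "integrable M \<psi>"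
    and lower: "\<And>s x. s \<in> A \<Longrightarrow> - w x \<le> f s x"
    and limit: "AE x in M. \<exists>L. ((\<lambda>s. f s x) \<longlongrightarrow> L) (at a within A) \<and> \<psi> x \<le> L"
    and I: "((\<lambda>s. \<integral>x. f s x \<partial>M) \<longlongrightarrow> I) (at a within A)" and nontrivial: "at a within A \<noteq> bot"
  shows "(\<integral>x. \<psi> x \<partial>M) \<le> I"
proof -
  define m where "m = (\<lambda>s x. min (f s x - \<psi> x) 0)"
  have m: "integrable M (m s)" if "s \<in> A" for s
    unfolding m_def using f[OF that] \<psi> by (intro integrable_min) auto
  have "((\<lambda>s. \<integral>x. m s x \<partial>M) \<longlongrightarrow> (\<integral>x. 0 \<partial>M)) (at a within A)"
  proof (rule integral_dominated_convergence_at_within)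
    show "integrable M (\<lambda>x. \<bar>w x\<bar> + \<bar>\<psi> x\<bar>)" using w \<psi> by simp
    show "AE x in M. ((\<lambda>s. m s x) \<longlongrightarrow> 0) (at a within A)"
      using limit
    proof eventually_elim
      case (elim x)
      then obtain L where L: "((\<lambda>s. f s x) \<longlongrightarrow> L) (at a within A)" "\<psi> x \<le> L" by blast
      have "((\<lambda>s. m s x) \<longlongrightarrow> min (L - \<psi> x) 0) (at a within A)"
        unfolding m_def by (intro tendsto_intros L(1))
      then show ?case using L(2) by simp
    qed
    show "AE x in M. norm (m s x) \<le> \<bar>w x\<bar> + \<bar>\<psi> x\<bar>" if "s \<in> A" for s
    proof (intro AE_I2)
      show "norm (m s x) \<le> \<bar>w x\<bar> + \<bar>\<psi> x\<bar>" for x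
        using lower[OF that, of x] unfolding m_def real_norm_def by linarith
    qed
  qed (use m in auto)
  then have "((\<lambda>s. (\<integral>x. \<psi> x \<partial>M) + (\<integral>x. m s x \<partial>M)) \<longlongrightarrow> (\<integral>x. \<psi> x \<partial>M) + 0) (at a within A)"
    by (intro tendsto_intros) simp
  moreover have "(\<integral>x. \<psi> x \<partial>M) + (\<integral>x. m s x \<partial>M) \<le> (\<integral>x. f s x \<partial>M)" if "s \<in> A" for s
    unfolding Bochner_Integration.integral_add[OF \<psi> m[OF that], symmetric]
    by (intro integral_mono Bochner_Integration.integrable_add \<psi> m f that) (simp add: m_def)
  then have "\<forall>\<^sub>F s in at a within A. (\<integral>x. \<psi> x \<partial>M) + (\<integral>x. m s x \<partial>M) \<le> (\<integral>x. f s x \<partial>M)"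
    by (simp add: eventually_at_filter)
  ultimately show ?thesis using tendsto_le[OF nontrivial I] by force
qed

context kernel
begin

lemma K_tail_integrable: "integrable lborel (\<lambda>u. indicator {u. H < \<bar>u\<bar>} u * (K u * (1 + \<bar>u\<bar>)))"
  by (rule Bochner_Integration.integrable_bound[OF K_moment_integrable]) (auto simp: indicator_def)

definition K_tail :: "real \<Rightarrow> real" where
  "K_tail H = (\<integral>u. indicator {u. H < \<bar>u\<bar>} u * (K u * (1 + \<bar>u\<bar>)) \<partial>lborel)"

lemma K_tail_le:
  obtains J where "J \<ge> 0" "\<And>H. K_tail H \<le> J * exp (- (c / 2) * exp (pi * H))"
proof -
  let ?e = "\<lambda>u. exp (- (c / 2) * exp (pi * \<bar>u\<bar>)) * (1 + \<bar>u\<bar>)"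
  have e: "integrable lborel ?e" by (rule double_exp_moment_integrable) (use c_pos in simp)
  define J where "J = B * (\<integral>u. ?e u \<partial>lborel)"
  have "J \<ge> 0"
    unfolding J_def using B_nonneg
    by (intro mult_nonneg_nonneg Bochner_Integration.integral_nonneg) auto
  moreover have "K_tail H \<le> J * exp (- (c / 2) * exp (pi * H))" for H
  proof -
    let ?Z = "exp (- (c / 2) * exp (pi * H))"
    have "indicator {u. H < \<bar>u\<bar>} u * (K u * (1 + \<bar>u\<bar>)) \<le> B * ?Z * ?e u" for u
    proof (cases "H < \<bar>u\<bar>")
      case True
      have "exp (- c * exp (pi * \<bar>u\<bar>))
          = exp (- (c / 2) * exp (pi * \<bar>u\<bar>)) * exp (- (c / 2) * exp (pi * \<bar>u\<bar>))"
        by (simp flip: exp_add)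
      also have "\<dots> \<le> ?Z * exp (- (c / 2) * exp (pi * \<bar>u\<bar>))"
        using True c_pos by (intro mult_right_mono) auto
      finally have "B * exp (- c * exp (pi * \<bar>u\<bar>)) \<le> B * (?Z * exp (- (c / 2) * exp (pi * \<bar>u\<bar>)))"
        using B_nonneg by (rule mult_left_mono)
      then have "K u * (1 + \<bar>u\<bar>) \<le> B * (?Z * exp (- (c / 2) * exp (pi * \<bar>u\<bar>))) * (1 + \<bar>u\<bar>)"
        using K_decay[of u] by (intro mult_right_mono) auto
      then show ?thesis using True by (simp add: mult.assoc)
    qed (use B_nonneg in simp)
    then have "K_tail H \<le> (\<integral>u. B * ?Z * ?e u \<partial>lborel)"
      unfolding K_tail_def by (intro integral_mono K_tail_integrable integrable_mult_right e)
    also have "\<dots> = J * ?Z" unfolding integral_mult_right_zero J_def by (simp only: mult_ac)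
    finally show ?thesis .
  qed
  ultimately show ?thesis by (rule that)
qed

end

context smoothed
begin

lemma Im_vertical_diff_g:
  "Im (vertical_diff h g (Complex \<sigma> y)) = Im (g (Complex \<sigma> (y + h))) - Im (g (Complex \<sigma> (y - h)))"
proof -
  have "Complex \<sigma> y + \<i> * of_real h = Complex \<sigma> (y + h)"
    "Complex \<sigma> y - \<i> * of_real h = Complex \<sigma> (y - h)"
    by (simp_all add: complex_eq_iff)
  then show ?thesis by (simp add: vertical_diff_def)
qed

lemma increment_lower_bound:
  obtains G where "G > 0" "\<And>\<sigma> t u. 1/2 < \<sigma> \<Longrightarrow> \<sigma> \<le> 3/4 \<Longrightarrow>
    - (G * log_height t * (1 + \<bar>u\<bar>)) \<le> Im (vertical_diff h g (Complex \<sigma> (t + u)))"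
proof -
  obtain G where G: "G > 0" "\<And>\<sigma> t. 1/2 < \<sigma> \<Longrightarrow> \<sigma> \<le> 3/4 \<Longrightarrow>
      - (G * log_height t) \<le> Im (g (Complex \<sigma> (t + h))) - Im (g (Complex \<sigma> (t - h)))"
    using Im_g_increment_ge[OF h_pos] by blast
  have "- (G * log_height t * (1 + \<bar>u\<bar>)) \<le> Im (vertical_diff h g (Complex \<sigma> (t + u)))"
    if "1/2 < \<sigma>" "\<sigma> \<le> 3/4" for \<sigma> t u
  proof -
    have "G * log_height (t + u) \<le> G * log_height t * (1 + \<bar>u\<bar>)"
      using log_height_add_le[of t u] G(1) by (simp add: mult.assoc)
    then show ?thesis using G(2)[OF that, of "t + u"] unfolding Im_vertical_diff_g by linarith
  qed
  with G(1) show ?thesis by (rule that)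
qed

lemma increment_limit:
  "AE u in lborel. \<exists>L. ((\<lambda>\<sigma>. Im (vertical_diff h g (Complex \<sigma> (t + u)))) \<longlongrightarrow> L) (at_right (1/2)) \<and>
    pi * (S (t + u + h) - S (t + u - h)) - 2 * pi \<le> L"
  using AE_not_zeta_zero_ordinate[of "t + h"] AE_not_zeta_zero_ordinate[of "t - h"]
proof eventually_elim
  case (elim u)
  then have "\<not> zeta_zero_ordinate (t + u + h)" "\<not> zeta_zero_ordinate (t + u - h)"
    by (simp_all add: algebra_simps)
  from Im_g_increment_limit[OF this] show ?case unfolding Im_vertical_diff_g by blast
qed

lemma smoothed_increment_limit_ge:
  assumes a: "a \<ge> 0" and G: "G \<ge> 0"
    and window: "\<And>u. \<bar>u\<bar> \<le> H \<Longrightarrow> - a \<le> pi * (S (t + u + h) - S (t + u - h)) - 2 * pi"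
    and lower: "\<And>\<sigma> u. 1/2 < \<sigma> \<Longrightarrow> \<sigma> \<le> 3/4 \<Longrightarrow>
      - (G * (1 + \<bar>u\<bar>)) \<le> Im (vertical_diff h g (Complex \<sigma> (t + u)))"
  shows "AE u in lborel.
    \<exists>L. ((\<lambda>\<sigma>. K u * Im (vertical_diff h g (Complex \<sigma> (t + u)))) \<longlongrightarrow> L) (at_right (1/2)) \<and>
      - a * K u - G * (indicator {u. H < \<bar>u\<bar>} u * (K u * (1 + \<bar>u\<bar>))) \<le> L"
  using increment_limit[of t]
proof eventually_elim
  case (elim u)
  then obtain L where S_le: "pi * (S (t + u + h) - S (t + u - h)) - 2 * pi \<le> L"
    and L: "((\<lambda>\<sigma>. Im (vertical_diff h g (Complex \<sigma> (t + u)))) \<longlongrightarrow> L) (at_right (1/2))"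
    by blast
  have "\<forall>\<^sub>F \<sigma> in at_right (1/2).
      - (G * (1 + \<bar>u\<bar>)) \<le> Im (vertical_diff h g (Complex \<sigma> (t + u)))"
    using eventually_at_right_real[of "1/2" "3/4"] by (auto elim!: eventually_mono intro: lower)
  then have "- (G * (1 + \<bar>u\<bar>)) \<le> L" by (intro tendsto_lowerbound[OF L]) auto
  then have "K u * (- (G * (1 + \<bar>u\<bar>))) \<le> K u * L" by (intro mult_left_mono K_nonneg)
  moreover have "K u * (- a) \<le> K u * L" if "\<bar>u\<bar> \<le> H"
    using window[OF that] S_le by (intro mult_left_mono K_nonneg) auto
  moreover have "a * K u \<ge> 0" using a K_nonneg by simp
  ultimately have "- a * K u - G * (indicator {u. H < \<bar>u\<bar>} u * (K u * (1 + \<bar>u\<bar>))) \<le> K u * L"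
    by (cases "H < \<bar>u\<bar>") (auto simp: mult_ac)
  moreover have "((\<lambda>\<sigma>. K u * Im (vertical_diff h g (Complex \<sigma> (t + u)))) \<longlongrightarrow> K u * L)
      (at_right (1/2))"
    by (intro tendsto_intros L)
  ultimately show ?case by blast
qed

lemma smoothed_lower_bound:
  assumes a: "a \<ge> 0" and G: "G \<ge> 0"
    and window: "\<And>u. \<bar>u\<bar> \<le> H \<Longrightarrow> - a \<le> pi * (S (t + u + h) - S (t + u - h)) - 2 * pi"
    and lower: "\<And>\<sigma> u. 1/2 < \<sigma> \<Longrightarrow> \<sigma> \<le> 3/4 \<Longrightarrow>
      - (G * (1 + \<bar>u\<bar>)) \<le> Im (vertical_diff h g (Complex \<sigma> (t + u)))"
  shows "- a * K_hat 0 - G * K_tail H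
    \<le> 2 * Re (pole_integral (Complex (1/2) t)) - 2 * Re (prime_sum (Complex (1/2) t))"
proof -
  let ?f = "\<lambda>\<sigma> u. K u * Im (vertical_diff h g (Complex \<sigma> (t + u)))"
  let ?A = "{1/2<..<3/4::real}"
  let ?\<psi> = "\<lambda>u. - a * K u - G * (indicator {u. H < \<bar>u\<bar>} u * (K u * (1 + \<bar>u\<bar>)))"
  have A: "at (1/2) within ?A = at_right (1/2)"
    by (rule at_within_nhd[of _ "{0<..<3/4}"]) auto
  have "(\<integral>u. ?\<psi> u \<partial>lborel)
      \<le> 2 * Re (pole_integral (Complex (1/2) t)) - 2 * Re (prime_sum (Complex (1/2) t))"
  proof (rule integral_le_limit_of_integrals[of ?A _ ?f])
    show "integrable lborel (?f \<sigma>)" if "\<sigma> \<in> ?A" for \<sigma>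
      using that by (intro smoothed_increment(1)) auto
    show "integrable lborel (\<lambda>u. G * (K u * (1 + \<bar>u\<bar>)))"
      by (intro integrable_mult_right K_moment_integrable)
    show "integrable lborel ?\<psi>"
      by (intro Bochner_Integration.integrable_diff integrable_mult_right K_integrable
            K_tail_integrable)
    show "- (G * (K u * (1 + \<bar>u\<bar>))) \<le> ?f \<sigma> u" if "\<sigma> \<in> ?A" for \<sigma> u
      using mult_left_mono[OF lower[of \<sigma> u] K_nonneg[of u]] that by (simp add: mult_ac)
    show "AE u in lborel. \<exists>L. ((\<lambda>\<sigma>. ?f \<sigma> u) \<longlongrightarrow> L) (at (1/2) within ?A) \<and> ?\<psi> u \<le> L"
      unfolding A using assms by (rule smoothed_increment_limit_ge)
    have "\<forall>\<^sub>F \<sigma> in at_right (1/2). 2 * Re (pole_integral (Complex \<sigma> t))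
        - 2 * Re (prime_sum (Complex \<sigma> t)) = (\<integral>u. ?f \<sigma> u \<partial>lborel)"
      using eventually_at_right_real[of "1/2" "3/4"]
      by (auto elim!: eventually_mono simp: smoothed_increment(2))
    then show "((\<lambda>\<sigma>. \<integral>u. ?f \<sigma> u \<partial>lborel) \<longlongrightarrow> 2 * Re (pole_integral (Complex (1/2) t))
        - 2 * Re (prime_sum (Complex (1/2) t))) (at (1/2) within ?A)"
      unfolding A by (rule Lim_transform_eventually[OF smoothed_increment_tendsto])
  qed (simp add: A)
  moreover have "(\<integral>u. ?\<psi> u \<partial>lborel) = - a * K_hat 0 - G * K_tail H"
    using integral_K K_integrable K_tail_integrable[of H] by (simp add: K_tail_def)
  ultimately show ?thesis by simp
qed

lemma critical_line_inequality:
  obtains E where "E > 0" "\<And>t H a. a \<ge> 0 \<Longrightarrow>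
    (\<forall>\<tau>. \<bar>\<tau> - t\<bar> \<le> H \<longrightarrow> - a \<le> pi * (S (\<tau> + h) - S (\<tau> - h)) - 2 * pi) \<Longrightarrow>
    - a * K_hat 0 - E * log_height t * exp (- (c / 2) * exp (pi * H))
      \<le> 2 * Re (pole_integral (Complex (1/2) t)) - 2 * Re (prime_sum (Complex (1/2) t))"
proof -
  obtain G where G: "G > 0" "\<And>\<sigma> t u. 1/2 < \<sigma> \<Longrightarrow> \<sigma> \<le> 3/4 \<Longrightarrow>
      - (G * log_height t * (1 + \<bar>u\<bar>)) \<le> Im (vertical_diff h g (Complex \<sigma> (t + u)))"
    using increment_lower_bound by blast
  obtain J where J: "J \<ge> 0" "\<And>H. K_tail H \<le> J * exp (- (c / 2) * exp (pi * H))"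
    using K_tail_le by blast
  show ?thesis
  proof (rule that[of "G * (J + 1)"])
    show "G * (J + 1) > 0" using G(1) J(1) by simp
    fix t H a :: real
    assume a: "a \<ge> 0"
      and window: "\<forall>\<tau>. \<bar>\<tau> - t\<bar> \<le> H \<longrightarrow> - a \<le> pi * (S (\<tau> + h) - S (\<tau> - h)) - 2 * pi"
    let ?Z = "exp (- (c / 2) * exp (pi * H))"
    have log_height: "0 \<le> log_height t" using log_height_ge_1[of t] by linarith
    have "K_tail H \<le> (J + 1) * ?Z" using J(2)[of H] by (simp add: distrib_right add_increasing2)
    then have "G * log_height t * K_tail H \<le> G * log_height t * ((J + 1) * ?Z)"
      using G(1) log_height by (intro mult_left_mono) auto
    moreover have "- a * K_hat 0 - G * log_height t * K_tail H
        \<le> 2 * Re (pole_integral (Complex (1/2) t)) - 2 * Re (prime_sum (Complex (1/2) t))"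
      using G log_height window by (intro smoothed_lower_bound a) auto
    ultimately show "- a * K_hat 0 - G * (J + 1) * log_height t * ?Z
        \<le> 2 * Re (pole_integral (Complex (1/2) t)) - 2 * Re (prime_sum (Complex (1/2) t))"
      by (simp add: mult_ac)
  qed
qed

lemma pole_integral_vanishes: "((\<lambda>t. Re (pole_integral (Complex (1/2) t))) \<longlongrightarrow> 0) at_top"
proof -
  let ?w = "\<lambda>x. pole_weight x * exp (x / 2)"
  have "((\<lambda>t. \<integral>x. ?w x * cos (t * x) \<partial>lborel) \<longlongrightarrow> 0) at_top"
  proof (rule Riemann_Lebesgue_cos[of ?w "h * C"])
    show "?w \<in> borel_measurable borel" by measurable
    show "\<bar>?w x\<bar> \<le> h * C / (1 + x\<^sup>2)" for x by (rule abs_pole_weight_exp_le)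
    have "AE x in lborel. x \<noteq> (0::real)" by (rule AE_lborel_singleton)
    then show "AE x in lborel. isCont ?w x"
    proof eventually_elim
      case (elim x)
      have "continuous_on {0<..} (\<lambda>x. wsinc h x * K_hat x * exp (x / 2))"
        by (intro continuous_intros wsinc_continuous continuous_on_subset[OF K_hat_continuous]) auto
      then have "continuous_on {0<..} ?w"
        by (rule continuous_on_eq) (simp add: pole_weight_def)
      moreover have "continuous_on {..<0} ?w"
        by (rule continuous_on_eq[OF continuous_on_const[of _ 0]]) (simp add: pole_weight_def)
      ultimately have "continuous_on ({0<..} \<union> {..<0}) ?w"
        by (intro continuous_on_open_Un) auto
      then show ?case
        using elim by (subst (asm) continuous_on_eq_continuous_at) (auto simp: neq_iff)
    qed
  qed
  moreover have "Complex (1/2) t - 1 = Complex (- (1/2)) t" for t by (simp add: complex_eq_iff)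
  ultimately show ?thesis
    using laplace_transform.Re_laplace(2)[OF pole_weight_laplace, of "Complex (- (1/2)) t" for t]
    by (simp add: pole_integral_def)
qed

lemma prime_sum_terms_summable:
  "summable (\<lambda>n. \<bar>prime_weight n * exp (- (1/2) * ln (real n))\<bar>)"
  using laplace_transform.integrable_abscissa[OF prime_weight_laplace]
  by (simp add: integrable_count_space_nat_iff)

lemma Re_prime_sum:
  "Re (prime_sum (Complex (1/2) t))
    = (\<Sum>n. prime_weight n * exp (- (1/2) * ln (real n)) * cos (t * ln (real n)))"
  using laplace_transform.Re_laplace[OF prime_weight_laplace, of "Complex (1/2) t"]
  by (simp add: prime_sum_def integral_count_space_nat)

lemma prime_sum_almost_periods:
  assumes \<delta>: "\<delta> > 0"
  obtains l where "\<And>T. \<exists>t. \<bar>t - T\<bar> \<le> l \<and>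
    Re (prime_sum (Complex (1/2) t)) \<ge> Re (prime_sum (Complex (1/2) 0)) - \<delta>"
  using cosine_series_almost_periods[OF prime_sum_terms_summable \<delta>, of "\<lambda>n. ln (real n)"] that
  unfolding Re_prime_sum by auto

end

lemma log_height_mult_double_exp_le:
  assumes c: "c > 0" and T: "T > 1" "ln (ln T) > 0" and t: "\<bar>t\<bar> + 3 \<le> T\<^sup>2"
  shows "log_height t * exp (- (c / 2) * exp (pi * (1 / pi * ln (ln (ln T)) + ln (4 / c) / pi)))
    \<le> 2 / ln T"
proof -
  have lnT: "ln T > 0" using T(1) by simp
  have "pi * (1 / pi * ln (ln (ln T)) + ln (4 / c) / pi) = ln (ln (ln T)) + ln (4 / c)"
    by (simp add: distrib_left)
  then have "exp (pi * (1 / pi * ln (ln (ln T)) + ln (4 / c) / pi)) = ln (ln T) * (4 / c)"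
    using T lnT c by (simp add: exp_add)
  then have "- (c / 2) * exp (pi * (1 / pi * ln (ln (ln T)) + ln (4 / c) / pi))
      = - ln (ln T) - ln (ln T)"
    using c by simp
  then have double_exp: "exp (- (c / 2) * exp (pi * (1 / pi * ln (ln (ln T)) + ln (4 / c) / pi)))
      = 1 / ln T * (1 / ln T)"
    using lnT by (simp only: exp_diff exp_minus exp_ln) (simp add: field_simps)
  have "log_height t \<le> ln (T\<^sup>2)"
    unfolding log_height_def using t T(1) by (subst ln_le_cancel_iff) auto
  also have "ln (T\<^sup>2) = 2 * ln T" using T(1) by (simp add: ln_realpow)
  finally have "log_height t * (1 / ln T * (1 / ln T)) \<le> 2 * ln T * (1 / ln T * (1 / ln T))"
    using lnT by (intro mult_right_mono) auto
  then show ?thesis unfolding double_exp using lnT by simp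
qed

lemma eventually_double_exp_negligible:
  assumes c: "c > 0" and E: "E > 0" and \<delta>: "\<delta> > 0"
  shows "\<forall>\<^sub>F T in at_top. \<forall>t. \<bar>t - T\<bar> \<le> l \<longrightarrow>
    E * log_height t * exp (- (c / 2) * exp (pi * (1 / pi * ln (ln (ln T)) + ln (4 / c) / pi))) < \<delta>"
proof -
  have "((\<lambda>T. E * (2 / ln T)) \<longlongrightarrow> 0) at_top" by real_asymp
  then have "\<forall>\<^sub>F T in at_top. E * (2 / ln T) < \<delta>" by (rule order_tendstoD(2)[OF _ \<delta>])
  moreover have "\<forall>\<^sub>F T in at_top. T + l + 3 \<le> T\<^sup>2" by real_asymp
  moreover have "\<forall>\<^sub>F T in at_top. T > (1::real)" by (rule eventually_gt_at_top)
  moreover have "\<forall>\<^sub>F T in at_top. ln (ln T) > (0::real)" by real_asymp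
  ultimately show ?thesis
  proof eventually_elim
    case (elim T)
    show ?case
    proof (intro allI impI)
      fix t assume t: "\<bar>t - T\<bar> \<le> l"
      let ?Z = "exp (- (c / 2) * exp (pi * (1 / pi * ln (ln (ln T)) + ln (4 / c) / pi)))"
      have "E * (log_height t * ?Z) \<le> E * (2 / ln T)"
        using E elim t by (intro mult_left_mono log_height_mult_double_exp_le c) auto
      then show "E * log_height t * ?Z < \<delta>" using elim(1) unfolding mult.assoc by linarith
    qed
  qed
qed

section \<open>Large negative increments\<close>

lemma (in smoothed) eventually_small_increment:
  assumes a: "a \<ge> 0" and large: "Re (prime_sum (Complex (1/2) 0)) > (a + 1) * K_hat 0"
  obtains c\<^sub>0 where "\<forall>\<^sub>F T in at_top. \<exists>\<tau>. \<bar>\<tau> - T\<bar> \<le> 1 / pi * ln (ln (ln T)) + c\<^sub>0 \<and>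
    pi * (S (\<tau> + h) - S (\<tau> - h)) - 2 * pi < - a"
proof -
  let ?\<delta> = "K_hat 0 / 4"
  have \<delta>: "?\<delta> > 0" using K_hat_0 by simp
  obtain E where E: "E > 0" and inequality: "\<And>t H a. a \<ge> 0 \<Longrightarrow>
      (\<forall>\<tau>. \<bar>\<tau> - t\<bar> \<le> H \<longrightarrow> - a \<le> pi * (S (\<tau> + h) - S (\<tau> - h)) - 2 * pi) \<Longrightarrow>
      - a * K_hat 0 - E * log_height t * exp (- (c / 2) * exp (pi * H))
        \<le> 2 * Re (pole_integral (Complex (1/2) t)) - 2 * Re (prime_sum (Complex (1/2) t))"
    by (rule critical_line_inequality, rule that)
  obtain l where l: "\<And>T. \<exists>t. \<bar>t - T\<bar> \<le> l \<and>
      Re (prime_sum (Complex (1/2) t)) \<ge> Re (prime_sum (Complex (1/2) 0)) - ?\<delta>"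
    by (rule prime_sum_almost_periods[OF \<delta>], rule that)
  have "\<forall>\<^sub>F t in at_top. Re (pole_integral (Complex (1/2) t)) < ?\<delta>"
    by (rule order_tendstoD(2)[OF pole_integral_vanishes \<delta>])
  then obtain T\<^sub>1 where T\<^sub>1: "\<And>t. t \<ge> T\<^sub>1 \<Longrightarrow> Re (pole_integral (Complex (1/2) t)) < ?\<delta>"
    by (auto simp: eventually_at_top_linorder)
  have "\<forall>\<^sub>F T in at_top. \<forall>t. \<bar>t - T\<bar> \<le> l \<longrightarrow> E * log_height t *
      exp (- (c / 2) * exp (pi * (1 / pi * ln (ln (ln T)) + ln (4 / c) / pi))) < ?\<delta>"
    by (rule eventually_double_exp_negligible[OF c_pos E \<delta>])
  moreover have "\<forall>\<^sub>F T in at_top. T \<ge> T\<^sub>1 + l" by (rule eventually_ge_at_top)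
  ultimately have "\<forall>\<^sub>F T in at_top. \<exists>\<tau>. \<bar>\<tau> - T\<bar> \<le> 1 / pi * ln (ln (ln T)) + (l + ln (4 / c) / pi) \<and>
      pi * (S (\<tau> + h) - S (\<tau> - h)) - 2 * pi < - a"
  proof eventually_elim
    case (elim T)
    let ?H = "1 / pi * ln (ln (ln T)) + ln (4 / c) / pi"
    obtain t where t: "\<bar>t - T\<bar> \<le> l"
      "Re (prime_sum (Complex (1/2) t)) \<ge> Re (prime_sum (Complex (1/2) 0)) - ?\<delta>"
      using l by blast
    have tail: "E * log_height t * exp (- (c / 2) * exp (pi * ?H)) < ?\<delta>"
      using elim(1) t(1) by blast
    have pole: "Re (pole_integral (Complex (1/2) t)) < ?\<delta>" using elim t(1) by (intro T\<^sub>1) auto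
    have "a * K_hat 0 \<ge> 0" using a K_hat_0 by simp
    then have "\<not> - a * K_hat 0 - E * log_height t * exp (- (c / 2) * exp (pi * ?H))
        \<le> 2 * Re (pole_integral (Complex (1/2) t)) - 2 * Re (prime_sum (Complex (1/2) t))"
      using tail pole large t(2) \<delta> by (simp add: distrib_right)
    then have "\<not> (\<forall>\<tau>. \<bar>\<tau> - t\<bar> \<le> ?H \<longrightarrow> - a \<le> pi * (S (\<tau> + h) - S (\<tau> - h)) - 2 * pi)"
      using inequality[OF a, of t ?H] by blast
    then obtain \<tau> where "\<bar>\<tau> - t\<bar> \<le> ?H" "pi * (S (\<tau> + h) - S (\<tau> - h)) - 2 * pi < - a"
      by (auto simp: not_le)
    then show ?case using t(1) by (intro exI[of _ \<tau>]) linarith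
  qed
  then show ?thesis by (rule that)
qed

theorem theorem4:
  assumes RH: "riemann_hypothesis"
  shows "\<forall>A::real. A \<ge> 1 \<longrightarrow>
    (\<exists>T\<^sub>0 c\<^sub>0 h :: real. h > 0 \<and>
      (\<forall>T\<ge>T\<^sub>0. let H = 1 / pi * ln (ln (ln T)) + c\<^sub>0 in
        (INF t \<in> {t. \<bar>t - T\<bar> \<le> H}. ereal (S (t + h) - S (t - h))) < ereal (- A)))"
proof (intro allI impI)
  fix A :: real assume A: "A \<ge> 1"
  define a where "a = pi * A + 2 * pi"
  obtain K K_hat B c C h where kernel: "kernel K K_hat B c C" and h: "h > 0"
    and large: "(\<Sum>n. log_coeff n * K_hat (ln (real n)) * exp (- (1/2) * ln (real n)) *
      sin (ln (real n) * h)) > (a + 1) * K_hat 0"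
    using kernel_with_large_prime_sine_series by blast
  obtain g where "log_zeta_branch g" using log_zeta_branch_exists[OF RH] by blast
  then interpret smoothed K K_hat B c C g h
    using kernel h by (intro smoothed.intro smoothed_axioms.intro)
  have "Re (prime_sum (Complex (1/2) 0)) > (a + 1) * K_hat 0"
    using large by (simp add: Re_prime_sum prime_weight_def mult_ac)
  moreover have "a \<ge> 0" using A by (simp add: a_def)
  ultimately obtain c\<^sub>0 where "\<forall>\<^sub>F T in at_top. \<exists>\<tau>. \<bar>\<tau> - T\<bar> \<le> 1 / pi * ln (ln (ln T)) + c\<^sub>0 \<and>
      pi * (S (\<tau> + h) - S (\<tau> - h)) - 2 * pi < - a"
    using eventually_small_increment by blast
  moreover have "S (\<tau> + h) - S (\<tau> - h) < - A"
    if "pi * (S (\<tau> + h) - S (\<tau> - h)) - 2 * pi < - a" for \<tau>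
  proof -
    have "pi * (S (\<tau> + h) - S (\<tau> - h)) < pi * (- A)" using that by (simp add: a_def)
    then show ?thesis by (simp only: mult_less_cancel_left_pos[OF pi_gt_zero])
  qed
  ultimately have "\<forall>\<^sub>F T in at_top.
      \<exists>\<tau>. \<bar>\<tau> - T\<bar> \<le> 1 / pi * ln (ln (ln T)) + c\<^sub>0 \<and> S (\<tau> + h) - S (\<tau> - h) < - A"
    by (blast intro: eventually_mono)
  then have "\<forall>\<^sub>F T in at_top. (INF t \<in> {t. \<bar>t - T\<bar> \<le> 1 / pi * ln (ln (ln T)) + c\<^sub>0}.
      ereal (S (t + h) - S (t - h))) < ereal (- A)"
    by (simp add: INF_less_iff)
  then show "\<exists>T\<^sub>0 c\<^sub>0 h :: real. h > 0 \<and>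
      (\<forall>T\<ge>T\<^sub>0. let H = 1 / pi * ln (ln (ln T)) + c\<^sub>0 in
        (INF t \<in> {t. \<bar>t - T\<bar> \<le> H}. ereal (S (t + h) - S (t - h))) < ereal (- A))"
    using h unfolding eventually_at_top_linorder Let_def by blast
qed

end
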